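(* Let $(M,\omega)$ be a closed connected symplectic manifold equipped with a Riemannian metric $g$. Let $(U^i,\mathcal H^i)$, $i\ge1$, be a sequence in $\mathfrak T(M,\omega,g)$ which is Cauchy in $D^1$. Given $\epsilon>0$, there exist positive constants $\delta=\delta(\{(U^i,\mathcal H^i)\})$ and $j_0=j_0(\{(U^i,\mathcal H^i)\})$ such that if $\xi_1,\xi_2:[0,1]\to[0,1]$ are two monotone smooth functions satisfying $\|\xi_1-\xi_2\|_{ham}<\delta$, then $$D^1\big((U^i,\mathcal H^i)^{\xi_1},(U^i,\mathcal H^i)^{\xi_2}\big)<\epsilon\quad\text{for all } i\ge j_0.$$
   Context: $M$ is closed of dimension $2n$. Let $\mathcal H^1(M,g)$ be the space of $g$-harmonic $1$-forms; fix a basis $(h_i)$ and put $|\sum_i\lambda_ih_i|:=\sum_i|\lambda_i|$. $\mathfrak T(M,\omega,g)$ is the set of pairs $(U,\mathcal H)$ with $U:[0,1]\times M\to\mathbb R$ smooth, $\int_MU_t\,\omega^n=0$ for all $t$, and $\mathcal H:[0,1]\to\mathcal H^1(M,g)$ smooth. Each $(U,\mathcal H)$ generates a unique symplectic isotopy $\phi_{(U,\mathcal H)}=\{\phi_t\}$, $\phi_0=\mathrm{id}$, determined by $\iota(\dot\phi_t)\omega=dU_t+\mathcal H_t$ with $\dot\phi_t=\frac{d\phi_t}{dt}\circ\phi_t^{-1}$; $(U,\mathcal H)$ is its generator. $\overline{(U,\mathcal H)}$ denotes the generator of the inverse isotopy $\{\phi_t^{-1}\}$; explicitly $\overline{(U,\mathcal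 H)}=(-U\circ\phi_{(U,\mathcal H)}-\widetilde\Delta(\mathcal H,\phi_{(U,\mathcal H)}),-\mathcal H)$, where $\Delta_t(\mathcal H,\{\phi_s\})=\int_0^t\mathcal H_t(\dot\phi_s)\circ\phi_s\,ds$ and $\widetilde\Delta_t$ is $\Delta_t$ minus its mean value with respect to $\omega^n$. For smooth $\xi:[0,1]\to[0,1]$, $(U,\mathcal H)^\xi:=(U^\xi,\mathcal H^\xi)$ with $U^\xi_t=\dot\xi(t)U_{\xi(t)}$, $\mathcal H^\xi_t=\dot\xi(t)\mathcal H_{\xi(t)}$. For a curve $\xi:[0,1]\to\mathbb R$, $\|\xi\|_{ham}=\sup_t|\xi(t)|+\int_0^1|\dot\xi(t)|dt$. With $\mathrm{osc}(f)=\max f-\min f$, $$D_0((U,\mathcal H),(V,\mathcal K))=\int_0^1\big(\mathrm{osc}(U_t-V_t)+|\mathcal H_t-\mathcal K_t|\big)dt,$$ $$D^1((U,\mathcal H),(V,\mathcal K))=\tfrac12\Big(D_0((U,\mathcal H),(V,\mathcal K))+D_0(\overline{(U,\mathcal H)},\overline{(V,\mathcal K)})\Big).$$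
   Formalization: The literal D^1 estimate is proved when ξ_1(0)=ξ_2(0)=0; it can fail otherwise, since (U,H)^ξ then generates φ_{ξ(t)}∘φ_{ξ(0)}^{-1}. For all monotone ξ_1, ξ_2 the estimate is proved with the reparametrised inverse generator in place of the inverse of the reparametrised one. *)

theory Defs
  imports "HOL-Analysis.Analysis"
begin

section \<open>Smooth maps between subsets of normed spaces\<close>

text \<open>Only meant for open \<open>S\<close> and finite-dimensional domains, where it is the usual notion of
  being \<open>k\<close> times continuously differentiable.\<close>

primrec C_k_on :: "nat \<Rightarrow> 'a::real_normed_vector set \<Rightarrow> ('a \<Rightarrow> 'b::real_normed_vector) \<Rightarrow> bool" where
  "C_k_on 0 S f \<longleftrightarrow> continuous_on S f"
| "C_k_on (Suc k) S f \<longleftrightarrow> (\<forall>x\<in>S. f differentiable (at x)) \<and>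
     (\<forall>v. C_k_on k S (\<lambda>x. frechet_derivative f (at x) v))"

text \<open>Smoothness on an arbitrary set (such as \<open>[0,1] \<times> W\<close>): locally the restriction of a smooth
  map on an open set.\<close>

definition smooth_on :: "'a::real_normed_vector set \<Rightarrow> ('a \<Rightarrow> 'b::real_normed_vector) \<Rightarrow> bool" where
  "smooth_on S f \<longleftrightarrow> (\<forall>x\<in>S. \<exists>W F. open W \<and> x \<in> W \<and> (\<forall>k. C_k_on k W F) \<and> (\<forall>y\<in>W \<inter> S. F y = f y))"

definition pd :: "'n::finite \<Rightarrow> (real^'n \<Rightarrow> real) \<Rightarrow> real^'n \<Rightarrow> real" where
  "pd i f x = frechet_derivative f (at x) (axis i 1)"

section \<open>Manifolds and tensor fields\<close>

type_synonym ('m, 'n) chart = "'m set \<times> ('m \<Rightarrow> real^'n)"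

definition cdom :: "('m, 'n) chart \<Rightarrow> 'm set" where "cdom c = fst c"
definition cmap :: "('m, 'n) chart \<Rightarrow> 'm \<Rightarrow> real^'n" where "cmap c = snd c"
definition cimg :: "('m, 'n) chart \<Rightarrow> (real^'n) set" where "cimg c = cmap c ` cdom c"
definition cinv :: "('m, 'n) chart \<Rightarrow> real^'n \<Rightarrow> 'm" where "cinv c = inv_into (cdom c) (cmap c)"

definition smooth_atlas :: "('m::topological_space, 'n::finite) chart set \<Rightarrow> bool" where
  "smooth_atlas A \<longleftrightarrow> (\<Union>c\<in>A. cdom c) = UNIV \<and>
     (\<forall>c\<in>A. open (cdom c) \<and> open (cimg c) \<and> homeomorphism (cdom c) (cimg c) (cmap c) (cinv c)) \<and>
     (\<forall>c\<in>A. \<forall>d\<in>A. smooth_on (cmap c ` (cdom c \<inter> cdom d)) (cmap d \<circ> cinv c))"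

text \<open>The manifold is the whole type \<open>'m\<close>.\<close>

definition closed_connected_manifold ::
  "('m::{t2_space, second_countable_topology}, 'n::finite) chart set \<Rightarrow> bool" where
  "closed_connected_manifold A \<longleftrightarrow>
     smooth_atlas A \<and> compact (UNIV :: 'm set) \<and> connected (UNIV :: 'm set)"

definition chart_at :: "('m, 'n) chart set \<Rightarrow> 'm \<Rightarrow> ('m, 'n) chart" where
  "chart_at A p = (SOME c. c \<in> A \<and> p \<in> cdom c)"

definition transition_deriv ::
  "('m, 'n::finite) chart \<Rightarrow> ('m, 'n) chart \<Rightarrow> real^'n \<Rightarrow> real^'n \<Rightarrow> real^'n" where
  "transition_deriv c d x = frechet_derivative (cmap d \<circ> cinv c) (at x)"

text \<open>Covariant tensor fields are families of coordinate expressions: \<open>\<alpha> c x v\<close> is the value of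
  \<open>\<alpha>\<close> at the point with coordinates \<open>x\<close> in the chart \<open>c\<close>, on the tangent vector with
  coordinates \<open>v\<close> in that chart.\<close>

type_synonym ('m, 'n) tensor1 = "('m, 'n) chart \<Rightarrow> real^'n \<Rightarrow> real^'n \<Rightarrow> real"
type_synonym ('m, 'n) tensor2 = "('m, 'n) chart \<Rightarrow> real^'n \<Rightarrow> real^'n \<Rightarrow> real^'n \<Rightarrow> real"

text \<open>The last clause makes a 1-form vanish at arguments without geometric meaning, so that
  equality of 1-forms is equality of functions.\<close>

definition one_form :: "('m, 'n::finite) chart set \<Rightarrow> ('m, 'n) tensor1 \<Rightarrow> bool" where
  "one_form A \<alpha> \<longleftrightarrow>
     (\<forall>c\<in>A. \<forall>x\<in>cimg c. linear (\<alpha> c x)) \<and>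
     (\<forall>c\<in>A. \<forall>v. smooth_on (cimg c) (\<lambda>x. \<alpha> c x v)) \<and>
     (\<forall>c\<in>A. \<forall>d\<in>A. \<forall>x\<in>cmap c ` (cdom c \<inter> cdom d). \<forall>v.
        \<alpha> c x v = \<alpha> d (cmap d (cinv c x)) (transition_deriv c d x v)) \<and>
     (\<forall>c x v. \<not> (c \<in> A \<and> x \<in> cimg c) \<longrightarrow> \<alpha> c x v = 0)"

definition smooth_tensor2 :: "('m, 'n::finite) chart set \<Rightarrow> ('m, 'n) tensor2 \<Rightarrow> bool" where
  "smooth_tensor2 A \<beta> \<longleftrightarrow>
     (\<forall>c\<in>A. \<forall>x\<in>cimg c. bilinear (\<beta> c x)) \<and>
     (\<forall>c\<in>A. \<forall>v w. smooth_on (cimg c) (\<lambda>x. \<beta> c x v w)) \<and>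
     (\<forall>c\<in>A. \<forall>d\<in>A. \<forall>x\<in>cmap c ` (cdom c \<inter> cdom d). \<forall>v w.
        \<beta> c x v w = \<beta> d (cmap d (cinv c x)) (transition_deriv c d x v) (transition_deriv c d x w))"

definition symplectic_form :: "('m, 'n::finite) chart set \<Rightarrow> ('m, 'n) tensor2 \<Rightarrow> bool" where
  "symplectic_form A \<omega> \<longleftrightarrow> smooth_tensor2 A \<omega> \<and>
     (\<forall>c\<in>A. \<forall>x\<in>cimg c. \<forall>v. \<omega> c x v v = 0) \<and>
     (\<forall>c\<in>A. \<forall>x\<in>cimg c. \<forall>v. v \<noteq> 0 \<longrightarrow> (\<exists>w. \<omega> c x v w \<noteq> 0)) \<and>
     (\<forall>c\<in>A. \<forall>x\<in>cimg c. \<forall>u v w.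
        frechet_derivative (\<lambda>y. \<omega> c y v w) (at x) u +
        frechet_derivative (\<lambda>y. \<omega> c y w u) (at x) v +
        frechet_derivative (\<lambda>y. \<omega> c y u v) (at x) w = 0)"

definition riemannian_metric :: "('m, 'n::finite) chart set \<Rightarrow> ('m, 'n) tensor2 \<Rightarrow> bool" where
  "riemannian_metric A g \<longleftrightarrow> smooth_tensor2 A g \<and>
     (\<forall>c\<in>A. \<forall>x\<in>cimg c. \<forall>v w. g c x v w = g c x w v) \<and>
     (\<forall>c\<in>A. \<forall>x\<in>cimg c. \<forall>v. v \<noteq> 0 \<longrightarrow> g c x v v > 0)"

text \<open>The differential of a function on the manifold, in the chart \<open>c\<close>.\<close>

definition dfun :: "('m \<Rightarrow> real) \<Rightarrow> ('m, 'n::finite) tensor1" where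
  "dfun f c x v = frechet_derivative (f \<circ> cinv c) (at x) v"

section \<open>Harmonic 1-forms\<close>

definition gram :: "('m, 'n::finite) tensor2 \<Rightarrow> ('m, 'n) chart \<Rightarrow> real^'n \<Rightarrow> real^'n^'n" where
  "gram g c x = (\<chi> i j. g c x (axis i 1) (axis j 1))"

definition vol_density :: "('m, 'n::finite) tensor2 \<Rightarrow> ('m, 'n) chart \<Rightarrow> real^'n \<Rightarrow> real" where
  "vol_density g c x = sqrt (det (gram g c x))"

definition gram_inv :: "('m, 'n::finite) tensor2 \<Rightarrow> ('m, 'n) chart \<Rightarrow> real^'n \<Rightarrow> real^'n^'n" where
  "gram_inv g c x = matrix_inv (gram g c x)"

text \<open>Components \<open>\<partial>\<^sub>i \<alpha>\<^sub>j - \<partial>\<^sub>j \<alpha>\<^sub>i\<close> of the exterior derivative of a 1-form.\<close>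

definition ext_deriv1 ::
  "('m, 'n::finite) tensor1 \<Rightarrow> ('m, 'n) chart \<Rightarrow> real^'n \<Rightarrow> 'n \<Rightarrow> 'n \<Rightarrow> real" where
  "ext_deriv1 \<alpha> c x i j = pd i (\<lambda>y. \<alpha> c y (axis j 1)) x - pd j (\<lambda>y. \<alpha> c y (axis i 1)) x"

text \<open>The codifferential (the formal adjoint of \<open>d\<close>) on 1-forms, minus the divergence: with
  \<open>G = det g\<close>, it is \<open>- G\<^sup>-\<^sup>1\<^sup>/\<^sup>2 \<partial>\<^sub>i (G\<^sup>1\<^sup>/\<^sup>2 g\<^sup>i\<^sup>j \<alpha>\<^sub>j)\<close>.\<close>

definition codiff1 ::
  "('m, 'n::finite) tensor2 \<Rightarrow> ('m, 'n) tensor1 \<Rightarrow> ('m, 'n) chart \<Rightarrow> real^'n \<Rightarrow> real" where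
  "codiff1 g \<alpha> c x = - (1 / vol_density g c x) *
     (\<Sum>i\<in>UNIV. pd i (\<lambda>y. vol_density g c y *
        (\<Sum>j\<in>UNIV. gram_inv g c y $ i $ j * \<alpha> c y (axis j 1))) x)"

text \<open>The codifferential on 2-forms, with components
  \<open>- g\<^sub>l\<^sub>k G\<^sup>-\<^sup>1\<^sup>/\<^sup>2 \<partial>\<^sub>i (G\<^sup>1\<^sup>/\<^sup>2 g\<^sup>i\<^sup>a g\<^sup>k\<^sup>b \<beta>\<^sub>a\<^sub>b)\<close>; here \<open>\<beta> y a b\<close> are the components of the
  2-form in the chart \<open>c\<close>.\<close>

definition codiff2 ::
  "('m, 'n::finite) tensor2 \<Rightarrow> (real^'n \<Rightarrow> 'n \<Rightarrow> 'n \<Rightarrow> real) \<Rightarrow> ('m, 'n) chart \<Rightarrow> real^'n \<Rightarrow> 'n \<Rightarrow> real" where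
  "codiff2 g \<beta> c x l = - (1 / vol_density g c x) *
     (\<Sum>k\<in>UNIV. gram g c x $ l $ k *
       (\<Sum>i\<in>UNIV. pd i (\<lambda>y. vol_density g c y *
          (\<Sum>a\<in>UNIV. \<Sum>b\<in>UNIV. gram_inv g c y $ i $ a * gram_inv g c y $ k $ b * \<beta> y a b)) x))"

definition hodge_laplacian1 ::
  "('m, 'n::finite) tensor2 \<Rightarrow> ('m, 'n) tensor1 \<Rightarrow> ('m, 'n) chart \<Rightarrow> real^'n \<Rightarrow> 'n \<Rightarrow> real" where
  "hodge_laplacian1 g \<alpha> c x l = pd l (codiff1 g \<alpha> c) x + codiff2 g (ext_deriv1 \<alpha> c) c x l"

definition harmonic_forms ::
  "('m, 'n::finite) chart set \<Rightarrow> ('m, 'n) tensor2 \<Rightarrow> ('m, 'n) tensor1 set" where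
  "harmonic_forms A g =
     {\<alpha>. one_form A \<alpha> \<and> (\<forall>c\<in>A. \<forall>x\<in>cimg c. \<forall>l. hodge_laplacian1 g \<alpha> c x l = 0)}"

definition lin_comb :: "nat \<Rightarrow> (nat \<Rightarrow> ('m, 'n) tensor1) \<Rightarrow> (nat \<Rightarrow> real) \<Rightarrow> ('m, 'n) tensor1" where
  "lin_comb m h l = (\<lambda>c x v. \<Sum>i<m. l i * h i c x v)"

definition harmonic_basis ::
  "('m, 'n::finite) chart set \<Rightarrow> ('m, 'n) tensor2 \<Rightarrow> nat \<Rightarrow> (nat \<Rightarrow> ('m, 'n) tensor1) \<Rightarrow> bool" where
  "harmonic_basis A g m h \<longleftrightarrow>
     (\<forall>i<m. h i \<in> harmonic_forms A g) \<and>
     (\<forall>\<alpha>\<in>harmonic_forms A g. \<exists>l. \<alpha> = lin_comb m h l) \<and>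
     (\<forall>l. lin_comb m h l = (\<lambda>c x v. 0) \<longrightarrow> (\<forall>i<m. l i = 0))"

definition hcoords :: "nat \<Rightarrow> (nat \<Rightarrow> ('m, 'n) tensor1) \<Rightarrow> ('m, 'n) tensor1 \<Rightarrow> nat \<Rightarrow> real" where
  "hcoords m h \<alpha> = (THE l. \<alpha> = lin_comb m h l \<and> (\<forall>i\<ge>m. l i = 0))"

definition hnorm :: "nat \<Rightarrow> (nat \<Rightarrow> ('m, 'n) tensor1) \<Rightarrow> ('m, 'n) tensor1 \<Rightarrow> real" where
  "hnorm m h \<alpha> = (\<Sum>i<m. \<bar>hcoords m h \<alpha> i\<bar>)"

section \<open>The volume form \<open>\<omega>\<^sup>n\<close> and integration against it\<close>

text \<open>\<open>\<omega>\<^sup>n\<close> evaluated on the coordinate frame of the chart \<open>c\<close>, taken in some order: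
  \<open>\<omega>\<^sup>n(e\<^sub>1,\<dots>,e\<^sub>2\<^sub>n) = 2\<^sup>-\<^sup>n \<Sum>\<^sub>\<sigma> sgn(\<sigma>) \<Prod>\<^sub>i \<omega>(e\<^sub>\<sigma>\<^sub>(\<^sub>2\<^sub>i\<^sub>-\<^sub>1\<^sub>),e\<^sub>\<sigma>\<^sub>(\<^sub>2\<^sub>i\<^sub>))\<close>. The order affects only the sign.\<close>

definition omega_power :: "('m, 'n::finite) tensor2 \<Rightarrow> nat \<Rightarrow> ('m, 'n) chart \<Rightarrow> real^'n \<Rightarrow> real" where
  "omega_power \<omega> n c x =
     (let e = (\<lambda>k. axis ((SOME f. bij_betw f {..<2 * n} (UNIV :: 'n set)) k) 1 :: real^'n)
      in (1 / 2 ^ n) * (\<Sum>s | s permutes {..<2 * n}.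
           real_of_int (sign s) * (\<Prod>i<n. \<omega> c x (e (s (2 * i))) (e (s (2 * i + 1))))))"

text \<open>Since the manifold is oriented by \<open>\<omega>\<^sup>n\<close>, integrating the top-degree form \<open>f \<omega>\<^sup>n\<close> is
  integrating \<open>f\<close> against the Borel measure with density \<open>\<bar>\<omega>\<^sup>n\<bar>\<close> in every chart.\<close>

definition liouville ::
  "('m::topological_space, 'n::finite) chart set \<Rightarrow> ('m, 'n) tensor2 \<Rightarrow> nat \<Rightarrow> 'm measure" where
  "liouville A \<omega> n = (THE \<mu>. sets \<mu> = sets borel \<and>
     (\<forall>c\<in>A. \<forall>B\<in>sets borel. B \<subseteq> cdom c \<longrightarrow>
        emeasure \<mu> B = (\<integral>\<^sup>+ x. ennreal \<bar>omega_power \<omega> n c x\<bar> * indicator (cmap c ` B) x \<partial>lborel)))"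

definition mean_value ::
  "('m::topological_space, 'n::finite) chart set \<Rightarrow> ('m, 'n) tensor2 \<Rightarrow> nat \<Rightarrow> ('m \<Rightarrow> real) \<Rightarrow> real" where
  "mean_value A \<omega> n f =
     (\<integral>p. f p \<partial>liouville A \<omega> n) / measure (liouville A \<omega> n) UNIV"

section \<open>Generators and the isotopies they generate\<close>

type_synonym ('m, 'n) generator = "(real \<Rightarrow> 'm \<Rightarrow> real) \<times> (real \<Rightarrow> ('m, 'n) tensor1)"

text \<open>Everything depends on the values at times in \<open>[0,1]\<close> only. A curve in the
  finite-dimensional space of harmonic forms is smooth iff its coordinates are.\<close>

definition generators :: "('m::topological_space, 'n::finite) chart set \<Rightarrow> ('m, 'n) tensor2 \<Rightarrow>
    ('m, 'n) tensor2 \<Rightarrow> nat \<Rightarrow> nat \<Rightarrow> (nat \<Rightarrow> ('m, 'n) tensor1) \<Rightarrow> ('m, 'n) generator set" where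
  "generators A \<omega> g n m h = {(U, H).
     (\<forall>c\<in>A. smooth_on ({0..1} \<times> cimg c) (\<lambda>(t, x). U t (cinv c x))) \<and>
     (\<forall>t\<in>{0..1}. (\<integral>p. U t p \<partial>liouville A \<omega> n) = 0) \<and>
     (\<forall>t\<in>{0..1}. H t \<in> harmonic_forms A g) \<and>
     (\<forall>i<m. smooth_on {0..1} (\<lambda>t. hcoords m h (H t) i))}"

text \<open>\<open>\<phi>\<^sub>0 = id\<close>, and at every point \<open>\<phi>\<^sub>t(p)\<close> the velocity \<open>w\<close> of \<open>t \<mapsto> \<phi>\<^sub>t(p)\<close> satisfies
  \<open>\<omega>(w, \<cdot>) = dU\<^sub>t + H\<^sub>t\<close>. This ordinary differential equation determines \<open>\<phi>\<close> on \<open>[0,1]\<close>;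
  that \<open>\<phi>\<close> is a smooth isotopy by symplectic diffeomorphisms is a consequence.\<close>

definition generates :: "('m::topological_space, 'n::finite) chart set \<Rightarrow> ('m, 'n) tensor2 \<Rightarrow>
    ('m, 'n) generator \<Rightarrow> (real \<Rightarrow> 'm \<Rightarrow> 'm) \<Rightarrow> bool" where
  "generates A \<omega> G \<phi> \<longleftrightarrow>
     (\<forall>p. \<phi> 0 p = p) \<and>
     (\<forall>p. continuous_on {0..1} (\<lambda>t. \<phi> t p)) \<and>
     (\<forall>p. \<forall>t\<in>{0..1}. \<forall>c\<in>A. \<phi> t p \<in> cdom c \<longrightarrow>
        (\<exists>w. ((\<lambda>s. cmap c (\<phi> s p)) has_vector_derivative w) (at t within {0..1}) \<and>
             (\<forall>v. \<omega> c (cmap c (\<phi> t p)) w v =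
                  dfun (fst G t) c (cmap c (\<phi> t p)) v + snd G t c (cmap c (\<phi> t p)) v)))"

definition isotopy :: "('m::topological_space, 'n::finite) chart set \<Rightarrow> ('m, 'n) tensor2 \<Rightarrow>
    ('m, 'n) generator \<Rightarrow> real \<Rightarrow> 'm \<Rightarrow> 'm" where
  "isotopy A \<omega> G = (SOME \<phi>. generates A \<omega> G \<phi>)"

definition velocity :: "('m, 'n::finite) chart \<Rightarrow> (real \<Rightarrow> 'm \<Rightarrow> 'm) \<Rightarrow> real \<Rightarrow> 'm \<Rightarrow> real^'n" where
  "velocity c \<phi> t p = vector_derivative (\<lambda>s. cmap c (\<phi> s p)) (at t within {0..1})"

definition Delta :: "('m, 'n::finite) chart set \<Rightarrow> (real \<Rightarrow> ('m, 'n) tensor1) \<Rightarrow>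
    (real \<Rightarrow> 'm \<Rightarrow> 'm) \<Rightarrow> real \<Rightarrow> 'm \<Rightarrow> real" where
  "Delta A H \<phi> t p = integral {0..t} (\<lambda>s.
     let c = chart_at A (\<phi> s p) in H t c (cmap c (\<phi> s p)) (velocity c \<phi> s p))"

definition Delta_normalized :: "('m::topological_space, 'n::finite) chart set \<Rightarrow> ('m, 'n) tensor2 \<Rightarrow>
    nat \<Rightarrow> (real \<Rightarrow> ('m, 'n) tensor1) \<Rightarrow> (real \<Rightarrow> 'm \<Rightarrow> 'm) \<Rightarrow> real \<Rightarrow> 'm \<Rightarrow> real" where
  "Delta_normalized A \<omega> n H \<phi> t p = Delta A H \<phi> t p - mean_value A \<omega> n (Delta A H \<phi> t)"

text \<open>The generator of the inverse isotopy.\<close>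

definition inverse_generator :: "('m::topological_space, 'n::finite) chart set \<Rightarrow> ('m, 'n) tensor2 \<Rightarrow>
    nat \<Rightarrow> ('m, 'n) generator \<Rightarrow> ('m, 'n) generator" where
  "inverse_generator A \<omega> n G =
     ((\<lambda>t p. - fst G t (isotopy A \<omega> G t p) - Delta_normalized A \<omega> n (snd G) (isotopy A \<omega> G) t p),
      (\<lambda>t c x v. - snd G t c x v))"

text \<open>If \<open>G\<close> generates \<open>\<phi>\<close>, then \<open>reparam \<xi> G\<close> satisfies the generator equation for
  \<open>t \<mapsto> \<phi>\<^bsub>\<xi>(t)\<^esub>\<close>, and \<open>reparam \<xi> (inverse_generator A \<omega> n G)\<close> that for the inverses
  \<open>t \<mapsto> (\<phi>\<^bsub>\<xi>(t)\<^esub>)\<^sup>-\<^sup>1\<close>. If \<open>\<xi>(0) = 0\<close>, the latter is \<open>inverse_generator A \<omega> n (reparam \<xi> G)\<close>. For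
  \<open>\<xi>(0) \<noteq> 0\<close> it is not, since the isotopy of \<open>reparam \<xi> G\<close> that starts at \<open>id\<close> is
  \<open>\<phi>\<^bsub>\<xi>(t)\<^esub> \<circ> (\<phi>\<^bsub>\<xi>(0)\<^esub>)\<^sup>-\<^sup>1\<close>.\<close>

definition reparam :: "(real \<Rightarrow> real) \<Rightarrow> ('m, 'n) generator \<Rightarrow> ('m, 'n) generator" where
  "reparam \<xi> G =
     ((\<lambda>t p. vector_derivative \<xi> (at t within {0..1}) * fst G (\<xi> t) p),
      (\<lambda>t c x v. vector_derivative \<xi> (at t within {0..1}) * snd G (\<xi> t) c x v))"

section \<open>Distances\<close>

definition ham_norm :: "(real \<Rightarrow> real) \<Rightarrow> real" where
  "ham_norm \<xi> = (SUP t\<in>{0..1}. \<bar>\<xi> t\<bar>) +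
     integral {0..1} (\<lambda>t. \<bar>vector_derivative \<xi> (at t within {0..1})\<bar>)"

definition osc :: "('m \<Rightarrow> real) \<Rightarrow> real" where
  "osc f = (SUP p. f p) - (INF p. f p)"

definition D0 :: "nat \<Rightarrow> (nat \<Rightarrow> ('m, 'n) tensor1) \<Rightarrow> ('m, 'n) generator \<Rightarrow> ('m, 'n) generator \<Rightarrow> real" where
  "D0 m h G K = integral {0..1} (\<lambda>t.
     osc (\<lambda>p. fst G t p - fst K t p) + hnorm m h (\<lambda>c x v. snd G t c x v - snd K t c x v))"

definition D1 :: "('m::topological_space, 'n::finite) chart set \<Rightarrow> ('m, 'n) tensor2 \<Rightarrow> nat \<Rightarrow>
    nat \<Rightarrow> (nat \<Rightarrow> ('m, 'n) tensor1) \<Rightarrow> ('m, 'n) generator \<Rightarrow> ('m, 'n) generator \<Rightarrow> real" where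
  "D1 A \<omega> n m h G K =
     (D0 m h G K + D0 m h (inverse_generator A \<omega> n G) (inverse_generator A \<omega> n K)) / 2"

definition D1_Cauchy :: "('m::topological_space, 'n::finite) chart set \<Rightarrow> ('m, 'n) tensor2 \<Rightarrow> nat \<Rightarrow>
    nat \<Rightarrow> (nat \<Rightarrow> ('m, 'n) tensor1) \<Rightarrow> (nat \<Rightarrow> ('m, 'n) generator) \<Rightarrow> bool" where
  "D1_Cauchy A \<omega> n m h G \<longleftrightarrow>
     (\<forall>e>0. \<exists>N. \<forall>i\<ge>N. \<forall>j\<ge>N. D1 A \<omega> n m h (G i) (G j) < e)"

definition monotone_reparam :: "(real \<Rightarrow> real) \<Rightarrow> bool" where
  "monotone_reparam \<xi> \<longleftrightarrow> smooth_on {0..1} \<xi> \<and> \<xi> ` {0..1} \<subseteq> {0..1} \<and>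
     (mono_on {0..1} \<xi> \<or> antimono_on {0..1} \<xi>)"

end

theory Submission
  imports Defs
begin

text \<open>Monotone reparametrisation does not increase \<open>D\<^sub>0\<close>, by substitution. So all \<open>G\<^sub>i\<close> with large
  \<open>i\<close> may be compared with one fixed \<open>G\<^sub>J\<close>, for which the distance between \<open>G\<^sub>J\<^bsup>\<xi>\<^sub>1\<^esup>\<close> and
  \<open>G\<^sub>J\<^bsup>\<xi>\<^sub>2\<^esup>\<close> is small because \<open>G\<^sub>J\<close> is bounded and Lipschitz in time. For the inverse generators
  this requires \<open>U\<^sub>t(\<phi>\<^sub>t(p))\<close> and \<open>\<Delta>\<^sub>t(p)\<close> to be Lipschitz in \<open>t\<close> uniformly in \<open>p\<close>, which follows
  from bounds on the generating vector field in finitely many charts; no regularity in \<open>p\<close> is needed,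
  and the mean value of \<open>\<Delta>\<^sub>t\<close> is invisible to the oscillation. The isotopy itself exists and is unique
  by Picard's theorem in charts, with a uniform time step. If \<open>\<xi>(0) = 0\<close>, uniqueness identifies the
  isotopy of the reparametrised generator with \<open>\<phi>\<^bsub>\<xi>(t)\<^esub>\<close>.\<close>

section \<open>Smooth and Lipschitz maps\<close>

text \<open>The speeds of \<xi>1 and \<xi>2 are not bounded in advance, and the Lipschitz constants
  of the G_i may grow with i. So neither may enter \<delta>: terms containing G_i - G_J are handled
  by substitution, which costs nothing because a monotone map into [0,1] has total variation at most
  1, and quantitative regularity is used for G_J alone. There the sup part of the ham norm controls
  the change of time and its integral part the change of speed. The obstacle on the inverse side is
  that \<Delta>_t depends on t twice, through the upper limit and through the form H_t. Expanding
  H_t in the harmonic basis separates them: \<Delta>_t is the sum over k of the k-th coordinate of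
  H_t times the integral over [0,t] of h_k applied to the velocity. This is a finite sum of products
  of Lipschitz functions of t, and under a change of time the coordinate contributes the factor
  \<xi>'(t) while the integral is transformed by substitution. Thus, if \<xi>(0) = 0, the
  unnormalised potential of the inverse transforms exactly like U, and one estimate for abstract
  paths serves both halves of \<open>D1\<close>.\<close>

lemma linear_onorm_le_sum_Basis:
  fixes D :: "'a::euclidean_space \<Rightarrow> 'b::real_normed_vector"
  assumes "linear D"
  shows "onorm D \<le> (\<Sum>b\<in>Basis. norm (D b))"
proof (rule onorm_le)
  fix x :: 'a
  have "D x = D (\<Sum>b\<in>Basis. (x \<bullet> b) *\<^sub>R b)"
    by (simp add: euclidean_representation)
  also have "\<dots> = (\<Sum>b\<in>Basis. (x \<bullet> b) *\<^sub>R D b)"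
    using assms by (simp add: linear_sum linear_scale)
  finally have "norm (D x) \<le> (\<Sum>b\<in>Basis. norm ((x \<bullet> b) *\<^sub>R D b))"
    by (simp only: norm_sum)
  also have "\<dots> \<le> (\<Sum>b\<in>Basis. norm x * norm (D b))"
    by (intro sum_mono) (auto intro!: mult_right_mono Basis_le_norm)
  finally show "norm (D x) \<le> (\<Sum>b\<in>Basis. norm (D b)) * norm x"
    by (simp add: sum_distrib_left mult.commute)
qed

text \<open>Smoothness on \<open>T\<close> gives an extension only near each point, and different
  extensions need not agree off \<open>T\<close>; hence the derivative is taken within
  \<open>T\<close>. It is bounded near \<open>z\<close> because its finitely many values on
  \<open>Basis\<close> are continuous and dominate the operator norm.\<close>

lemma smooth_on_local_derivative_bound:
  fixes f :: "'a::euclidean_space \<Rightarrow> 'b::real_normed_vector"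
  assumes "smooth_on T f" "z \<in> T"
  shows "\<exists>V C. open V \<and> z \<in> V \<and>
    (\<forall>x\<in>V \<inter> T. \<exists>D. (f has_derivative D) (at x within T) \<and> onorm D \<le> C)"
proof -
  obtain W F where W: "open W" "z \<in> W" "\<And>k. C_k_on k W F" "\<And>y. y \<in> W \<inter> T \<Longrightarrow> F y = f y"
    using assms unfolding smooth_on_def by metis
  let ?D = "\<lambda>x. frechet_derivative F (at x)"
  have diff: "F differentiable (at x)" if "x \<in> W" for x
    using W(3)[of 1] that by auto
  have cont: "continuous_on W (\<lambda>x. ?D x v)" for v
    using W(3)[of 1] by auto
  \<comment> \<open>The slack 1 turns continuity at \<open>z\<close> into a bound on a whole
    neighbourhood.\<close>
  define C where "C = (\<Sum>b\<in>Basis. norm (?D z b) + 1)"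
  have "\<forall>\<^sub>F x in nhds z. norm (?D x b) < norm (?D z b) + 1" for b
  proof -
    have "isCont (\<lambda>x. norm (?D x b)) z"
      using cont[of b] W(1,2) by (simp add: continuous_on_eq_continuous_at)
    then have "((\<lambda>x. norm (?D x b)) \<longlongrightarrow> norm (?D z b)) (nhds z)"
      unfolding isCont_def by (rule tendsto_at_iff_tendsto_nhds[THEN iffD1])
    then show ?thesis
      by (rule order_tendstoD) simp
  qed
  then have "\<forall>\<^sub>F x in nhds z. x \<in> W \<and> (\<forall>b\<in>Basis. norm (?D x b) < norm (?D z b) + 1)"
    using W(1,2) by (intro eventually_conj eventually_ball_finite eventually_nhds_in_open) auto
  then obtain V where V: "open V" "z \<in> V"
    "\<And>x. x \<in> V \<Longrightarrow> x \<in> W \<and> (\<forall>b\<in>Basis. norm (?D x b) < norm (?D z b) + 1)"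
    unfolding eventually_nhds by blast
  have "(f has_derivative ?D x) (at x within T) \<and> onorm (?D x) \<le> C" if x: "x \<in> V \<inter> T" for x
  proof
    have xW: "x \<in> W"
      using V(3) x by blast
    then obtain e where e: "e > 0" "ball x e \<subseteq> W"
      using W(1) openE by blast
    have F: "(F has_derivative ?D x) (at x within T)"
      using diff[OF xW] by (simp add: frechet_derivative_works has_derivative_at_withinI)
    show "(f has_derivative ?D x) (at x within T)"
      by (rule has_derivative_transform_within[OF F e(1)])
        (use x e W(4) in \<open>auto simp: dist_commute subset_eq\<close>)
    have "linear (?D x)"
      using diff[OF xW] by (rule linear_frechet_derivative)
    then have "onorm (?D x) \<le> (\<Sum>b\<in>Basis. norm (?D x b))"
      by (rule linear_onorm_le_sum_Basis)
    also have "\<dots> \<le> C"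
      unfolding C_def using V(3) x by (intro sum_mono) (auto intro: less_imp_le)
    finally show "onorm (?D x) \<le> C" .
  qed
  then show ?thesis
    using V(1,2) by blast
qed

text \<open>Finitely many of the local derivative bounds cover \<open>K\<close>, and on a convex set
  the mean value inequality turns a bound on the derivative within \<open>K\<close> into a Lipschitz
  constant.\<close>

lemma smooth_on_imp_lipschitz_on:
  fixes f :: "'a::euclidean_space \<Rightarrow> 'b::real_normed_vector"
  assumes "smooth_on T f" "compact K" "convex K" "K \<subseteq> T"
  shows "\<exists>L. L-lipschitz_on K f"
proof -
  have "\<forall>z\<in>K. \<exists>V C. open V \<and> z \<in> V \<and>
      (\<forall>x\<in>V \<inter> T. \<exists>D. (f has_derivative D) (at x within T) \<and> onorm D \<le> C)"
    using smooth_on_local_derivative_bound[OF assms(1)] assms(4) by blast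
  then obtain V C where V: "\<And>z. z \<in> K \<Longrightarrow> open (V z) \<and> z \<in> V z"
    "\<And>z x. z \<in> K \<Longrightarrow> x \<in> V z \<inter> T \<Longrightarrow>
       \<exists>D. (f has_derivative D) (at x within T) \<and> onorm D \<le> C z"
    by metis
  have "\<exists>I\<subseteq>K. finite I \<and> K \<subseteq> (\<Union>z\<in>I. V z)"
    by (rule compactE_image[OF assms(2), of K V]) (use V(1) in auto)
  then obtain I where I: "I \<subseteq> K" "finite I" "K \<subseteq> (\<Union>z\<in>I. V z)"
    by blast
  \<comment> \<open>A sum instead of a maximum, so that an empty \<open>K\<close> needs no separate
    case.\<close>
  define L where "L = (\<Sum>z\<in>I. \<bar>C z\<bar>)"
  have "\<exists>D. (f has_derivative D) (at x within K) \<and> onorm D \<le> L" if x: "x \<in> K" for x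
  proof -
    obtain z where z: "z \<in> I" "x \<in> V z"
      using I(3) x by blast
    then obtain D where D: "(f has_derivative D) (at x within T)" "onorm D \<le> C z"
      using V(2)[of z x] I(1) x assms(4) by blast
    have "C z \<le> \<bar>C z\<bar>" by simp
    also have "\<dots> \<le> L"
      unfolding L_def using I(2) z(1) by (intro member_le_sum) auto
    finally show ?thesis
      using D has_derivative_subset[OF D(1) assms(4)] by fastforce
  qed
  then obtain D where D: "\<And>x. x \<in> K \<Longrightarrow> (f has_derivative D x) (at x within K) \<and> onorm (D x) \<le> L"
    by metis
  have "L-lipschitz_on K f"
  proof (rule lipschitz_onI)
    fix x y assume "x \<in> K" "y \<in> K"
    then show "dist (f x) (f y) \<le> L * dist x y"
      unfolding dist_norm by (intro differentiable_bound[OF assms(3)]) (use D in auto)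
  qed (simp add: L_def sum_nonneg)
  then show ?thesis ..
qed

lemma smooth_on_imp_continuous_on:
  assumes "smooth_on T f"
  shows "continuous_on T f"
  unfolding continuous_on_eq_continuous_within
proof
  fix x assume x: "x \<in> T"
  obtain W F where W: "open W" "x \<in> W" "C_k_on 0 W F" "\<And>y. y \<in> W \<inter> T \<Longrightarrow> F y = f y"
    using assms x unfolding smooth_on_def by metis
  then obtain e where e: "e > 0" "ball x e \<subseteq> W"
    using openE by blast
  have "isCont F x"
    using W(1-3) by (simp add: continuous_on_eq_continuous_at)
  then have "continuous (at x within T) F"
    by (rule continuous_at_imp_continuous_at_within)
  then show "continuous (at x within T) f"
    by (rule continuous_transform_within[OF _ e(1) x])
      (use e W(4) in \<open>auto simp: dist_commute subset_eq\<close>)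
qed

lemma smooth_on_open_differentiable:
  assumes "smooth_on S f" "open S" "x \<in> S"
  shows "f differentiable (at x)"
proof -
  obtain W F where W: "open W" "x \<in> W" "C_k_on 1 W F" "\<And>y. y \<in> W \<inter> S \<Longrightarrow> F y = f y"
    using assms unfolding smooth_on_def by metis
  have "F differentiable (at x)"
    using W by auto
  then have "(F has_derivative frechet_derivative F (at x)) (at x)"
    by (simp add: frechet_derivative_works)
  then have "(f has_derivative frechet_derivative F (at x)) (at x)"
    by (rule has_derivative_transform_within_open[of _ _ _ _ "W \<inter> S"]) (use W assms in auto)
  then show ?thesis
    by (auto simp: differentiable_def)
qed

text \<open>Gives dU_t and its smoothness in (t, x) up to the ends of the time interval. Since
  \<open>S\<close> is open, differentiation in x is unrestricted even where t is an endpoint, and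
  the derivative of a local extension in direction (0, v) is itself a smooth extension of the
  partial derivative.\<close>

lemma smooth_on_partial_derivative:
  fixes f :: "real \<times> 'a::euclidean_space \<Rightarrow> 'b::real_normed_vector"
  assumes f: "smooth_on (T \<times> S) f" and S: "open S"
  shows "t \<in> T \<Longrightarrow> x \<in> S \<Longrightarrow> (\<lambda>x. f (t, x)) differentiable (at x)"
    and "smooth_on (T \<times> S) (\<lambda>(t, x). frechet_derivative (\<lambda>x. f (t, x)) (at x) v)"
proof -
  have key: "\<exists>W F. open W \<and> z \<in> W \<and> (\<forall>k. C_k_on k W F) \<and>
     (\<forall>t x. (t, x) \<in> W \<inter> T \<times> S \<longrightarrow>
        ((\<lambda>x. f (t, x)) has_derivative (\<lambda>v. frechet_derivative F (at (t, x)) (0, v))) (at x))"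
    if z: "z \<in> T \<times> S" for z
  proof -
    obtain W F where W: "open W" "z \<in> W" "\<And>k. C_k_on k W F" "\<And>y. y \<in> W \<inter> T \<times> S \<Longrightarrow> F y = f y"
      using assms z unfolding smooth_on_def by metis
    have "((\<lambda>x. f (t, x)) has_derivative (\<lambda>v. frechet_derivative F (at (t, x)) (0, v))) (at x)"
      if tx: "(t, x) \<in> W \<inter> T \<times> S" for t x
    proof -
      have "F differentiable (at (t, x))"
        using W(3)[of 1] tx by auto
      then have "(F has_derivative frechet_derivative F (at (t, x))) (at (t, x))"
        by (simp add: frechet_derivative_works)
      moreover have "(Pair t has_derivative (\<lambda>v. (0, v))) (at x)"
        by (auto intro!: derivative_eq_intros)
      ultimately have "((F \<circ> Pair t) has_derivative (frechet_derivative F (at (t, x)) \<circ> (\<lambda>v. (0, v)))) (at x)"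
        by (intro diff_chain_at)
      then have F: "((F \<circ> Pair t) has_derivative (\<lambda>v. frechet_derivative F (at (t, x)) (0, v))) (at x)"
        by (simp add: o_def)
      have "open (Pair t -` W \<inter> S)"
        by (intro open_Int open_vimage W(1) S) (auto intro!: continuous_intros)
      with F show ?thesis
        by (rule has_derivative_transform_within_open) (use tx W(4) in auto)
    qed
    with W show ?thesis
      by blast
  qed
  show "t \<in> T \<Longrightarrow> x \<in> S \<Longrightarrow> (\<lambda>x. f (t, x)) differentiable (at x)"
    using key[of "(t, x)"] by (auto simp: differentiable_def)
  show "smooth_on (T \<times> S) (\<lambda>(t, x). frechet_derivative (\<lambda>x. f (t, x)) (at x) v)"
    unfolding smooth_on_def
  proof
    fix z assume "z \<in> T \<times> S"
    from key[OF this] obtain W F where W: "open W" "z \<in> W" "\<And>k. C_k_on k W F"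
      and D: "\<And>t x. (t, x) \<in> W \<inter> T \<times> S \<Longrightarrow>
        ((\<lambda>x. f (t, x)) has_derivative (\<lambda>v. frechet_derivative F (at (t, x)) (0, v))) (at x)"
      by metis
    show "\<exists>W F. open W \<and> z \<in> W \<and> (\<forall>k. C_k_on k W F) \<and>
       (\<forall>y\<in>W \<inter> T \<times> S. F y = (case y of (t, x) \<Rightarrow> frechet_derivative (\<lambda>x. f (t, x)) (at x) v))"
    proof (intro exI conjI allI ballI)
      show "open W" "z \<in> W"
        by fact+
      show "C_k_on k W (\<lambda>z. frechet_derivative F (at z) (0, v))" for k
        using W(3)[of "Suc k"] by simp
    next
      fix y assume y: "y \<in> W \<inter> T \<times> S"
      show "frechet_derivative F (at y) (0, v) =
          (case y of (t, x) \<Rightarrow> frechet_derivative (\<lambda>x. f (t, x)) (at x) v)"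
      proof (cases y)
        case (Pair t x)
        then have "((\<lambda>x. f (t, x)) has_derivative (\<lambda>v. frechet_derivative F (at (t, x)) (0, v))) (at x)"
          using D y by blast
        from frechet_derivative_at[OF this] Pair show ?thesis
          by (simp add: fun_eq_iff)
      qed
    qed
  qed
qed

text \<open>Derivatives within [0,1] are unique, also at the ends. So the derivatives of all local
  extensions agree with \<open>vector_derivative\<close> on [0,1], and its continuity is inherited
  from them.\<close>

lemma smooth_on_real_interval_derivative:
  fixes f :: "real \<Rightarrow> real"
  assumes "smooth_on {0..1} f"
  shows "t \<in> {0..1} \<Longrightarrow>
      (f has_real_derivative vector_derivative f (at t within {0..1})) (at t within {0..1})"
    and "continuous_on {0..1} (\<lambda>t. vector_derivative f (at t within {0..1}))"
proof -
  have key: "\<exists>W F. open W \<and> z \<in> W \<and> continuous_on W (\<lambda>x. frechet_derivative F (at x) 1) \<and>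
     (\<forall>t\<in>W \<inter> {0..1}. (f has_vector_derivative frechet_derivative F (at t) 1) (at t within {0..1}))"
    if z: "z \<in> {0..1}" for z
  proof -
    obtain W F where W: "open W" "z \<in> W" "C_k_on 1 W F" "\<And>y. y \<in> W \<inter> {0..1} \<Longrightarrow> F y = f y"
      using assms z unfolding smooth_on_def by metis
    have "(f has_vector_derivative frechet_derivative F (at t) 1) (at t within {0..1})"
      if t: "t \<in> W \<inter> {0..1}" for t
    proof -
      obtain e where e: "e > 0" "ball t e \<subseteq> W"
        using openE W(1) t by blast
      have "F differentiable (at t)"
        using W(3) t by auto
      then have "(F has_vector_derivative vector_derivative F (at t)) (at t)"
        by (simp add: vector_derivative_works)
      moreover from \<open>F differentiable (at t)\<close>
      have "frechet_derivative F (at t) 1 = vector_derivative F (at t)"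
        by (simp add: frechet_derivative_eq_vector_derivative)
      ultimately have "(F has_vector_derivative frechet_derivative F (at t) 1) (at t within {0..1})"
        by (simp add: has_vector_derivative_at_within)
      then show ?thesis
        by (rule has_vector_derivative_transform_within[OF _ e(1)])
          (use t e W(4) in \<open>auto simp: dist_commute subset_eq\<close>)
    qed
    with W show ?thesis
      by (intro exI[of _ W] exI[of _ F]) auto
  qed
  have eq: "vector_derivative f (at t within {0..1}) = w"
    if "t \<in> {0..1}" "(f has_vector_derivative w) (at t within {0..1})" for t w
    using vector_derivative_within_cbox[of 0 1 t] that by simp
  show "(f has_real_derivative vector_derivative f (at t within {0..1})) (at t within {0..1})"
    if "t \<in> {0..1}"
    using key[OF that] eq[OF that] that
    by (metis IntI has_real_derivative_iff_has_vector_derivative)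
  show "continuous_on {0..1} (\<lambda>t. vector_derivative f (at t within {0..1}))"
    unfolding continuous_on_eq_continuous_within
  proof
    fix t :: real assume t: "t \<in> {0..1}"
    obtain W F where W: "open W" "t \<in> W" "continuous_on W (\<lambda>x. frechet_derivative F (at x) 1)"
      "\<And>t. t \<in> W \<inter> {0..1} \<Longrightarrow> (f has_vector_derivative frechet_derivative F (at t) 1) (at t within {0..1})"
      using key[OF t] by blast
    obtain e where e: "e > 0" "ball t e \<subseteq> W"
      using openE W(1,2) by blast
    have "continuous (at t within {0..1}) (\<lambda>x. frechet_derivative F (at x) 1)"
      using W(1-3) by (simp add: continuous_on_eq_continuous_at continuous_at_imp_continuous_at_within)
    then show "continuous (at t within {0..1}) (\<lambda>t. vector_derivative f (at t within {0..1}))"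
    proof (rule continuous_transform_within[OF _ e(1) t])
      fix s assume that: "s \<in> {0..1}" "dist s t < e"
      have "s \<in> W \<inter> {0..1}"
        using that e(2) by (auto simp: dist_commute subset_eq)
      from eq[OF that(1) W(4)[OF this]]
      show "frechet_derivative F (at s) 1 = vector_derivative f (at s within {0..1})" ..
    qed
  qed
qed

section \<open>Calculus of Lipschitz and bounded maps\<close>

abbreviation lipschitz :: "'a::metric_space set \<Rightarrow> ('a \<Rightarrow> 'b::metric_space) \<Rightarrow> bool" where
  "lipschitz K f \<equiv> \<exists>L. L-lipschitz_on K f"

lemma lipschitz_imp_bounded:
  fixes f :: "'a::metric_space \<Rightarrow> 'b::real_normed_vector"
  assumes "lipschitz K f" "compact K"
  shows "\<exists>B\<ge>0. \<forall>x\<in>K. norm (f x) \<le> B"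
proof -
  have "bounded (f ` K)"
    using assms by (auto intro: compact_imp_bounded compact_continuous_image lipschitz_on_continuous_on)
  then obtain B where "\<forall>x\<in>K. norm (f x) \<le> B"
    by (auto simp: bounded_iff)
  then show ?thesis
    by (intro exI[of _ "max 0 B"]) auto
qed

text \<open>Products need a sup bound besides the Lipschitz constant. Using one number for both
  makes the property monotone in a single constant, so that the constants of finitely many charts
  can be merged.\<close>

definition lipschitz_bounded :: "real \<Rightarrow> 'a::metric_space set \<Rightarrow> ('a \<Rightarrow> 'b::real_normed_vector) \<Rightarrow> bool" where
  "lipschitz_bounded L K f \<longleftrightarrow> L-lipschitz_on K f \<and> (\<forall>x\<in>K. norm (f x) \<le> L)"

lemma lipschitz_bounded_mono:
  "lipschitz_bounded L K f \<Longrightarrow> K' \<subseteq> K \<Longrightarrow> L \<le> L' \<Longrightarrow> lipschitz_bounded L' K' f"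
  unfolding lipschitz_bounded_def by (auto intro: lipschitz_on_mono order_trans)

lemma lipschitz_bounded_nonneg: "lipschitz_bounded L K f \<Longrightarrow> L \<ge> 0"
  unfolding lipschitz_bounded_def by (auto intro: lipschitz_on_nonneg)

lemma lipschitz_bounded_cong:
  "(\<And>x. x \<in> K \<Longrightarrow> f x = g x) \<Longrightarrow> lipschitz_bounded L K f = lipschitz_bounded L K g"
  by (simp add: lipschitz_bounded_def lipschitz_on_def)

lemma lipschitz_imp_lipschitz_bounded:
  fixes f :: "'a::metric_space \<Rightarrow> 'b::real_normed_vector"
  assumes "lipschitz K f" "compact K"
  shows "\<exists>L. lipschitz_bounded L K f"
proof -
  obtain L B where L: "L-lipschitz_on K f" and B: "\<forall>x\<in>K. norm (f x) \<le> B"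
    using lipschitz_imp_bounded[OF assms] assms(1) by blast
  have "lipschitz_bounded (max L B) K f"
    unfolding lipschitz_bounded_def using B by (auto intro: lipschitz_on_mono[OF L])
  then show ?thesis ..
qed

lemma lipschitz_bounded_mult:
  fixes f g :: "'a::metric_space \<Rightarrow> real"
  assumes f: "lipschitz_bounded L K f" and g: "lipschitz_bounded L' K g"
  shows "lipschitz_bounded (2 * L * L') K (\<lambda>x. f x * g x)"
proof -
  note pos = lipschitz_bounded_nonneg[OF f] lipschitz_bounded_nonneg[OF g]
  have "\<bar>f x * g x - f y * g y\<bar> \<le> 2 * L * L' * dist x y" if xy: "x \<in> K" "y \<in> K" for x y
  proof -
    have "f x * g x - f y * g y = f x * (g x - g y) + g y * (f x - f y)"
      by (simp add: algebra_simps)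
    then have "\<bar>f x * g x - f y * g y\<bar> \<le> \<bar>f x\<bar> * \<bar>g x - g y\<bar> + \<bar>g y\<bar> * \<bar>f x - f y\<bar>"
      by (metis abs_mult abs_triangle_ineq)
    also have "\<dots> \<le> L * (L' * dist x y) + L' * (L * dist x y)"
      using f g xy pos lipschitz_onD[of L K f x y] lipschitz_onD[of L' K g x y]
      by (intro add_mono mult_mono) (auto simp: dist_real_def lipschitz_bounded_def)
    finally show ?thesis
      by (simp add: algebra_simps)
  qed
  moreover have "\<bar>f x * g x\<bar> \<le> 2 * L * L'" if "x \<in> K" for x
  proof -
    have "\<bar>f x * g x\<bar> \<le> L * L'"
      using f g that pos unfolding abs_mult lipschitz_bounded_def by (intro mult_mono) auto
    also have "\<dots> \<le> 2 * L * L'"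
      using pos by simp
    finally show ?thesis .
  qed
  ultimately show ?thesis
    using pos by (auto simp: lipschitz_bounded_def dist_real_def intro!: lipschitz_onI)
qed

lemma lipschitz_mult:
  fixes f g :: "'a::metric_space \<Rightarrow> real"
  assumes "lipschitz K f" "lipschitz K g" "compact K"
  shows "lipschitz K (\<lambda>x. f x * g x)"
proof -
  obtain L L' where "lipschitz_bounded L K f" "lipschitz_bounded L' K g"
    using lipschitz_imp_lipschitz_bounded[OF assms(1,3)] lipschitz_imp_lipschitz_bounded[OF assms(2,3)] by blast
  from lipschitz_bounded_mult[OF this] show ?thesis
    by (auto simp: lipschitz_bounded_def)
qed

lemma lipschitz_add:
  fixes f g :: "'a::metric_space \<Rightarrow> 'b::real_normed_vector"
  assumes "lipschitz K f" "lipschitz K g"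
  shows "lipschitz K (\<lambda>x. f x + g x)"
  using assms lipschitz_on_add by blast

lemma lipschitz_sum:
  fixes f :: "'i \<Rightarrow> 'a::metric_space \<Rightarrow> 'b::real_normed_vector"
  assumes "\<And>i. i \<in> I \<Longrightarrow> lipschitz K (f i)"
  shows "lipschitz K (\<lambda>x. \<Sum>i\<in>I. f i x)"
  using assms
proof (induction I rule: infinite_finite_induct)
  case (insert i I)
  then show ?case
    using lipschitz_add[of K "f i" "\<lambda>x. \<Sum>i\<in>I. f i x"] by simp
qed (auto intro: lipschitz_on_constant)

lemma lipschitz_fst:
  assumes "lipschitz K f"
  shows "lipschitz (K \<times> K') (\<lambda>z. f (fst z))"
proof -
  obtain L where L: "L-lipschitz_on K f"
    using assms by blast
  have "L-lipschitz_on (K \<times> K') (\<lambda>z. f (fst z))"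
  proof (rule lipschitz_onI)
    fix x y assume "x \<in> K \<times> K'" "y \<in> K \<times> K'"
    then have "dist (f (fst x)) (f (fst y)) \<le> L * dist (fst x) (fst y)"
      by (intro lipschitz_onD[OF L]) auto
    also have "\<dots> \<le> L * dist x y"
      using lipschitz_on_nonneg[OF L] by (intro mult_left_mono dist_fst_le)
    finally show "dist (f (fst x)) (f (fst y)) \<le> L * dist x y" .
  qed (rule lipschitz_on_nonneg[OF L])
  then show ?thesis ..
qed

lemma lipschitz_snd:
  assumes "lipschitz K' f"
  shows "lipschitz (K \<times> K') (\<lambda>z. f (snd z))"
proof -
  obtain L where L: "L-lipschitz_on K' f"
    using assms by blast
  have "L-lipschitz_on (K \<times> K') (\<lambda>z. f (snd z))"
  proof (rule lipschitz_onI)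
    fix x y assume "x \<in> K \<times> K'" "y \<in> K \<times> K'"
    then have "dist (f (snd x)) (f (snd y)) \<le> L * dist (snd x) (snd y)"
      by (intro lipschitz_onD[OF L]) auto
    also have "\<dots> \<le> L * dist x y"
      using lipschitz_on_nonneg[OF L] by (intro mult_left_mono dist_snd_le)
    finally show "dist (f (snd x)) (f (snd y)) \<le> L * dist x y" .
  qed (rule lipschitz_on_nonneg[OF L])
  then show ?thesis ..
qed

lemma lipschitz_vec:
  fixes f :: "'a::metric_space \<Rightarrow> ('b::euclidean_space)^'n"
  assumes "\<And>i. lipschitz K (\<lambda>x. f x $ i)"
  shows "lipschitz K f"
proof -
  obtain L where L: "\<And>i. (L i)-lipschitz_on K (\<lambda>x. f x $ i)"
    using assms by metis
  have "(\<Sum>i\<in>UNIV. L i)-lipschitz_on K f"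
  proof (rule lipschitz_onI)
    fix x y assume xy: "x \<in> K" "y \<in> K"
    have "dist (f x) (f y) \<le> (\<Sum>i\<in>UNIV. dist (f x $ i) (f y $ i))"
      unfolding dist_vec_def by (rule L2_set_le_sum) auto
    also have "\<dots> \<le> (\<Sum>i\<in>UNIV. L i * dist x y)"
      by (intro sum_mono lipschitz_onD[OF L xy])
    finally show "dist (f x) (f y) \<le> (\<Sum>i\<in>UNIV. L i) * dist x y"
      by (simp add: sum_distrib_right)
  qed (intro sum_nonneg lipschitz_on_nonneg[OF L])
  then show ?thesis ..
qed

lemma lipschitz_nth:
  fixes f :: "'a::metric_space \<Rightarrow> ('b::euclidean_space)^'n"
  assumes "lipschitz K f"
  shows "lipschitz K (\<lambda>x. f x $ i)"
proof -
  obtain L where L: "L-lipschitz_on K f"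
    using assms by blast
  have "L-lipschitz_on K (\<lambda>x. f x $ i)"
    using lipschitz_onD[OF L] order_trans[OF dist_vec_nth_le]
    by (intro lipschitz_onI lipschitz_on_nonneg[OF L]) blast
  then show ?thesis ..
qed

text \<open>By compactness, injectivity of each \<open>M z\<close> improves to a uniform bound
  \<kappa> |w| \<le> |M(z) w|, where \<kappa> is a minimum over \<open>K\<close> times the unit
  sphere. The difference X(x) - X(y) solves the system with matrix M(x) and right-hand side (b(x) -
  b(y)) - (M(x) - M(y)) X(y), which is of order \<open>dist x y\<close>.\<close>

lemma linear_system_solution_lipschitz:
  fixes M :: "'a::metric_space \<Rightarrow> real^'n^'n" and b X :: "'a \<Rightarrow> real^'n"
  assumes K: "compact K" and M: "lipschitz K M" and b: "lipschitz K b"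
    and sol: "\<And>z. z \<in> K \<Longrightarrow> M z *v X z = b z"
    and inj: "\<And>z w. z \<in> K \<Longrightarrow> M z *v w = 0 \<Longrightarrow> w = 0"
  shows "lipschitz K X"
proof (cases "K = {}")
  case False
  have "bilinear (\<lambda>(A::real^'n^'n) (w::real^'n). A *v w)"
    by (auto simp: bilinear_def linear_iff matrix_vector_mult_add_rdistrib matrix_vector_right_distrib
        scaleR_matrix_vector_assoc vec_eq_iff matrix_vector_mult_def sum_distrib_left sum.distrib algebra_simps)
  then have bb: "bounded_bilinear (\<lambda>(A::real^'n^'n) (w::real^'n). A *v w)"
    by (simp add: bilinear_conv_bounded_bilinear)
  obtain C where C: "C > 0" "\<And>(A::real^'n^'n) (w::real^'n). norm (A *v w) \<le> norm A * norm w * C"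
    using bounded_bilinear.pos_bounded[OF bb] by blast
  obtain LM Lb where LM: "LM-lipschitz_on K M" and Lb: "Lb-lipschitz_on K b"
    using M b by blast
  obtain B where B: "B \<ge> 0" "\<forall>z\<in>K. norm (b z) \<le> B"
    using lipschitz_imp_bounded[OF b K] by blast
  let ?S = "sphere (0::real^'n) 1"
  have "continuous_on (K \<times> ?S) (\<lambda>z. norm (M (fst z) *v snd z))"
    by (intro continuous_on_norm bounded_bilinear.continuous_on[OF bb] continuous_on_snd
        continuous_on_compose2[OF lipschitz_on_continuous_on[OF LM]] continuous_on_fst continuous_on_id) auto
  moreover have "compact (K \<times> ?S)" "K \<times> ?S \<noteq> {}"
    using K False by (auto intro: compact_Times)
  ultimately have "\<exists>z0\<in>K \<times> ?S. \<forall>z\<in>K \<times> ?S. norm (M (fst z0) *v snd z0) \<le> norm (M (fst z) *v snd z)"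
    by (intro continuous_attains_inf)
  then obtain z0 where z0: "z0 \<in> K \<times> ?S"
    "\<And>z. z \<in> K \<times> ?S \<Longrightarrow> norm (M (fst z0) *v snd z0) \<le> norm (M (fst z) *v snd z)"
    by blast
  define \<kappa> where "\<kappa> = norm (M (fst z0) *v snd z0)"
  have "fst z0 \<in> K" "norm (snd z0) = 1"
    using z0(1) by (auto simp: mem_Times_iff)
  then have \<kappa>: "\<kappa> > 0"
    using inj[of "fst z0" "snd z0"] by (auto simp: \<kappa>_def)
  have low: "\<kappa> * norm w \<le> norm (M z *v w)" if "z \<in> K" for z w
  proof (cases "w = 0")
    case False
    then have "\<kappa> \<le> norm (M z *v (w /\<^sub>R norm w))"
      using z0(2)[of "(z, w /\<^sub>R norm w)"] that by (simp add: \<kappa>_def)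
    also have "\<dots> = norm (M z *v w) / norm w"
      by (simp add: matrix_vector_mult_scaleR divide_inverse mult.commute)
    finally show ?thesis
      using False by (simp add: field_simps)
  qed simp
  have X: "norm (X z) \<le> B / \<kappa>" if "z \<in> K" for z
    using low[OF that, of "X z"] sol[OF that] B(2) that \<kappa> by (auto simp: field_simps intro: order_trans)
  have "((Lb + LM * (B / \<kappa>) * C) / \<kappa>)-lipschitz_on K X"
  proof (rule lipschitz_onI)
    fix x y assume xy: "x \<in> K" "y \<in> K"
    have "M x *v (X x - X y) = (b x - b y) - (M x - M y) *v X y"
      using sol[OF xy(1)] sol[OF xy(2)]
      by (simp add: matrix_vector_mult_diff_distrib matrix_vector_mult_diff_rdistrib)
    then have "\<kappa> * norm (X x - X y) \<le> norm ((b x - b y) - (M x - M y) *v X y)"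
      using low[OF xy(1), of "X x - X y"] by simp
    also have "\<dots> \<le> norm (b x - b y) + norm ((M x - M y) *v X y)"
      by (rule norm_triangle_ineq4)
    also have "\<dots> \<le> Lb * dist x y + (LM * dist x y) * (B / \<kappa>) * C"
    proof (rule add_mono)
      show "norm (b x - b y) \<le> Lb * dist x y"
        using lipschitz_onD[OF Lb xy] by (simp add: dist_norm)
      have "norm ((M x - M y) *v X y) \<le> norm (M x - M y) * norm (X y) * C"
        by (rule C(2))
      also have "\<dots> \<le> (LM * dist x y) * (B / \<kappa>) * C"
        using lipschitz_onD[OF LM xy] X[OF xy(2)] C(1) lipschitz_on_nonneg[OF LM] B(1) \<kappa>
        by (intro mult_mono mult_nonneg_nonneg) (auto simp: dist_norm)
      finally show "norm ((M x - M y) *v X y) \<le> (LM * dist x y) * (B / \<kappa>) * C" .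
    qed
    finally show "dist (X x) (X y) \<le> (Lb + LM * (B / \<kappa>) * C) / \<kappa> * dist x y"
      using \<kappa> by (simp add: dist_norm field_simps)
  qed (use B \<kappa> C lipschitz_on_nonneg[OF LM] lipschitz_on_nonneg[OF Lb] in auto)
  then show ?thesis ..
qed (auto intro: exI[of _ 0])

text \<open>Nondegeneracy makes the map from w to the components of \<open>B w\<close> injective,
  hence bijective in finite dimension. This is what makes the Hamiltonian vector field well
  defined.\<close>

lemma nondegenerate_bilinear_represents:
  fixes B :: "real^'n \<Rightarrow> real^'n \<Rightarrow> real"
  assumes B: "bilinear B" and nondeg: "\<And>v. v \<noteq> 0 \<Longrightarrow> \<exists>w. B v w \<noteq> 0" and \<beta>: "linear \<beta>"
  shows "\<exists>!w. \<forall>v. B w v = \<beta> v"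
proof -
  have lin: "linear (B w)" "linear (\<lambda>w. B w v)" for w v
    using B by (auto simp: bilinear_def)
  have ext: "f = g" if "linear f" "linear g" "\<And>i. f (axis i 1) = g (axis i (1::real))" for f g :: "real^'n \<Rightarrow> real"
    using that(3) by (intro linear_eq_stdbasis that(1,2)) (auto simp: Basis_vec_def)
  define T where "T w = (\<chi> i. B w (axis i 1))" for w
  have "linear T"
    by (rule linearI) (auto simp: T_def vec_eq_iff linear_add[OF lin(2)] linear_scale[OF lin(2)])
  have ker: "w = 0" if "T w = 0" for w
  proof (rule ccontr)
    assume "w \<noteq> 0"
    have "B w = (\<lambda>_. 0)"
      by (rule ext) (use that lin in \<open>auto simp: T_def vec_eq_iff intro: linear_zero\<close>)
    then show False
      using nondeg[OF \<open>w \<noteq> 0\<close>] by simp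
  qed
  then have "inj T"
    using \<open>linear T\<close> by (simp add: linear_injective_0)
  then have "surj T"
    using \<open>linear T\<close> linear_injective_imp_surjective by blast
  then obtain w where w: "T w = (\<chi> i. \<beta> (axis i 1))"
    by (metis surjD)
  show ?thesis
  proof
    show "\<forall>v. B w v = \<beta> v"
      using ext[OF lin(1)[of w] \<beta>] w by (simp add: T_def vec_eq_iff fun_eq_iff)
    fix w' assume "\<forall>v. B w' v = \<beta> v"
    then have "T w' = T w"
      using w by (simp add: T_def)
    then show "w' = w"
      using \<open>inj T\<close> by (simp add: inj_eq)
  qed
qed

lemma linear_eq_sum_axis:
  fixes f :: "real^'n \<Rightarrow> real"
  assumes "linear f"
  shows "f w = (\<Sum>j\<in>UNIV. w $ j * f (axis j 1))"
proof -
  have "f w = f (\<Sum>j\<in>UNIV. w $ j *s axis j 1)"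
    by (simp add: basis_expansion)
  also have "\<dots> = (\<Sum>j\<in>UNIV. w $ j * f (axis j 1))"
    by (simp add: linear_sum[OF assms] linear_scale[OF assms] scalar_mult_eq_scaleR)
  finally show ?thesis .
qed

lemma lipschitz_bounded_add:
  assumes "lipschitz_bounded L K f" "lipschitz_bounded L' K g"
  shows "lipschitz_bounded (L + L') K (\<lambda>x. f x + g x)"
  using assms unfolding lipschitz_bounded_def
  by (auto intro!: lipschitz_on_add norm_triangle_le add_mono)

lemma lipschitz_bounded_uminus:
  assumes "lipschitz_bounded L K f"
  shows "lipschitz_bounded L K (\<lambda>x. - f x)"
  using assms by (simp add: lipschitz_bounded_def)

lemma lipschitz_bounded_sum:
  assumes "\<And>i. i \<in> I \<Longrightarrow> lipschitz_bounded (L i) K (f i)"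
  shows "lipschitz_bounded (\<Sum>i\<in>I. L i) K (\<lambda>x. \<Sum>i\<in>I. f i x)"
  using assms
proof (induction I rule: infinite_finite_induct)
  case (insert i I)
  then show ?case
    using lipschitz_bounded_add[of "L i" K "f i" "\<Sum>i\<in>I. L i" "\<lambda>x. \<Sum>i\<in>I. f i x"] by simp
qed (auto simp: lipschitz_bounded_def lipschitz_on_constant)

text \<open>The same \<open>L\<close> also bounds the integral itself because the time interval has
  length 1.\<close>

lemma lipschitz_bounded_indefinite_integral:
  fixes f :: "real \<Rightarrow> real"
  assumes f: "continuous_on {0..1} f" "\<And>t. t \<in> {0..1} \<Longrightarrow> \<bar>f t\<bar> \<le> L"
  shows "lipschitz_bounded L {0..1} (\<lambda>t. integral {0..t} f)"
proof -
  have L: "L \<ge> 0"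
    using f(2)[of 0] by auto
  have int: "f integrable_on {s..t}" if "0 \<le> s" "t \<le> 1" for s t
    by (rule integrable_continuous_real[OF continuous_on_subset[OF f(1)]]) (use that in auto)
  have *: "\<bar>integral {0..t} f - integral {0..s} f\<bar> \<le> L * (t - s)" if "0 \<le> s" "s \<le> t" "t \<le> 1" for s t
  proof -
    have "integral {0..t} f - integral {0..s} f = integral {s..t} f"
      using Henstock_Kurzweil_Integration.integral_combine[of 0 s t f] int[of 0 t] that by simp
    moreover have "norm (integral {s..t} f) \<le> L * (t - s)"
      by (rule integral_bound[OF that(2) continuous_on_subset[OF f(1)]]) (use that f(2) in auto)
    ultimately show ?thesis
      by simp
  qed
  have "L-lipschitz_on {0..1} (\<lambda>t. integral {0..t} f)"
  proof (rule lipschitz_onI[OF _ L])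
    fix s t :: real assume st: "s \<in> {0..1}" "t \<in> {0..1}"
    show "dist (integral {0..s} f) (integral {0..t} f) \<le> L * dist s t"
      using *[of s t] *[of t s] st by (cases "s \<le> t") (auto simp: dist_real_def abs_minus_commute)
  qed
  moreover have "\<bar>integral {0..t} f\<bar> \<le> L" if "t \<in> {0..1}" for t
  proof -
    have "\<bar>integral {0..t} f\<bar> \<le> L * t"
      using *[of 0 t] that by simp
    also have "\<dots> \<le> L"
      using that L by (simp add: mult_left_le)
    finally show ?thesis .
  qed
  ultimately show ?thesis
    by (simp add: lipschitz_bounded_def)
qed

section \<open>Ordinary differential equations\<close>

text \<open>\<open>L * (b - a) < 1\<close> makes the integral operator a contraction in the sup
  norm; \<open>B * (b - a) \<le> r\<close> keeps its values in the ball. The Lipschitz condition is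
  joint in (t, x), which also supplies continuity in time.\<close>

lemma picard_local:
  fixes f :: "real \<Rightarrow> 'a::euclidean_space \<Rightarrow> 'a"
  assumes lip: "L-lipschitz_on ({a..b} \<times> cball y r) (\<lambda>(t, x). f t x)"
    and bnd: "\<And>t x. t \<in> {a..b} \<Longrightarrow> x \<in> cball y r \<Longrightarrow> norm (f t x) \<le> B"
    and r: "r \<ge> 0" and ab: "a \<le> b" and Lba: "L * (b - a) < 1" and Bba: "B * (b - a) \<le> r"
  shows "\<exists>x. x a = y \<and> (\<forall>t\<in>{a..b}. x t \<in> cball y r \<and>
           (x has_vector_derivative f t (x t)) (at t within {a..b}))"
proof -
  have L0: "L \<ge> 0"
    using lip by (rule lipschitz_on_nonneg)
  have B0: "B \<ge> 0"
    using order_trans[OF norm_ge_zero bnd[of a y]] ab r by simp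
  \<comment> \<open>The nearest-point projection extends \<open>f\<close> to the whole space without increasing \<open>L\<close> and \<open>B\<close>;
    the bound \<open>B\<close> then keeps the solution in the ball.\<close>
  define \<pi> where "\<pi> = closest_point (cball y r)"
  have ball: "convex (cball y r)" "closed (cball y r)" "cball y r \<noteq> {}"
    using r by auto
  have \<pi>_in: "\<pi> x \<in> cball y r" for x
    unfolding \<pi>_def using ball closest_point_exists(1) by blast
  have \<pi>_id: "\<pi> x = x" if "x \<in> cball y r" for x
    unfolding \<pi>_def using that by (rule closest_point_self)
  have \<pi>_lip: "dist (\<pi> x) (\<pi> z) \<le> dist x z" for x z
    unfolding \<pi>_def by (rule closest_point_lipschitz) (use ball in auto)
  have \<pi>_cont: "continuous_on S \<pi>" for S
    unfolding \<pi>_def using ball by (intro continuous_on_closest_point) auto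
  \<comment> \<open>Clamping time to \<open>{a..b}\<close> lets the integral operator act on the
    bounded continuous functions on the whole real line, a type that is a complete metric
    space.\<close>
  define c where "c t = max a (min b t)" for t
  have c_in: "c t \<in> {a..b}" for t
    using ab by (auto simp: c_def)
  have c_id: "c t = t" if "t \<in> {a..b}" for t
    using that by (auto simp: c_def)
  have f_cont: "continuous_on {a..b} (\<lambda>s. f s (\<pi> (u s)))" if "continuous_on {a..b} u" for u
  proof -
    have "continuous_on {a..b} (\<lambda>s. (\<lambda>(t, x). f t x) (s, \<pi> (u s)))"
      by (rule continuous_on_compose2[OF lipschitz_on_continuous_on[OF lip]])
        (auto intro!: continuous_intros continuous_on_compose2[OF \<pi>_cont that] simp del: mem_cball simp: \<pi>_in)
    then show ?thesis by simp
  qed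
  define I where "I u t = y + integral {a..t} (\<lambda>s. f s (\<pi> (u s)))" for u :: "real \<Rightarrow> 'a" and t
  have I_cont: "continuous_on {a..b} (I u)" if "continuous_on {a..b} u" for u
    unfolding I_def
    by (intro continuous_intros indefinite_integral_continuous_1 integrable_continuous_real f_cont that)
  have I_bound: "norm (I u t - y) \<le> B * (b - a)" if "continuous_on {a..b} u" "t \<in> {a..b}" for u t
  proof -
    have "norm (integral {a..t} (\<lambda>s. f s (\<pi> (u s)))) \<le> B * (t - a)"
      by (rule integral_bound) (use that f_cont[OF that(1)] bnd \<pi>_in in \<open>auto intro: continuous_on_subset simp del: mem_cball\<close>)
    also have "\<dots> \<le> B * (b - a)"
      using that B0 by (auto intro: mult_left_mono)
    finally show ?thesis by (simp add: I_def)
  qed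
  have I_bcont: "(\<lambda>t. I (apply_bcontfun u) (c t)) \<in> bcontfun" for u
  proof (rule bcontfun_normI)
    show "continuous_on UNIV (\<lambda>t. I (apply_bcontfun u) (c t))"
      by (rule continuous_on_compose2[OF I_cont])
        (use c_in in \<open>auto simp: c_def intro!: continuous_intros\<close>)
    show "norm (I (apply_bcontfun u) (c t)) \<le> norm y + B * (b - a)" for t
      using I_bound[of "apply_bcontfun u" "c t"] c_in[of t]
        norm_triangle_ineq[of "I (apply_bcontfun u) (c t) - y" y] by simp
  qed
  define T where "T u = Bcontfun (\<lambda>t. I (apply_bcontfun u) (c t))" for u
  have T: "apply_bcontfun (T u) t = I (apply_bcontfun u) (c t)" for u t
    unfolding T_def by (simp add: Bcontfun_inverse I_bcont)
  have "dist (T u) (T v) \<le> (L * (b - a)) * dist u v" for u v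
  proof (rule dist_bound)
    fix t
    let ?g = "\<lambda>w s. f s (\<pi> (apply_bcontfun w s))"
    have cont: "continuous_on {a..c t} (?g w)" for w
      by (rule continuous_on_subset[OF f_cont]) (use c_in[of t] in auto)
    have "dist (T u t) (T v t) = norm (integral {a..c t} (?g u) - integral {a..c t} (?g v))"
      by (simp add: T I_def dist_norm)
    also have "\<dots> = norm (integral {a..c t} (\<lambda>s. ?g u s - ?g v s))"
      by (subst integral_diff) (auto intro: integrable_continuous_real cont)
    also have "\<dots> \<le> (L * dist u v) * (c t - a)"
    proof (rule integral_bound)
      show "continuous_on {a..c t} (\<lambda>s. ?g u s - ?g v s)"
        by (intro continuous_intros cont)
      fix s assume s: "s \<in> {a..c t}"
      have "dist (?g u s) (?g v s) \<le> L * dist (s, \<pi> (u s)) (s, \<pi> (v s))"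
        using lipschitz_onD[OF lip, of "(s, \<pi> (u s))" "(s, \<pi> (v s))"] s c_in[of t] \<pi>_in
        by (auto simp del: mem_cball)
      also have "dist (s, \<pi> (u s)) (s, \<pi> (v s)) = dist (\<pi> (u s)) (\<pi> (v s))"
        by (simp add: dist_Pair_Pair)
      also have "L * \<dots> \<le> L * dist u v"
        using \<pi>_lip[of "u s" "v s"] dist_bounded[of u s v] L0 by (intro mult_left_mono) auto
      finally show "norm (?g u s - ?g v s) \<le> L * dist u v"
        by (simp add: dist_norm)
    qed (use c_in[of t] in auto)
    also have "\<dots> \<le> (L * dist u v) * (b - a)"
      using c_in[of t] L0 by (intro mult_left_mono) auto
    finally show "dist (T u t) (T v t) \<le> (L * (b - a)) * dist u v"
      by (simp add: mult_ac)
  qed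
  then have "\<exists>!u. T u = u"
    using L0 ab Lba by (intro banach_fix_type) auto
  then obtain u where "T u = u" by blast
  then have u: "u t = I u (c t)" for t
    using T[of u t] by simp
  have ucont: "continuous_on {a..b} u" by simp
  have in_ball: "u t \<in> cball y r" if "t \<in> {a..b}" for t
    using I_bound[OF ucont that] Bba u[of t] c_id[OF that] by (simp add: dist_norm norm_minus_commute)
  have "(u has_vector_derivative f t (u t)) (at t within {a..b})" if t: "t \<in> {a..b}" for t
  proof -
    have "((\<lambda>x. integral {a..x} (\<lambda>s. f s (\<pi> (u s)))) has_vector_derivative f t (\<pi> (u t))) (at t within {a..b})"
      by (rule integral_has_vector_derivative[OF f_cont[OF ucont] t])
    then have "(I u has_vector_derivative f t (\<pi> (u t))) (at t within {a..b})"
      unfolding I_def by (auto intro!: derivative_eq_intros)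
    then have "(u has_vector_derivative f t (\<pi> (u t))) (at t within {a..b})"
      by (rule has_vector_derivative_transform[rotated 2]) (use t u c_id in auto)
    then show ?thesis
      using \<pi>_id[OF in_ball[OF t]] by simp
  qed
  moreover have "u a = y"
    using u[of a] c_id[of a] ab by (simp add: I_def)
  ultimately show ?thesis
    using in_ball by (intro exI[of _ "apply_bcontfun u"]) auto
qed

text \<open>The interval need not start at \<open>\<tau>\<close>: uniqueness is needed in both time directions.\<close>

lemma lipschitz_ode_locally_unique:
  fixes u v :: "real \<Rightarrow> 'a::real_normed_vector"
  assumes u: "\<And>t. t \<in> J \<Longrightarrow> (u has_vector_derivative f t (u t)) (at t within J)"
    and v: "\<And>t. t \<in> J \<Longrightarrow> (v has_vector_derivative f t (v t)) (at t within J)"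
    and lip: "\<And>t. t \<in> J \<Longrightarrow> norm (f t (u t) - f t (v t)) \<le> L * norm (u t - v t)"
    and J: "compact J" "convex J" "\<And>t. t \<in> J \<Longrightarrow> \<bar>t - \<tau>\<bar> \<le> \<eta>" and tau: "\<tau> \<in> J" "u \<tau> = v \<tau>"
    and L: "L \<ge> 0" "L * \<eta> < 1" and t: "t \<in> J"
  shows "u t = v t"
proof -
  define w where "w t = u t - v t" for t
  have w: "(w has_vector_derivative f t (u t) - f t (v t)) (at t within J)" if "t \<in> J" for t
    unfolding w_def using u[OF that] v[OF that] by (rule has_vector_derivative_diff)
  have "continuous_on J (\<lambda>t. norm (w t))"
    by (intro continuous_on_norm) (use w has_vector_derivative_continuous continuous_on_eq_continuous_within in blast)
  \<comment> \<open>At a maximum s of |w| the mean value inequality from \<tau> gives |w(s)| \<le> L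
    \<eta> |w(s)|; as L \<eta> < 1, this forces w = 0 on all of \<open>J\<close>. It replaces a
    Gronwall estimate.\<close>
  from continuous_attains_sup[OF J(1) _ this] tau
  obtain s where s: "s \<in> J" "\<And>t. t \<in> J \<Longrightarrow> norm (w t) \<le> norm (w s)"
    by blast
  have "norm (w s - w \<tau>) \<le> (L * norm (w s)) * norm (s - \<tau>)"
  proof (rule differentiable_bound[OF J(2)])
    show "(w has_derivative (\<lambda>h. h *\<^sub>R (f x (u x) - f x (v x)))) (at x within J)" if "x \<in> J" for x
      using w[OF that] by (simp add: has_vector_derivative_def)
    show "onorm (\<lambda>h. h *\<^sub>R (f x (u x) - f x (v x))) \<le> L * norm (w s)" if "x \<in> J" for x
    proof -
      have "norm (f x (u x) - f x (v x)) \<le> L * norm (w s)"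
        using lip[OF that] s(2)[OF that] L(1) mult_left_mono unfolding w_def by (meson order_trans)
      then have "norm (h *\<^sub>R (f x (u x) - f x (v x))) \<le> (L * norm (w s)) * norm h" for h :: real
        by (simp add: mult.commute mult_left_mono)
      then show ?thesis
        by (rule onorm_le)
    qed
  qed (use s tau in auto)
  also have "\<dots> \<le> (L * norm (w s)) * \<eta>"
    using J(3)[OF s(1)] L(1) by (intro mult_left_mono) auto
  finally have "norm (w s) \<le> (L * \<eta>) * norm (w s)"
    using tau(2) by (simp add: w_def mult_ac)
  then have "norm (w s) * (1 - L * \<eta>) \<le> 0"
    by (simp add: algebra_simps)
  with L(2) have "norm (w s) \<le> 0"
    by (simp add: mult_le_0_iff)
  then show ?thesis
    using s(2)[OF t] by (simp add: w_def)
qed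

section \<open>Integral curves on manifolds\<close>

lemma atlas_open:
  assumes "smooth_atlas A" "c \<in> A"
  shows "open (cdom c)" "open (cimg c)"
  using assms by (auto simp: smooth_atlas_def)

lemma atlas_homeomorphism:
  assumes "smooth_atlas A" "c \<in> A"
  shows "homeomorphism (cdom c) (cimg c) (cmap c) (cinv c)"
  using assms by (auto simp: smooth_atlas_def)

lemma atlas_covers:
  assumes "smooth_atlas A"
  obtains c where "c \<in> A" "p \<in> cdom c"
  using assms unfolding smooth_atlas_def by blast

lemma chart_at:
  assumes "smooth_atlas A"
  shows "chart_at A p \<in> A" "p \<in> cdom (chart_at A p)"
proof -
  have "\<exists>c. c \<in> A \<and> p \<in> cdom c"
    using atlas_covers[OF assms, of p] by blast
  from someI_ex[OF this] show "chart_at A p \<in> A" "p \<in> cdom (chart_at A p)"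
    by (simp_all add: chart_at_def)
qed

lemma chart_simps:
  assumes "smooth_atlas A" "c \<in> A"
  shows "p \<in> cdom c \<Longrightarrow> cinv c (cmap c p) = p" "p \<in> cdom c \<Longrightarrow> cmap c p \<in> cimg c"
    "x \<in> cimg c \<Longrightarrow> cmap c (cinv c x) = x" "x \<in> cimg c \<Longrightarrow> cinv c x \<in> cdom c"
    "continuous_on (cdom c) (cmap c)" "continuous_on (cimg c) (cinv c)"
  using atlas_homeomorphism[OF assms] by (force simp: homeomorphism_def)+

lemma open_chart_preimage:
  assumes "smooth_atlas A" "c \<in> A" "open S"
  shows "open {q \<in> cdom c. cmap c q \<in> S}"
proof -
  have "open (cdom c \<inter> cmap c -` S)"
    using chart_simps(5)[OF assms(1,2)] atlas_open(1)[OF assms(1,2)] assms(3)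
    by (rule continuous_open_preimage)
  moreover have "cdom c \<inter> cmap c -` S = {q \<in> cdom c. cmap c q \<in> S}"
    by auto
  ultimately show ?thesis
    by simp
qed

lemma open_chart_overlap:
  assumes "smooth_atlas A" "c \<in> A" "d \<in> A"
  shows "open (cmap c ` (cdom c \<inter> cdom d))"
proof -
  have "open (cimg c \<inter> cinv c -` cdom d)"
    by (rule continuous_open_preimage[OF chart_simps(6)[OF assms(1,2)] atlas_open(2)[OF assms(1,2)]
          atlas_open(1)[OF assms(1,3)]])
  also have "cimg c \<inter> cinv c -` cdom d = cmap c ` (cdom c \<inter> cdom d)"
  proof (intro equalityI subsetI)
    fix x assume "x \<in> cimg c \<inter> cinv c -` cdom d"
    then show "x \<in> cmap c ` (cdom c \<inter> cdom d)"
      using chart_simps(3,4)[OF assms(1,2), of x] by (intro image_eqI[of _ _ "cinv c x"]) auto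
  qed (use chart_simps(1,2)[OF assms(1,2)] in auto)
  finally show ?thesis .
qed

lemma transition_has_derivative:
  assumes "smooth_atlas A" "c \<in> A" "d \<in> A" "p \<in> cdom c" "p \<in> cdom d"
  shows "((cmap d \<circ> cinv c) has_derivative transition_deriv c d (cmap c p)) (at (cmap c p))"
proof -
  have "smooth_on (cmap c ` (cdom c \<inter> cdom d)) (cmap d \<circ> cinv c)"
    using assms(1-3) by (auto simp: smooth_atlas_def)
  from smooth_on_open_differentiable[OF this open_chart_overlap[OF assms(1-3)], of "cmap c p"] assms(4,5)
  show ?thesis
    unfolding transition_deriv_def by (simp add: frechet_derivative_works)
qed

lemma transition_deriv_inverse:
  assumes "smooth_atlas A" "c \<in> A" "d \<in> A" "p \<in> cdom c" "p \<in> cdom d"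
  shows "transition_deriv d c (cmap d p) (transition_deriv c d (cmap c p) v) = v"
proof -
  note simps = chart_simps[OF assms(1,2)] chart_simps[OF assms(1,3)]
  have "((cmap c \<circ> cinv d) has_derivative transition_deriv d c (cmap d p)) (at ((cmap d \<circ> cinv c) (cmap c p)))"
    using transition_has_derivative[OF assms(1,3,2,5,4)] simps assms by simp
  from diff_chain_at[OF transition_has_derivative[OF assms] this]
  have "((cmap c \<circ> cinv d \<circ> (cmap d \<circ> cinv c)) has_derivative
      (transition_deriv d c (cmap d p) \<circ> transition_deriv c d (cmap c p))) (at (cmap c p))" .
  then have "(id has_derivative
      (transition_deriv d c (cmap d p) \<circ> transition_deriv c d (cmap c p))) (at (cmap c p))"
    by (rule has_derivative_transform_within_open[OF _ open_chart_overlap[OF assms(1-3)]])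
      (use assms simps in auto)
  from has_derivative_unique[OF this has_derivative_id] show ?thesis
    by (simp add: fun_eq_iff)
qed

lemma linear_transition_deriv:
  assumes "smooth_atlas A" "c \<in> A" "d \<in> A" "p \<in> cdom c" "p \<in> cdom d"
  shows "linear (transition_deriv c d (cmap c p))"
  using transition_has_derivative[OF assms] by (rule has_derivative_linear)

lemma continuous_on_eventually_in_open:
  assumes "continuous_on I \<gamma>" "t \<in> I" "open V" "\<gamma> t \<in> V"
  shows "\<forall>\<^sub>F s in at t within I. \<gamma> s \<in> V"
  using assms by (auto simp: continuous_on_def dest: topological_tendstoD)

lemma has_vector_derivative_chart_change:
  assumes "smooth_atlas A" "c \<in> A" "d \<in> A" "\<gamma> t \<in> cdom c" "\<gamma> t \<in> cdom d"
    and "continuous_on I \<gamma>" "t \<in> I"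
    and "((\<lambda>s. cmap c (\<gamma> s)) has_vector_derivative w) (at t within I)"
  shows "((\<lambda>s. cmap d (\<gamma> s)) has_vector_derivative transition_deriv c d (cmap c (\<gamma> t)) w) (at t within I)"
  unfolding has_vector_derivative_def
proof (rule has_derivative_transform_eventually)
  let ?D = "transition_deriv c d (cmap c (\<gamma> t))"
  have "((\<lambda>s. (cmap d \<circ> cinv c) (cmap c (\<gamma> s))) has_derivative (\<lambda>h. ?D (h *\<^sub>R w))) (at t within I)"
    using assms(8) transition_has_derivative[OF assms(1-5)] unfolding has_vector_derivative_def
    by (rule has_derivative_compose)
  then show "((\<lambda>s. (cmap d \<circ> cinv c) (cmap c (\<gamma> s))) has_derivative (\<lambda>h. h *\<^sub>R ?D w)) (at t within I)"
    by (simp add: linear_scale[OF linear_transition_deriv[OF assms(1-5)]])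
  show "\<forall>\<^sub>F s in at t within I. (cmap d \<circ> cinv c) (cmap c (\<gamma> s)) = cmap d (\<gamma> s)"
    using continuous_on_eventually_in_open[OF assms(6,7) atlas_open(1)[OF assms(1,2)] assms(4)]
    by eventually_elim (simp add: chart_simps[OF assms(1,2)])
qed (use assms in \<open>auto simp: chart_simps[OF assms(1,2)]\<close>)

text \<open>A Lebesgue number argument: compactness of the manifold turns a property that holds on
  each coordinate ball with some constant into one radius and one constant valid around every point.
  The property will be \<open>controlled G\<close>.\<close>

lemma uniform_chart_radius:
  fixes A :: "('m::{t2_space, second_countable_topology}, 'n::finite) chart set"
  assumes "closed_connected_manifold A"
    and P: "\<And>c x r. c \<in> A \<Longrightarrow> cball x r \<subseteq> cimg c \<Longrightarrow> \<exists>L. P c (cball x r) L"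
    and mono: "\<And>c S L S' L'. P c S L \<Longrightarrow> S' \<subseteq> S \<Longrightarrow> L \<le> L' \<Longrightarrow> P c S' (L'::real)"
  obtains r L where "r > 0" "L \<ge> 0"
    "\<And>p. \<exists>c\<in>A. p \<in> cdom c \<and> cball (cmap c p) r \<subseteq> cimg c \<and> P c (cball (cmap c p) r) L"
proof -
  have A: "smooth_atlas A" and cpt: "compact (UNIV :: 'm set)"
    using assms(1) by (auto simp: closed_connected_manifold_def)
  \<comment> \<open>The factor 2 leaves room to move the centre: a point within coordinate distance
    \<open>r\<close> of p still has a ball of radius \<open>r\<close> inside the ball of radius
    \<open>2 * r\<close> around p.\<close>
  have "\<exists>c r L. c \<in> A \<and> p \<in> cdom c \<and> r > 0 \<and> cball (cmap c p) (2 * r) \<subseteq> cimg c \<and>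
      P c (cball (cmap c p) (2 * r)) L" for p
  proof -
    obtain c where c: "c \<in> A" "p \<in> cdom c"
      using atlas_covers[OF A] .
    have "cmap c p \<in> cimg c" "open (cimg c)"
      using chart_simps(2)[OF A c] atlas_open(2)[OF A c(1)] by auto
    then obtain e where "e > 0" "cball (cmap c p) e \<subseteq> cimg c"
      by (auto simp: open_contains_cball)
    moreover from this obtain L where "P c (cball (cmap c p) e) L"
      using P c by blast
    ultimately show ?thesis
      using c by (intro exI[of _ c] exI[of _ "e / 2"] exI[of _ L]) auto
  qed
  then obtain c r L where cr: "\<And>p. c p \<in> A \<and> p \<in> cdom (c p) \<and> r p > 0 \<and>
      cball (cmap (c p) p) (2 * r p) \<subseteq> cimg (c p) \<and> P (c p) (cball (cmap (c p) p) (2 * r p)) (L p)"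
    by metis
  define V where "V p = {q \<in> cdom (c p). cmap (c p) q \<in> ball (cmap (c p) p) (r p)}" for p
  have "\<exists>I\<subseteq>UNIV. finite I \<and> UNIV \<subseteq> (\<Union>p\<in>I. V p)"
  proof (rule compactE_image[OF cpt, of UNIV V])
    show "open (V p)" for p
      unfolding V_def using cr by (intro open_chart_preimage[OF A]) auto
    show "UNIV \<subseteq> (\<Union>p\<in>UNIV. V p)"
      using cr by (auto simp: V_def)
  qed blast
  then obtain I where I: "finite I" "UNIV \<subseteq> (\<Union>p\<in>I. V p)"
    by blast
  then have "I \<noteq> {}"
    by auto
  define r0 where "r0 = Min (r ` I)"
  define L0 where "L0 = (\<Sum>p\<in>I. \<bar>L p\<bar>)"
  show thesis
  proof (rule that[of r0 L0])
    show "r0 > 0"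
      unfolding r0_def using I(1) \<open>I \<noteq> {}\<close> cr by (subst Min_gr_iff) auto
    show "L0 \<ge> 0"
      by (simp add: L0_def sum_nonneg)
    fix q
    obtain p where p: "p \<in> I" "q \<in> V p"
      using I(2) by blast
    have "r0 \<le> r p"
      unfolding r0_def using p(1) I(1) by (intro Min_le) auto
    have sub: "cball (cmap (c p) q) r0 \<subseteq> cball (cmap (c p) p) (2 * r p)"
    proof
      fix x assume "x \<in> cball (cmap (c p) q) r0"
      then show "x \<in> cball (cmap (c p) p) (2 * r p)"
        using p(2) \<open>r0 \<le> r p\<close> dist_triangle[of "cmap (c p) p" x "cmap (c p) q"] by (simp add: V_def)
    qed
    have "\<bar>L p\<bar> \<le> L0"
      unfolding L0_def using p(1) I(1) by (intro member_le_sum) auto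
    then have "P (c p) (cball (cmap (c p) q) r0) L0"
      using mono[of "c p" _ "L p" _ L0, OF _ sub] cr[of p] by simp
    with sub cr[of p] p(2) show "\<exists>c\<in>A. q \<in> cdom c \<and> cball (cmap c q) r0 \<subseteq> cimg c \<and> P c (cball (cmap c q) r0) L0"
      by (intro bexI[of _ "c p"]) (auto simp: V_def)
  qed
qed

text \<open>Time-dependent vector fields are given, like tensor fields, by their coordinate expressions
  \<open>X c t x\<close> in all charts.\<close>

definition vector_field ::
  "('m, 'n::finite) chart set \<Rightarrow> (('m, 'n) chart \<Rightarrow> real \<Rightarrow> real^'n \<Rightarrow> real^'n) \<Rightarrow> bool" where
  "vector_field A X \<longleftrightarrow> (\<forall>c\<in>A. \<forall>d\<in>A. \<forall>t\<in>{0..1}. \<forall>p\<in>cdom c \<inter> cdom d.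
     X d t (cmap d p) = transition_deriv c d (cmap c p) (X c t (cmap c p)))"

text \<open>The derivative is one-sided at the ends, as in \<open>generates\<close>. The equation is
  required in every chart around \<gamma>(t), so that each argument may choose its own
  chart.\<close>

definition integral_curve ::
  "('m::topological_space, 'n::finite) chart set \<Rightarrow> (('m, 'n) chart \<Rightarrow> real \<Rightarrow> real^'n \<Rightarrow> real^'n) \<Rightarrow>
     real \<Rightarrow> real \<Rightarrow> (real \<Rightarrow> 'm) \<Rightarrow> bool" where
  "integral_curve A X a b \<gamma> \<longleftrightarrow> continuous_on {a..b} \<gamma> \<and>
     (\<forall>t\<in>{a..b}. \<forall>c\<in>A. \<gamma> t \<in> cdom c \<longrightarrow>
        ((\<lambda>s. cmap c (\<gamma> s)) has_vector_derivative X c t (cmap c (\<gamma> t))) (at t within {a..b}))"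

lemma integral_curveD:
  assumes "integral_curve A X a b \<gamma>" "t \<in> {a..b}" "c \<in> A" "\<gamma> t \<in> cdom c"
  shows "((\<lambda>s. cmap c (\<gamma> s)) has_vector_derivative X c t (cmap c (\<gamma> t))) (at t within {a..b})"
  using assms by (auto simp: integral_curve_def)

text \<open>Solve in one chart; the solution stays in the coordinate ball during
  \<open>{a..b}\<close>, and the transformation law of \<open>X\<close> carries the equation to all
  other charts.\<close>

lemma integral_curve_exists_in_chart:
  assumes A: "smooth_atlas A" and X: "vector_field A X"
    and c: "c \<in> A" "p \<in> cdom c" "cball (cmap c p) r \<subseteq> cimg c"
    and lip: "L-lipschitz_on ({0..1} \<times> cball (cmap c p) r) (\<lambda>(t, x). X c t x)"
    and bnd: "\<And>t x. t \<in> {0..1} \<Longrightarrow> x \<in> cball (cmap c p) r \<Longrightarrow> norm (X c t x) \<le> L"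
    and ab: "0 \<le> a" "a \<le> b" "b \<le> 1" "L * (b - a) < 1" "L * (b - a) \<le> r" and r: "r \<ge> 0"
  shows "\<exists>\<gamma>. \<gamma> a = p \<and> integral_curve A X a b \<gamma>"
proof -
  have "L-lipschitz_on ({a..b} \<times> cball (cmap c p) r) (\<lambda>(t, x). X c t x)"
    by (rule lipschitz_on_subset[OF lip]) (use ab in auto)
  from picard_local[OF this bnd r ab(2,4,5)] ab
  obtain x where x: "x a = cmap c p" "\<And>t. t \<in> {a..b} \<Longrightarrow> x t \<in> cball (cmap c p) r"
    "\<And>t. t \<in> {a..b} \<Longrightarrow> (x has_vector_derivative X c t (x t)) (at t within {a..b})"
    by auto
  let ?\<gamma> = "\<lambda>t. cinv c (x t)"
  have x_img: "x t \<in> cimg c" if "t \<in> {a..b}" for t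
    using x(2)[OF that] c(3) by blast
  have x_cont: "continuous_on {a..b} x"
    using x(3) has_vector_derivative_continuous continuous_on_eq_continuous_within by blast
  have cont: "continuous_on {a..b} ?\<gamma>"
    by (rule continuous_on_compose2[OF chart_simps(6)[OF A c(1)] x_cont]) (use x_img in auto)
  have "integral_curve A X a b ?\<gamma>"
    unfolding integral_curve_def
  proof (intro conjI ballI impI cont)
    fix t d assume t: "t \<in> {a..b}" and d: "d \<in> A" "?\<gamma> t \<in> cdom d"
    have in_c: "?\<gamma> t \<in> cdom c"
      using chart_simps(4)[OF A c(1)] x_img[OF t] by blast
    have "((\<lambda>s. cmap c (?\<gamma> s)) has_vector_derivative X c t (x t)) (at t within {a..b})"
      by (rule has_vector_derivative_transform[OF t _ x(3)[OF t]])
        (use x_img chart_simps(3)[OF A c(1)] in auto)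
    from has_vector_derivative_chart_change[OF A c(1) d(1) in_c d(2) cont t this]
    show "((\<lambda>s. cmap d (?\<gamma> s)) has_vector_derivative X d t (cmap d (?\<gamma> t))) (at t within {a..b})"
      using X c(1) d t ab in_c x_img[OF t] chart_simps(3)[OF A c(1)]
      unfolding vector_field_def by auto
  qed
  moreover have "?\<gamma> a = p"
    using x(1) chart_simps(1)[OF A c(1,2)] by simp
  ultimately show ?thesis
    by (intro exI[of _ ?\<gamma>]) simp
qed

text \<open>At the joint \<open>b\<close> both one-sided derivatives are the value of
  \<open>X\<close> at the same point, so they combine to a derivative within
  \<open>{a..d}\<close>.\<close>

lemma integral_curve_join:
  assumes 1: "integral_curve A X a b \<gamma>1" and 2: "integral_curve A X b d \<gamma>2"
    and eq: "\<gamma>1 b = \<gamma>2 b" and ab: "a \<le> b" "b \<le> d"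
  shows "integral_curve A X a d (\<lambda>t. if t \<in> {a..b} then \<gamma>1 t else \<gamma>2 t)"
    (is "integral_curve A X a d ?\<gamma>")
  unfolding integral_curve_def
proof (intro conjI ballI impI)
  have un: "{a..d} = {a..b} \<union> {b..d}"
    using ab by auto
  have "continuous_on ({a..b} \<union> {b..d}) ?\<gamma>"
    by (rule continuous_on_cases) (use 1 2 eq in \<open>auto simp: integral_curve_def\<close>)
  then show "continuous_on {a..d} ?\<gamma>"
    by (simp only: un)
  fix t c assume t: "t \<in> {a..d}" and c: "c \<in> A" "?\<gamma> t \<in> cdom c"
  have "((\<lambda>s. if s \<in> {a..b} then cmap c (\<gamma>1 s) else cmap c (\<gamma>2 s)) has_vector_derivative
      (if t \<in> {a..b} then X c t (cmap c (\<gamma>1 t)) else X c t (cmap c (\<gamma>2 t)))) (at t within {a..d})"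
  proof (rule has_vector_derivative_If_within_closures[of t "{a..b}" "{b..d}" "{a..d}"
        "\<lambda>s. cmap c (\<gamma>1 s)" "\<lambda>t. X c t (cmap c (\<gamma>1 t))" "\<lambda>s. cmap c (\<gamma>2 s)" "\<lambda>t. X c t (cmap c (\<gamma>2 t))"])
    \<comment> \<open>The two closures meet only in \<open>b\<close>, which belongs to both
      intervals already.\<close>
    have cl: "{a..b} \<union> (closure {a..b} \<inter> closure {b..d}) = {a..b}"
      "{b..d} \<union> (closure {a..b} \<inter> closure {b..d}) = {b..d}"
      using ab by auto
    show "((\<lambda>s. cmap c (\<gamma>1 s)) has_vector_derivative X c t (cmap c (\<gamma>1 t)))
        (at t within {a..b} \<union> (closure {a..b} \<inter> closure {b..d}))"
      if "t \<in> {a..b} \<union> (closure {a..b} \<inter> closure {b..d})"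
      unfolding cl by (rule integral_curveD[OF 1]) (use that c cl in auto)
    show "((\<lambda>s. cmap c (\<gamma>2 s)) has_vector_derivative X c t (cmap c (\<gamma>2 t)))
        (at t within {b..d} \<union> (closure {a..b} \<inter> closure {b..d}))"
      if "t \<in> {b..d} \<union> (closure {a..b} \<inter> closure {b..d})"
    proof -
      have "t \<in> {b..d}"
        using that unfolding cl .
      moreover from this have "t \<in> {a..b} \<longleftrightarrow> t = b"
        using ab by auto
      ultimately show ?thesis
        unfolding cl by (intro integral_curveD[OF 2]) (use c eq in \<open>auto split: if_splits\<close>)
    qed
  next
    assume "t \<in> closure {a..b}" "t \<in> closure {b..d}"
    then have "t = b"
      by auto
    then show "cmap c (\<gamma>1 t) = cmap c (\<gamma>2 t)" "X c t (cmap c (\<gamma>1 t)) = X c t (cmap c (\<gamma>2 t))"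
      using eq by auto
  qed (use t un in auto)
  moreover have "(\<lambda>s. if s \<in> {a..b} then cmap c (\<gamma>1 s) else cmap c (\<gamma>2 s)) = (\<lambda>s. cmap c (?\<gamma> s))"
    by auto
  moreover have "(if t \<in> {a..b} then X c t (cmap c (\<gamma>1 t)) else X c t (cmap c (\<gamma>2 t))) = X c t (cmap c (?\<gamma> t))"
    by auto
  ultimately show "((\<lambda>s. cmap c (?\<gamma> s)) has_vector_derivative X c t (cmap c (?\<gamma> t))) (at t within {a..d})"
    by simp
qed

text \<open>Since \<open>r\<close> and \<open>L\<close> do not depend on the point, a step of length
  1/N is possible from wherever the previous step ended, and N steps reach time 1.\<close>

lemma integral_curve_exists:
  assumes A: "smooth_atlas A" and X: "vector_field A X"
    and r: "r > 0" and L: "L \<ge> 0"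
    and loc: "\<And>p. \<exists>c\<in>A. p \<in> cdom c \<and> cball (cmap c p) r \<subseteq> cimg c \<and>
       L-lipschitz_on ({0..1} \<times> cball (cmap c p) r) (\<lambda>(t, x). X c t x) \<and>
       (\<forall>t\<in>{0..1}. \<forall>x\<in>cball (cmap c p) r. norm (X c t x) \<le> L)"
  shows "\<exists>\<gamma>. \<gamma> 0 = p \<and> integral_curve A X 0 1 \<gamma>"
proof -
  \<comment> \<open>The bounds on \<open>L / N\<close> are the contraction condition and the
    condition of staying in the ball of radius \<open>r\<close>.\<close>
  obtain N :: nat where N: "N > 0" "L / N < 1" "L / N \<le> r"
  proof -
    obtain N :: nat where "real N > max L (L / r)"
      using reals_Archimedean2 by blast
    then have "N > 0" "L < N" "L < r * N"
      using L r by (auto simp: pos_divide_less_eq mult.commute)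
    then show thesis
      by (intro that[of N]) (auto simp: field_simps)
  qed
  have step: "\<exists>\<gamma>. \<gamma> a = q \<and> integral_curve A X a b \<gamma>"
    if "0 \<le> a" "a \<le> b" "b \<le> 1" "b - a \<le> 1 / N" for a b q
  proof -
    obtain c where c: "c \<in> A" "q \<in> cdom c" "cball (cmap c q) r \<subseteq> cimg c"
       "L-lipschitz_on ({0..1} \<times> cball (cmap c q) r) (\<lambda>(t, x). X c t x)"
       "\<And>t x. t \<in> {0..1} \<Longrightarrow> x \<in> cball (cmap c q) r \<Longrightarrow> norm (X c t x) \<le> L"
      using loc[of q] by blast
    have "L * (b - a) \<le> L / N"
      using mult_left_mono[OF that(4) L] by simp
    then have "L * (b - a) < 1" "L * (b - a) \<le> r"
      using N by linarith+
    then show ?thesis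
      using integral_curve_exists_in_chart[OF A X c that(1-3)] r by simp
  qed
  have "\<exists>\<gamma>. \<gamma> 0 = p \<and> integral_curve A X 0 (k / N) \<gamma>" if "k \<le> N" for k :: nat
    using that
  proof (induction k)
    case 0
    show ?case
      using step[of 0 0 p] by simp
  next
    case (Suc k)
    then obtain \<gamma>1 where 1: "\<gamma>1 0 = p" "integral_curve A X 0 (k / N) \<gamma>1"
      by auto
    have le: "real k / N \<le> real (Suc k) / N" "real (Suc k) / N \<le> 1" "real (Suc k) / N - k / N \<le> 1 / N"
      using Suc.prems N(1) by (auto simp: field_simps)
    obtain \<gamma>2 where 2: "\<gamma>2 (k / N) = \<gamma>1 (k / N)" "integral_curve A X (k / N) (Suc k / N) \<gamma>2"
      using step[OF _ le, of "\<gamma>1 (k / N)"] by auto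
    from integral_curve_join[OF 1(2) 2(2) 2(1)[symmetric] _ le(1)] 1(1)
    show ?case
      by (intro exI[of _ "\<lambda>t. if t \<in> {0..k / N} then \<gamma>1 t else \<gamma>2 t"]) simp
  qed
  from this[of N] N(1) show ?thesis
    by simp
qed

text \<open>The set of times at which the curves agree contains 0, is closed because the manifold is
  Hausdorff, and is open by local uniqueness in both time directions; [0,1] is connected. The
  condition on \<open>X\<close> concerns x at fixed time only, which suits reparametrised fields
  with their additional factor \<xi>'(t).\<close>

lemma integral_curve_unique:
  fixes A :: "('m::t2_space, 'n::finite) chart set"
  assumes A: "smooth_atlas A"
    and r: "r > 0" and L: "L \<ge> 0"
    and loc: "\<And>p. \<exists>c\<in>A. p \<in> cdom c \<and>
       (\<forall>t\<in>{0..1}. \<forall>x\<in>cball (cmap c p) r. \<forall>y\<in>cball (cmap c p) r. norm (X c t x - X c t y) \<le> L * norm (x - y))"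
    and 1: "integral_curve A X 0 1 \<gamma>1" and 2: "integral_curve A X 0 1 \<gamma>2" and eq: "\<gamma>1 0 = \<gamma>2 0"
    and t: "t \<in> {0..1}"
  shows "\<gamma>1 t = \<gamma>2 t"
proof -
  let ?I = "{0..1::real}"
  define S where "S = {t \<in> ?I. \<gamma>1 t = \<gamma>2 t}"
  have cont: "continuous_on ?I \<gamma>1" "continuous_on ?I \<gamma>2"
    using 1 2 by (auto simp: integral_curve_def)
  have "closedin (top_of_set ?I) S"
  proof -
    have "closedin (top_of_set ?I) (?I \<inter> (\<lambda>t. (\<gamma>1 t, \<gamma>2 t)) -` {y. \<exists>x. y = (x, x)})"
      by (intro continuous_closedin_preimage continuous_on_Pair cont closed_diagonal)
    moreover have "?I \<inter> (\<lambda>t. (\<gamma>1 t, \<gamma>2 t)) -` {y. \<exists>x. y = (x, x)} = S"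
      by (auto simp: S_def)
    ultimately show ?thesis
      by simp
  qed
  moreover have "openin (top_of_set ?I) S"
    unfolding openin_euclidean_subtopology_iff
  proof (intro conjI ballI)
    show "S \<subseteq> ?I"
      by (auto simp: S_def)
    fix t0 assume t0: "t0 \<in> S"
    define q where "q = \<gamma>1 t0"
    have q: "t0 \<in> ?I" "\<gamma>1 t0 = q" "\<gamma>2 t0 = q"
      using t0 by (auto simp: S_def q_def)
    obtain c where c: "c \<in> A" "q \<in> cdom c"
      and lip: "\<And>t x y. t \<in> ?I \<Longrightarrow> x \<in> cball (cmap c q) r \<Longrightarrow> y \<in> cball (cmap c q) r \<Longrightarrow>
        norm (X c t x - X c t y) \<le> L * norm (x - y)"
      using loc[of q] by blast
    let ?V = "{p \<in> cdom c. cmap c p \<in> ball (cmap c q) r}"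
    have V: "open ?V" "q \<in> ?V"
      using c r open_chart_preimage[OF A c(1) open_ball] by auto
    have "\<forall>\<^sub>F s in at t0 within ?I. \<gamma>1 s \<in> ?V \<and> \<gamma>2 s \<in> ?V"
      using V q by (intro eventually_conj continuous_on_eventually_in_open cont) auto
    then obtain e where e: "e > 0"
      "\<And>s. s \<in> ?I \<Longrightarrow> dist s t0 < e \<Longrightarrow> \<gamma>1 s \<in> ?V \<and> \<gamma>2 s \<in> ?V"
      unfolding eventually_at using V(2) q
      by (metis (no_types, lifting))
    \<comment> \<open>\<open>e / 2\<close> keeps both curves in the chart ball; the other term makes
      L \<eta> < 1, and the 1 in its denominator takes care of L = 0.\<close>
    define \<eta> where "\<eta> = min (e / 2) (1 / (2 * (L + 1)))"
    have \<eta>: "\<eta> > 0" "\<eta> < e" "L * \<eta> < 1"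
    proof -
      show "\<eta> > 0" "\<eta> < e"
        using e(1) L by (auto simp: \<eta>_def min_less_iff_disj)
      have "L * \<eta> \<le> L * (1 / (2 * (L + 1)))"
        using L by (intro mult_left_mono) (auto simp: \<eta>_def)
      also have "\<dots> < 1"
        using L by (simp add: field_simps)
      finally show "L * \<eta> < 1" .
    qed
    define J where "J = ?I \<inter> cball t0 \<eta>"
    have J: "s \<in> ?I" "\<bar>s - t0\<bar> \<le> \<eta>" "\<gamma>1 s \<in> ?V" "\<gamma>2 s \<in> ?V" if "s \<in> J" for s
      using that e(2)[of s] \<eta>(2) by (auto simp: J_def dist_real_def)
    have der: "((\<lambda>s. cmap c (\<gamma> s)) has_vector_derivative X c s (cmap c (\<gamma> s))) (at s within J)"
      if "integral_curve A X 0 1 \<gamma>" "s \<in> J" "\<gamma> s \<in> ?V" for \<gamma> s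
      by (rule has_vector_derivative_within_subset[OF integral_curveD[OF that(1) _ c(1)]])
        (use that J(1)[OF that(2)] in \<open>auto simp: J_def\<close>)
    have "\<gamma>1 s = \<gamma>2 s" if s: "s \<in> J" for s
    proof -
      have "cmap c (\<gamma>1 s) = cmap c (\<gamma>2 s)"
      proof (rule lipschitz_ode_locally_unique[where f = "X c"
            and u = "\<lambda>s. cmap c (\<gamma>1 s)" and v = "\<lambda>s. cmap c (\<gamma>2 s)" and J = J and \<tau> = t0 and \<eta> = \<eta> and L = L])
        show "compact J" "convex J"
          unfolding J_def by (auto intro: compact_Int convex_Int)
        show "t0 \<in> J" "cmap c (\<gamma>1 t0) = cmap c (\<gamma>2 t0)"
          using q \<eta>(1) by (auto simp: J_def)
        show "norm (X c s (cmap c (\<gamma>1 s)) - X c s (cmap c (\<gamma>2 s))) \<le> L * norm (cmap c (\<gamma>1 s) - cmap c (\<gamma>2 s))"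
          if "s \<in> J" for s
          using J[OF that] by (intro lip) auto
        show "\<bar>s - t0\<bar> \<le> \<eta>" if "s \<in> J" for s
          using J(2)[OF that] .
      qed (use der[OF 1] der[OF 2] J(3,4) s L \<eta>(3) in blast)+
      moreover have "\<gamma>1 s \<in> cdom c" "\<gamma>2 s \<in> cdom c"
        using J[OF s] by auto
      ultimately show ?thesis
        using chart_simps(1)[OF A c(1)] by metis
    qed
    then show "\<exists>e>0. \<forall>s\<in>?I. dist s t0 < e \<longrightarrow> s \<in> S"
      using \<eta>(1) by (intro exI[of _ \<eta>]) (auto simp: S_def J_def dist_commute)
  qed
  ultimately have "S = {} \<or> S = ?I"
    using connected_clopen[THEN iffD1, OF connected_Icc] by blast
  moreover have "0 \<in> S"
    using eq by (simp add: S_def)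
  ultimately have "t \<in> S"
    using t by blast
  then show ?thesis
    by (simp add: S_def)
qed

text \<open>In a chart around \<gamma>(t) the curve moves from its position at t at a rate of at
  most L + 1, and F is L-Lipschitz in (t, x); together this is L (1 + (L + 1)) = L (L + 2). The
  chart changes with t but the constant does not, and on an interval such local bounds add up to a
  global one.\<close>

lemma lipschitz_along_integral_curve:
  fixes F :: "real \<Rightarrow> 'm::topological_space \<Rightarrow> real"
  assumes A: "smooth_atlas A" and \<gamma>: "integral_curve A X 0 1 \<gamma>"
    and r: "r > 0"
    and loc: "\<And>p. \<exists>c\<in>A. p \<in> cdom c \<and> (\<forall>t\<in>{0..1}. norm (X c t (cmap c p)) \<le> L) \<and>
      L-lipschitz_on ({0..1} \<times> cball (cmap c p) r) (\<lambda>(t, x). F t (cinv c x))"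
  shows "(L * (L + 2))-lipschitz_on {0..1} (\<lambda>t. F t (\<gamma> t))"
proof -
  let ?I = "{0..1::real}"
  have L: "L \<ge> 0"
    using loc lipschitz_on_nonneg by blast
  have near: "\<forall>\<^sub>F s in at t within ?I. dist (F s (\<gamma> s)) (F t (\<gamma> t)) \<le> L * (L + 2) * \<bar>s - t\<bar>"
    if t: "t \<in> ?I" for t
  proof -
    obtain c where c: "c \<in> A" "\<gamma> t \<in> cdom c" "norm (X c t (cmap c (\<gamma> t))) \<le> L"
      and lip: "L-lipschitz_on (?I \<times> cball (cmap c (\<gamma> t)) r) (\<lambda>(t, x). F t (cinv c x))"
      using loc[of "\<gamma> t"] t by blast
    let ?x = "\<lambda>s. cmap c (\<gamma> s)"
    have "(?x has_derivative (\<lambda>h. h *\<^sub>R X c t (?x t))) (at t within ?I)"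
      using integral_curveD[OF \<gamma> t c(1,2)] by (simp add: has_vector_derivative_def)
    then have "\<forall>e>0. \<exists>d>0. \<forall>s\<in>?I. norm (s - t) < d \<longrightarrow>
        norm (?x s - ?x t - (s - t) *\<^sub>R X c t (?x t)) \<le> e * norm (s - t)"
      unfolding has_derivative_within_alt by (rule conjunct2)
    \<comment> \<open>The error quotient 1 is the slack that raises the speed bound from L to L +
      1.\<close>
    then have "\<exists>d>0. \<forall>s\<in>?I. norm (s - t) < d \<longrightarrow>
        norm (?x s - ?x t - (s - t) *\<^sub>R X c t (?x t)) \<le> 1 * norm (s - t)"
      by (rule allE[where x = 1]) (erule impE, rule zero_less_one)
    then obtain d where d: "d > 0"
      "\<And>s. s \<in> ?I \<Longrightarrow> \<bar>s - t\<bar> < d \<Longrightarrow> norm (?x s - ?x t - (s - t) *\<^sub>R X c t (?x t)) \<le> 1 * \<bar>s - t\<bar>"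
      unfolding real_norm_def by blast
    have "\<forall>\<^sub>F s in at t within ?I. \<gamma> s \<in> {q \<in> cdom c. cmap c q \<in> ball (?x t) r}"
      using \<gamma> t c r open_chart_preimage[OF A c(1) open_ball]
      by (intro continuous_on_eventually_in_open) (auto simp: integral_curve_def)
    moreover have "\<forall>\<^sub>F s in at t within ?I. \<bar>s - t\<bar> < d \<and> s \<in> ?I"
      unfolding eventually_at by (intro exI[of _ d]) (use d in \<open>auto simp: dist_real_def\<close>)
    ultimately show ?thesis
    proof eventually_elim
      case (elim s)
      have "norm (?x s - ?x t) \<le> norm (?x s - ?x t - (s - t) *\<^sub>R X c t (?x t)) + norm ((s - t) *\<^sub>R X c t (?x t))"
        using norm_triangle_ineq[of "?x s - ?x t - (s - t) *\<^sub>R X c t (?x t)" "(s - t) *\<^sub>R X c t (?x t)"] by simp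
      also have "\<dots> \<le> \<bar>s - t\<bar> + \<bar>s - t\<bar> * L"
        using d(2)[of s] elim c(3) by (intro add_mono) (auto intro: mult_left_mono)
      finally have x: "dist (?x s) (?x t) \<le> (L + 1) * \<bar>s - t\<bar>"
        by (simp add: dist_norm algebra_simps)
      have "dist (F s (\<gamma> s)) (F t (\<gamma> t)) = dist (F s (cinv c (?x s))) (F t (cinv c (?x t)))"
        using elim c chart_simps(1)[OF A c(1)] by simp
      also have "\<dots> \<le> L * dist (s, ?x s) (t, ?x t)"
        using lipschitz_onD[OF lip, of "(s, ?x s)" "(t, ?x t)"] elim t r by auto
      also have "\<dots> \<le> L * (dist s t + dist (?x s) (?x t))"
        using L by (intro mult_left_mono) (auto simp: dist_Pair_Pair sqrt_sum_squares_le_sum)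
      also have "\<dots> \<le> L * (\<bar>s - t\<bar> + (L + 1) * \<bar>s - t\<bar>)"
        using L x by (intro mult_left_mono) (auto simp: dist_real_def)
      finally show ?case
        by (simp add: algebra_simps)
    qed
  qed
  show ?thesis
  proof (rule locally_lipschitz_imp_lipschitz)
    show "continuous_on ?I (\<lambda>t. F t (\<gamma> t))"
      unfolding continuous_on_def
    proof
      fix t assume t: "t \<in> ?I"
      have "((\<lambda>s. L * (L + 2) * \<bar>s - t\<bar>) \<longlongrightarrow> L * (L + 2) * \<bar>t - t\<bar>) (at t within ?I)"
        by (intro tendsto_intros)
      then have "((\<lambda>s. dist (F s (\<gamma> s)) (F t (\<gamma> t))) \<longlongrightarrow> 0) (at t within ?I)"
        by - (rule Lim_null_comparison[OF eventually_mono[OF near[OF t]]], simp_all)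
      then show "((\<lambda>s. F s (\<gamma> s)) \<longlongrightarrow> F t (\<gamma> t)) (at t within ?I)"
        by (rule tendsto_dist_iff[THEN iffD2])
    qed
  next
    fix x y :: real assume x: "x \<in> {0..<1}" "x < y"
    then obtain d where d: "d > 0"
      "\<And>s. s \<in> ?I \<Longrightarrow> s \<noteq> x \<Longrightarrow> dist s x < d \<Longrightarrow> dist (F s (\<gamma> s)) (F x (\<gamma> x)) \<le> L * (L + 2) * \<bar>s - x\<bar>"
      using near[of x] by (auto simp: eventually_at)
    \<comment> \<open>A single point slightly to the right of x is enough; it must lie in (x, y],
      within [0,1] and within distance d of x.\<close>
    define z where "z = min (min y 1) (x + d / 2)"
    have "z \<in> {x<..y}" "z \<in> ?I" "dist z x < d"
      using x d(1) by (auto simp: z_def dist_real_def min_def)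
    with d(2)[of z] show "\<exists>z\<in>{x<..y}. dist (F z (\<gamma> z)) (F x (\<gamma> x)) \<le> L * (L + 2) * (z - x)"
      by (intro bexI[of _ z]) auto
  qed (use L in auto)
qed

section \<open>Oscillation and reparametrisation\<close>

lemma bdd_real_function:
  assumes "\<And>p. \<bar>f p\<bar> \<le> (B::real)"
  shows "bdd_above (range f)" "bdd_below (range f)"
  using assms by (auto simp: abs_le_iff minus_le_iff intro!: bdd_aboveI[of _ B] bdd_belowI[of _ "- B"])

text \<open>The bound is there to make supremum and infimum genuine: over an unbounded set of reals
  they carry no information.\<close>

lemma le_osc:
  assumes "\<And>p. \<bar>f p\<bar> \<le> B"
  shows "f p - f q \<le> osc f"
  unfolding osc_def using bdd_real_function[of f, OF assms]
  by (intro diff_mono cSUP_upper cINF_lower) auto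

lemma abs_diff_le_osc:
  assumes "\<And>p. \<bar>f p\<bar> \<le> B"
  shows "\<bar>f p - f q\<bar> \<le> osc f"
  using le_osc[of f, OF assms, of p q] le_osc[of f, OF assms, of q p] by simp

lemma osc_le:
  assumes "\<And>p q. f p - f q \<le> B"
  shows "osc f \<le> B"
proof -
  have "f p \<le> B + (INF q. f q)" for p
  proof -
    have "f p - B \<le> (INF q. f q)"
      by (rule cINF_greatest) (use assms[of p] in \<open>auto simp: algebra_simps\<close>)
    then show ?thesis
      by simp
  qed
  then have "(SUP p. f p) \<le> B + (INF q. f q)"
    by (intro cSUP_least) auto
  then show ?thesis
    by (simp add: osc_def)
qed

lemma osc_nonneg:
  assumes "\<And>p. \<bar>f p\<bar> \<le> B"
  shows "osc f \<ge> 0"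
  using le_osc[of f, OF assms, of undefined undefined] by simp

lemma osc_add_const:
  assumes "\<And>p. \<bar>f p\<bar> \<le> B"
  shows "osc (\<lambda>p. f p + c) = osc f"
proof (rule antisym)
  have "\<bar>f p + c\<bar> \<le> B + \<bar>c\<bar>" for p
    using assms[of p] by linarith
  from le_osc[of "\<lambda>p. f p + c", OF this] show "osc f \<le> osc (\<lambda>p. f p + c)"
    by (intro osc_le) simp
  show "osc (\<lambda>p. f p + c) \<le> osc f"
    using le_osc[of f, OF assms] by (intro osc_le) simp
qed

text \<open>The integrand of \<open>D0\<close> with the harmonic form replaced by its list of
  coordinates, so that the estimate can be carried out without any geometry.\<close>

definition osc_norm :: "nat \<Rightarrow> ('m \<Rightarrow> real) \<Rightarrow> (nat \<Rightarrow> real) \<Rightarrow> real" where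
  "osc_norm m u l = osc u + (\<Sum>k<m. \<bar>l k\<bar>)"

lemma osc_norm_nonneg:
  assumes "\<And>p. \<bar>u p\<bar> \<le> B"
  shows "osc_norm m u l \<ge> 0"
  using osc_nonneg[of u, OF assms] by (simp add: osc_norm_def sum_nonneg)

lemma osc_norm_le:
  assumes "\<And>p. \<bar>u p\<bar> \<le> B" "\<And>k. k < m \<Longrightarrow> \<bar>l k\<bar> \<le> B"
  shows "osc_norm m u l \<le> (2 + real m) * B"
proof -
  have "osc u \<le> 2 * B"
  proof (rule osc_le)
    show "u p - u q \<le> 2 * B" for p q
      using assms(1)[of p] assms(1)[of q] by linarith
  qed
  moreover have "(\<Sum>k<m. \<bar>l k\<bar>) \<le> (\<Sum>k<m. B)"
    using assms(2) by (intro sum_mono) auto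
  ultimately show ?thesis
    by (simp add: osc_norm_def algebra_simps)
qed

text \<open>Here u, u' are the values of one path at two times, v, v' those of the reference path at
  the same times, and a, b the speeds. The decomposition is a u - b u' = a (u - v) + a (v - v') + (a
  - b) v' - b (u' - v').\<close>

lemma osc_norm_telescope:
  assumes u: "\<And>p. \<bar>u p\<bar> \<le> B" "\<And>p. \<bar>u' p\<bar> \<le> B" "\<And>p. \<bar>v p\<bar> \<le> B" "\<And>p. \<bar>v' p\<bar> \<le> B"
  shows "osc_norm m (\<lambda>p. a * u p - b * u' p) (\<lambda>k. a * l k - b * l' k) \<le>
    \<bar>a\<bar> * osc_norm m (\<lambda>p. u p - v p) (\<lambda>k. l k - w k) +
    \<bar>a\<bar> * osc_norm m (\<lambda>p. v p - v' p) (\<lambda>k. w k - w' k) +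
    \<bar>a - b\<bar> * osc_norm m v' w' +
    \<bar>b\<bar> * osc_norm m (\<lambda>p. u' p - v' p) (\<lambda>k. l' k - w' k)"
proof -
  have bnd: "\<bar>u p - v p\<bar> \<le> 2 * B" "\<bar>v p - v' p\<bar> \<le> 2 * B" "\<bar>u' p - v' p\<bar> \<le> 2 * B" for p
    using u[of p] by linarith+
  let ?O = "\<bar>a\<bar> * osc (\<lambda>p. u p - v p) + \<bar>a\<bar> * osc (\<lambda>p. v p - v' p) + \<bar>a - b\<bar> * osc v' +
    \<bar>b\<bar> * osc (\<lambda>p. u' p - v' p)"
  have scale: "c * (f p - f q) \<le> \<bar>c\<bar> * osc f" if "\<And>p. \<bar>f p\<bar> \<le> B'" for c B' :: real and f :: "_ \<Rightarrow> real" and p q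
  proof -
    have "c * (f p - f q) \<le> \<bar>c\<bar> * \<bar>f p - f q\<bar>"
      by (metis abs_ge_self abs_mult)
    also have "\<dots> \<le> \<bar>c\<bar> * osc f"
      using abs_diff_le_osc[of f, OF that] by (intro mult_left_mono) auto
    finally show ?thesis .
  qed
  have "osc (\<lambda>p. a * u p - b * u' p) \<le> ?O"
  proof (rule osc_le)
    fix p q
    have "(a * u p - b * u' p) - (a * u q - b * u' q) =
        a * ((u p - v p) - (u q - v q)) + a * ((v p - v' p) - (v q - v' q)) + (a - b) * (v' p - v' q) +
        (- b) * ((u' p - v' p) - (u' q - v' q))"
      by (simp add: algebra_simps)
    also have "\<dots> \<le> \<bar>a\<bar> * osc (\<lambda>p. u p - v p) + \<bar>a\<bar> * osc (\<lambda>p. v p - v' p) + \<bar>a - b\<bar> * osc v' +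
        \<bar>- b\<bar> * osc (\<lambda>p. u' p - v' p)"
      using scale[of "\<lambda>p. u p - v p", OF bnd(1), of a p q] scale[of "\<lambda>p. v p - v' p", OF bnd(2), of a p q]
        scale[of v', OF u(4), of "a - b" p q] scale[of "\<lambda>p. u' p - v' p", OF bnd(3), of "- b" p q]
      by linarith
    finally show "(a * u p - b * u' p) - (a * u q - b * u' q) \<le> ?O"
      by simp
  qed
  moreover have "(\<Sum>k<m. \<bar>a * l k - b * l' k\<bar>) \<le> (\<Sum>k<m. \<bar>a\<bar> * \<bar>l k - w k\<bar> + \<bar>a\<bar> * \<bar>w k - w' k\<bar> +
      \<bar>a - b\<bar> * \<bar>w' k\<bar> + \<bar>b\<bar> * \<bar>l' k - w' k\<bar>)"
  proof (rule sum_mono)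
    fix k
    have "a * l k - b * l' k = a * (l k - w k) + a * (w k - w' k) + (a - b) * w' k + (- b) * (l' k - w' k)"
      by (simp add: algebra_simps)
    then have "\<bar>a * l k - b * l' k\<bar> \<le> \<bar>a * (l k - w k)\<bar> + \<bar>a * (w k - w' k)\<bar> + \<bar>(a - b) * w' k\<bar> + \<bar>(- b) * (l' k - w' k)\<bar>"
      by linarith
    then show "\<bar>a * l k - b * l' k\<bar> \<le> \<bar>a\<bar> * \<bar>l k - w k\<bar> + \<bar>a\<bar> * \<bar>w k - w' k\<bar> +
      \<bar>a - b\<bar> * \<bar>w' k\<bar> + \<bar>b\<bar> * \<bar>l' k - w' k\<bar>"
      by (simp add: abs_mult)
  qed
  ultimately show ?thesis
    by (simp add: osc_norm_def sum.distrib sum_distrib_left distrib_left)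
qed

text \<open>Here \<open>V\<close> is a function part and \<open>l\<close> lists the harmonic coordinates of the form part of a
  generator.\<close>

definition regular_path :: "nat \<Rightarrow> real \<Rightarrow> (real \<Rightarrow> 'm \<Rightarrow> real) \<Rightarrow> (real \<Rightarrow> nat \<Rightarrow> real) \<Rightarrow> bool" where
  "regular_path m C V l \<longleftrightarrow> (\<forall>p. lipschitz_bounded C {0..1} (\<lambda>t. V t p)) \<and>
     (\<forall>k<m. lipschitz_bounded C {0..1} (\<lambda>t. l t k))"

lemma regular_pathD:
  assumes "regular_path m C V l" "s \<in> {0..1}" "t \<in> {0..1}"
  shows "\<bar>V t p\<bar> \<le> C" "\<bar>V s p - V t p\<bar> \<le> C * \<bar>s - t\<bar>"
    "k < m \<Longrightarrow> \<bar>l t k\<bar> \<le> C" "k < m \<Longrightarrow> \<bar>l s k - l t k\<bar> \<le> C * \<bar>s - t\<bar>"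
proof -
  have *: "\<bar>f t\<bar> \<le> C" "\<bar>f s - f t\<bar> \<le> C * \<bar>s - t\<bar>" if "lipschitz_bounded C {0..1} f" for f :: "real \<Rightarrow> real"
    using that lipschitz_onD[of C "{0..1}" f s t] assms(2,3)
    by (auto simp: lipschitz_bounded_def dist_real_def)
  show "\<bar>V t p\<bar> \<le> C" "\<bar>V s p - V t p\<bar> \<le> C * \<bar>s - t\<bar>"
    "k < m \<Longrightarrow> \<bar>l t k\<bar> \<le> C" "k < m \<Longrightarrow> \<bar>l s k - l t k\<bar> \<le> C * \<bar>s - t\<bar>"
    using assms(1) *[of "\<lambda>t. V t p"] *[of "\<lambda>t. l t k"] by (simp_all add: regular_path_def)
qed

lemma regular_path_nonneg: "regular_path m C V l \<Longrightarrow> C \<ge> 0"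
  unfolding regular_path_def using lipschitz_bounded_nonneg by blast

lemma regular_path_diff:
  assumes "regular_path m C V l" "regular_path m C' V' l'"
  shows "regular_path m (C + C') (\<lambda>t p. V t p - V' t p) (\<lambda>t k. l t k - l' t k)"
proof -
  have "lipschitz_bounded (C + C') {0..1} (\<lambda>t. f t - f' t)"
    if "lipschitz_bounded C {0..1} f" "lipschitz_bounded C' {0..1} f'" for f f' :: "real \<Rightarrow> real"
    using lipschitz_bounded_add[OF that(1) lipschitz_bounded_uminus[OF that(2)]] by simp
  with assms show ?thesis
    by (auto simp: regular_path_def)
qed

lemma continuous_on_osc_norm:
  assumes V: "regular_path m C V l"
  shows "continuous_on {0..1} (\<lambda>t. osc_norm m (V t) (l t))"
proof -
  let ?I = "{0..1::real}"
  have le: "osc_norm m (V s) (l s) \<le> osc_norm m (V t) (l t) + (2 + real m) * (C * \<bar>s - t\<bar>)"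
    if st: "s \<in> ?I" "t \<in> ?I" for s t
  proof -
    \<comment> \<open>The triangle inequality is the telescoping estimate with a = 1, b = 0 and v =
      v'.\<close>
    have "osc_norm m (V s) (l s) \<le> osc_norm m (\<lambda>p. V s p - V t p) (\<lambda>k. l s k - l t k) + osc_norm m (V t) (l t)"
      using osc_norm_telescope[of "V s" C "V t" "V t" "V t" m 1 0 "l s" "l t" "l t" "l t"]
        regular_pathD(1)[OF V st] regular_pathD(1)[OF V st(2,1)] by (simp add: osc_norm_def osc_def)
    also have "osc_norm m (\<lambda>p. V s p - V t p) (\<lambda>k. l s k - l t k) \<le> (2 + real m) * (C * \<bar>s - t\<bar>)"
      by (intro osc_norm_le regular_pathD[OF V st])
    finally show ?thesis
      by simp
  qed
  have "((2 + real m) * C)-lipschitz_on ?I (\<lambda>t. osc_norm m (V t) (l t))"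
  proof (rule lipschitz_onI)
    fix s t assume "s \<in> ?I" "t \<in> ?I"
    with le[of s t] le[of t s] show "dist (osc_norm m (V s) (l s)) (osc_norm m (V t) (l t)) \<le> ((2 + real m) * C) * dist s t"
      by (auto simp: dist_real_def abs_minus_commute[of t s] mult_ac)
  qed (use regular_path_nonneg[OF V] in auto)
  then show ?thesis
    by (rule lipschitz_on_continuous_on)
qed

section \<open>Monotone changes of time and the equicontinuity estimate\<close>

abbreviation deriv01 :: "(real \<Rightarrow> real) \<Rightarrow> real \<Rightarrow> real" where
  "deriv01 \<xi> t \<equiv> vector_derivative \<xi> (at t within {0..1})"

lemma mono_on_deriv_nonneg:
  fixes \<xi> :: "real \<Rightarrow> real"
  assumes \<xi>: "mono_on {0..1} \<xi>" and t: "t \<in> {0..1}" and D: "(\<xi> has_real_derivative D) (at t within {0..1})"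
  shows "D \<ge> 0"
proof (rule tendsto_lowerbound)
  show "((\<lambda>s. (\<xi> s - \<xi> t) / (s - t)) \<longlongrightarrow> D) (at t within {0..1})"
    using D by (simp add: has_field_derivative_iff)
  have "0 \<le> (\<xi> s - \<xi> t) / (s - t)" if "s \<in> {0..1}" "s \<noteq> t" for s
    using mono_onD[OF \<xi>, of s t] mono_onD[OF \<xi>, of t s] t that
    by (cases "s < t") (auto simp: divide_nonneg_pos divide_nonpos_neg)
  then show "\<forall>\<^sub>F s in at t within {0..1}. 0 \<le> (\<xi> s - \<xi> t) / (s - t)"
    by (auto simp: eventually_at_filter)
  show "at t within {0..1} \<noteq> bot"
    using t by (simp add: trivial_limit_within)
qed

lemma monotone_reparam_deriv:
  assumes "monotone_reparam \<xi>"
  shows "t \<in> {0..1} \<Longrightarrow> (\<xi> has_real_derivative deriv01 \<xi> t) (at t within {0..1})"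
    "continuous_on {0..1} (deriv01 \<xi>)" "continuous_on {0..1} \<xi>" "t \<in> {0..1} \<Longrightarrow> \<xi> t \<in> {0..1}"
  using assms smooth_on_real_interval_derivative[of \<xi>] smooth_on_imp_continuous_on[of "{0..1}" \<xi>]
  by (auto simp: monotone_reparam_def image_subset_iff)

text \<open>One sign for the whole interval allows |\<xi>'| to be integrated by substitution, for
  decreasing \<xi> as well.\<close>

lemma monotone_reparam_sign:
  assumes "monotone_reparam \<xi>"
  obtains \<sigma> :: real where "\<bar>\<sigma>\<bar> = 1" "\<And>t. t \<in> {0..1} \<Longrightarrow> \<bar>deriv01 \<xi> t\<bar> = \<sigma> * deriv01 \<xi> t"
proof -
  note D = monotone_reparam_deriv(1)[OF assms]
  consider "mono_on {0..1} \<xi>" | "antimono_on {0..1} \<xi>"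
    using assms by (auto simp: monotone_reparam_def)
  then show thesis
  proof cases
    case 1
    then show thesis
      using that[of 1] mono_on_deriv_nonneg[OF 1 _ D] by auto
  next
    case 2
    then have "mono_on {0..1} (\<lambda>t. - \<xi> t)"
      by (auto simp: monotone_on_def)
    from mono_on_deriv_nonneg[OF this _ DERIV_minus[OF D]] show thesis
      using that[of "-1"] by auto
  qed
qed

text \<open>Without absolute values, substitution yields \<plusminus> the integral of f between
  \<xi>(0) and \<xi>(1), a part of [0,1]; monotonicity is what permits the absolute value. For
  constant f this bounds the total variation of \<xi> by 1.\<close>

lemma monotone_substitution_le:
  fixes f :: "real \<Rightarrow> real"
  assumes \<xi>: "monotone_reparam \<xi>" and f: "continuous_on {0..1} f" "\<And>t. t \<in> {0..1} \<Longrightarrow> f t \<ge> 0"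
  shows "integral {0..1} (\<lambda>t. \<bar>deriv01 \<xi> t\<bar> * f (\<xi> t)) \<le> integral {0..1} f"
proof -
  note D = monotone_reparam_deriv[OF \<xi>]
  obtain \<sigma> where \<sigma>: "\<bar>\<sigma>\<bar> = 1" "\<And>t. t \<in> {0..1} \<Longrightarrow> \<bar>deriv01 \<xi> t\<bar> = \<sigma> * deriv01 \<xi> t"
    using monotone_reparam_sign[OF \<xi>] by blast
  \<comment> \<open>At least one of the two intervals is empty or a single point, so
    \<open>?v\<close> is a signed integral that covers both orders of the endpoints.\<close>
  let ?v = "integral {\<xi> 0..\<xi> 1} f - integral {\<xi> 1..\<xi> 0} f"
  have "((\<lambda>t. deriv01 \<xi> t *\<^sub>R f (\<xi> t)) has_integral ?v) {0..1}"
    by (rule has_integral_substitution_general[of "{}" 0 1 \<xi> 0 1]) (use D f in auto)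
  then have "((\<lambda>t. \<sigma> * (deriv01 \<xi> t * f (\<xi> t))) has_integral \<sigma> * ?v) {0..1}"
    by (auto intro: has_integral_mult_right)
  then have "integral {0..1} (\<lambda>t. \<sigma> * (deriv01 \<xi> t * f (\<xi> t))) = \<sigma> * ?v"
    by (rule integral_unique)
  moreover have "integral {0..1} (\<lambda>t. \<bar>deriv01 \<xi> t\<bar> * f (\<xi> t)) = integral {0..1} (\<lambda>t. \<sigma> * (deriv01 \<xi> t * f (\<xi> t)))"
    by (rule integral_cong) (simp add: \<sigma>(2))
  moreover have bnd: "0 \<le> integral {a..b} f \<and> integral {a..b} f \<le> integral {0..1} f"
    if "a \<in> {0..1}" "b \<in> {0..1}" for a b
  proof -
    have "f integrable_on {a..b}" "f integrable_on {0..1}"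
      using that by (auto intro!: integrable_continuous_real continuous_on_subset[OF f(1)])
    with f(2) that show ?thesis
      by (intro conjI integral_nonneg integral_subset_le) auto
  qed
  have "\<bar>?v\<bar> \<le> integral {0..1} f"
    using bnd[OF D(4)[of 0] D(4)[of 1]] bnd[OF D(4)[of 1] D(4)[of 0]] by (intro abs_leI) auto
  moreover have "\<sigma> * ?v \<le> \<bar>?v\<bar>"
    using abs_ge_self[of "\<sigma> * ?v"] \<sigma>(1) by (simp add: abs_mult)
  ultimately show ?thesis
    by linarith
qed

lemma ham_norm_diff_bounds:
  assumes \<xi>: "monotone_reparam \<xi>1" "monotone_reparam \<xi>2"
    and \<delta>: "ham_norm (\<lambda>t. \<xi>1 t - \<xi>2 t) < \<delta>"
  shows "t \<in> {0..1} \<Longrightarrow> \<bar>\<xi>1 t - \<xi>2 t\<bar> \<le> \<delta>"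
    and "integral {0..1} (\<lambda>t. \<bar>deriv01 \<xi>1 t - deriv01 \<xi>2 t\<bar>) \<le> \<delta>"
proof -
  let ?I = "{0..1::real}"
  note D = monotone_reparam_deriv[OF \<xi>(1)] monotone_reparam_deriv[OF \<xi>(2)]
  have "deriv01 (\<lambda>t. \<xi>1 t - \<xi>2 t) t = deriv01 \<xi>1 t - deriv01 \<xi>2 t" if t: "t \<in> ?I" for t
  proof -
    have "((\<lambda>t. \<xi>1 t - \<xi>2 t) has_vector_derivative deriv01 \<xi>1 t - deriv01 \<xi>2 t) (at t within {0..1})"
      using DERIV_diff[OF D(1)[OF t] D(5)[OF t]] by (simp add: has_real_derivative_iff_has_vector_derivative)
    with t show ?thesis
      using vector_derivative_within_cbox[of 0 1 t] by simp
  qed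
  then have eq: "integral ?I (\<lambda>t. \<bar>deriv01 (\<lambda>t. \<xi>1 t - \<xi>2 t) t\<bar>) = integral ?I (\<lambda>t. \<bar>deriv01 \<xi>1 t - deriv01 \<xi>2 t\<bar>)"
    by (intro integral_cong) simp
  have bnd: "\<bar>\<xi>1 t - \<xi>2 t\<bar> \<le> 1" if "t \<in> ?I" for t
    using D(4)[OF that] D(8)[OF that] by auto
  have sup: "\<bar>\<xi>1 t - \<xi>2 t\<bar> \<le> (SUP t\<in>?I. \<bar>\<xi>1 t - \<xi>2 t\<bar>)" if "t \<in> ?I" for t
    by (rule cSUP_upper[OF that]) (use bnd in \<open>auto intro!: bdd_aboveI[of _ 1]\<close>)
  have nonneg: "integral ?I (\<lambda>t. \<bar>deriv01 \<xi>1 t - deriv01 \<xi>2 t\<bar>) \<ge> 0"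
    by (intro integral_nonneg integrable_continuous_real continuous_intros D) auto
  show "t \<in> ?I \<Longrightarrow> \<bar>\<xi>1 t - \<xi>2 t\<bar> \<le> \<delta>"
    using sup[of t] nonneg \<delta> unfolding ham_norm_def eq by linarith
  show "integral ?I (\<lambda>t. \<bar>deriv01 \<xi>1 t - deriv01 \<xi>2 t\<bar>) \<le> \<delta>"
    using sup[of 0] \<delta> unfolding ham_norm_def eq by auto
qed

text \<open>If \<open>f\<close> is not integrable, then its integral is 0.\<close>

lemma integral_le_of_dominated:
  fixes f g :: "real \<Rightarrow> real"
  assumes "g integrable_on S" "\<And>t. t \<in> S \<Longrightarrow> f t \<le> g t" "\<And>t. t \<in> S \<Longrightarrow> 0 \<le> g t"
  shows "integral S f \<le> integral S g"
proof (cases "f integrable_on S")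
  case True
  then show ?thesis
    using assms by (intro integral_le) auto
next
  case False
  then show ?thesis
    using assms by (simp add: not_integrable_integral integral_nonneg)
qed

text \<open>Compares all paths with a single one, whose Lipschitz constant then determines \<open>\<delta>\<close>.\<close>

lemma reparam_equicontinuity:
  fixes V :: "nat \<Rightarrow> real \<Rightarrow> 'm \<Rightarrow> real" and l :: "nat \<Rightarrow> real \<Rightarrow> nat \<Rightarrow> real"
  assumes reg: "\<And>i. i \<ge> 1 \<Longrightarrow> \<exists>C. regular_path m C (V i) (l i)"
    and cauchy: "\<And>e. e > 0 \<Longrightarrow> \<exists>N. \<forall>i\<ge>N. \<forall>j\<ge>N.
      integral {0..1} (\<lambda>t. osc_norm m (\<lambda>p. V i t p - V j t p) (\<lambda>k. l i t k - l j t k)) < e"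
    and \<epsilon>: "\<epsilon> > 0"
  shows "\<exists>\<delta>>0. \<exists>j0\<ge>1. \<forall>\<xi>1 \<xi>2. monotone_reparam \<xi>1 \<and> monotone_reparam \<xi>2 \<and>
      ham_norm (\<lambda>t. \<xi>1 t - \<xi>2 t) < \<delta> \<longrightarrow> (\<forall>i\<ge>j0.
        integral {0..1} (\<lambda>t. osc_norm m
          (\<lambda>p. deriv01 \<xi>1 t * V i (\<xi>1 t) p - deriv01 \<xi>2 t * V i (\<xi>2 t) p)
          (\<lambda>k. deriv01 \<xi>1 t * l i (\<xi>1 t) k - deriv01 \<xi>2 t * l i (\<xi>2 t) k)) < \<epsilon>)"
proof -
  let ?I = "{0..1::real}"
  define E where "E i j t = osc_norm m (\<lambda>p. V i t p - V j t p) (\<lambda>k. l i t k - l j t k)" for i j t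
  \<comment> \<open>The final sum has four terms of at most \<epsilon>/8 each: two comparisons with
    the reference path, one change of time and one change of speed. The total is below
    \<epsilon>/2.\<close>
  have "\<epsilon> / 8 > 0"
    using \<epsilon> by simp
  from cauchy[OF this] obtain N where N: "\<And>i j. i \<ge> N \<Longrightarrow> j \<ge> N \<Longrightarrow> integral ?I (E i j) < \<epsilon> / 8"
    unfolding E_def by blast
  \<comment> \<open>Regularity is available for indices from 1 on.\<close>
  define J where "J = max N 1"
  have J: "J \<ge> 1" "J \<ge> N"
    by (auto simp: J_def)
  obtain C where C: "regular_path m C (V J) (l J)"
    using reg[OF J(1)] by blast
  \<comment> \<open>Bounds both the reference path and its Lipschitz constant in
    \<open>osc_norm\<close>: the oscillation costs 2 C and each of the m coordinates costs
    C.\<close>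
  define K where "K = (2 + real m) * C"
  have K: "K \<ge> 0"
    using regular_path_nonneg[OF C] by (simp add: K_def)
  \<comment> \<open>The summand 1 keeps the denominator positive if \<open>K\<close> is 0.\<close>
  define \<delta> where "\<delta> = \<epsilon> / (8 * (K + 1))"
  have \<delta>: "\<delta> > 0"
    using \<epsilon> K by (simp add: \<delta>_def)
  have K\<delta>: "K * \<delta> \<le> \<epsilon> / 8"
    using \<epsilon> K by (simp add: \<delta>_def field_simps)
  have "integral ?I (\<lambda>t. osc_norm m
          (\<lambda>p. deriv01 \<xi>1 t * V i (\<xi>1 t) p - deriv01 \<xi>2 t * V i (\<xi>2 t) p)
          (\<lambda>k. deriv01 \<xi>1 t * l i (\<xi>1 t) k - deriv01 \<xi>2 t * l i (\<xi>2 t) k)) < \<epsilon>"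
      (is "integral ?I ?f < \<epsilon>")
    if \<xi>: "monotone_reparam \<xi>1" "monotone_reparam \<xi>2" and ham: "ham_norm (\<lambda>t. \<xi>1 t - \<xi>2 t) < \<delta>"
      and i: "i \<ge> J" for \<xi>1 \<xi>2 i
  proof -
    note D = monotone_reparam_deriv[OF \<xi>(1)] monotone_reparam_deriv[OF \<xi>(2)]
    note near = ham_norm_diff_bounds[OF \<xi> ham]
    obtain C' where C': "regular_path m C' (V i) (l i)"
      using reg[of i] i J by auto
    have E_cont: "continuous_on ?I (E i J)"
      unfolding E_def by (rule continuous_on_osc_norm[OF regular_path_diff[OF C' C]])
    have E_nonneg: "E i J t \<ge> 0" if "t \<in> ?I" for t
      unfolding E_def by (rule osc_norm_nonneg) (rule regular_pathD(1)[OF regular_path_diff[OF C' C] that that])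
    have E_int: "integral ?I (E i J) < \<epsilon> / 8"
      using N[of i J] i J by simp
    let ?g1 = "\<lambda>t. \<bar>deriv01 \<xi>1 t\<bar> * E i J (\<xi>1 t)" and ?g2 = "\<lambda>t. \<bar>deriv01 \<xi>1 t\<bar> * (K * \<delta>)"
      and ?g3 = "\<lambda>t. \<bar>deriv01 \<xi>1 t - deriv01 \<xi>2 t\<bar> * K" and ?g4 = "\<lambda>t. \<bar>deriv01 \<xi>2 t\<bar> * E i J (\<xi>2 t)"
    have comp: "continuous_on ?I (\<lambda>t. E i J (\<xi>1 t))" "continuous_on ?I (\<lambda>t. E i J (\<xi>2 t))"
      using D by (auto intro!: continuous_on_compose2[OF E_cont])
    have int: "?g1 integrable_on ?I" "?g2 integrable_on ?I" "?g3 integrable_on ?I" "?g4 integrable_on ?I"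
      using D comp by (auto intro!: integrable_continuous_real continuous_intros)
    have le: "?f t \<le> ?g1 t + ?g2 t + ?g3 t + ?g4 t" if t: "t \<in> ?I" for t
    proof -
      note I = D(4)[OF t] D(8)[OF t]
      let ?B = "max C C'"
      have bnd: "\<bar>V i (\<xi>1 t) p\<bar> \<le> ?B" "\<bar>V i (\<xi>2 t) p\<bar> \<le> ?B" "\<bar>V J (\<xi>1 t) p\<bar> \<le> ?B" "\<bar>V J (\<xi>2 t) p\<bar> \<le> ?B" for p
        using regular_pathD(1)[OF C I, of p] regular_pathD(1)[OF C I(2,1), of p]
          regular_pathD(1)[OF C' I, of p] regular_pathD(1)[OF C' I(2,1), of p] by auto
      have "osc_norm m (\<lambda>p. V J (\<xi>1 t) p - V J (\<xi>2 t) p) (\<lambda>k. l J (\<xi>1 t) k - l J (\<xi>2 t) k) \<le>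
          (2 + real m) * (C * \<bar>\<xi>1 t - \<xi>2 t\<bar>)"
        by (intro osc_norm_le regular_pathD[OF C I])
      also have "\<dots> \<le> (2 + real m) * (C * \<delta>)"
        using near(1)[OF t] regular_path_nonneg[OF C] by (intro mult_left_mono) auto
      finally have 2: "osc_norm m (\<lambda>p. V J (\<xi>1 t) p - V J (\<xi>2 t) p) (\<lambda>k. l J (\<xi>1 t) k - l J (\<xi>2 t) k) \<le> K * \<delta>"
        by (simp add: K_def)
      have 3: "osc_norm m (V J (\<xi>2 t)) (l J (\<xi>2 t)) \<le> K"
        unfolding K_def by (intro osc_norm_le regular_pathD[OF C I])
      have "?f t \<le> ?g1 t + \<bar>deriv01 \<xi>1 t\<bar> * osc_norm m (\<lambda>p. V J (\<xi>1 t) p - V J (\<xi>2 t) p) (\<lambda>k. l J (\<xi>1 t) k - l J (\<xi>2 t) k) +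
          \<bar>deriv01 \<xi>1 t - deriv01 \<xi>2 t\<bar> * osc_norm m (V J (\<xi>2 t)) (l J (\<xi>2 t)) + ?g4 t"
        unfolding E_def by (rule osc_norm_telescope[OF bnd])
      also have "\<dots> \<le> ?g1 t + ?g2 t + ?g3 t + ?g4 t"
        using 2 3 by (intro add_mono mult_left_mono) auto
      finally show ?thesis .
    qed
    have "integral ?I ?f \<le> integral ?I (\<lambda>t. ?g1 t + ?g2 t + ?g3 t + ?g4 t)"
      using int le E_nonneg D K \<delta> by (intro integral_le_of_dominated) (auto intro!: integrable_add add_nonneg_nonneg)
    also have "\<dots> = integral ?I ?g1 + integral ?I ?g2 + integral ?I ?g3 + integral ?I ?g4"
      using int by (simp add: integral_add integrable_add)
    also have "\<dots> \<le> integral ?I (E i J) + K * \<delta> + \<delta> * K + integral ?I (E i J)"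
    proof (intro add_mono)
      show "integral ?I ?g1 \<le> integral ?I (E i J)"
        by (rule monotone_substitution_le[OF \<xi>(1) E_cont E_nonneg])
      show "integral ?I ?g4 \<le> integral ?I (E i J)"
        by (rule monotone_substitution_le[OF \<xi>(2) E_cont E_nonneg])
      \<comment> \<open>Substitution with a constant function: the speed of \<xi>1 enters only
        through its total variation.\<close>
      show "integral ?I ?g2 \<le> K * \<delta>"
        using monotone_substitution_le[OF \<xi>(1), of "\<lambda>_. K * \<delta>"] K \<delta> by simp
      show "integral ?I ?g3 \<le> \<delta> * K"
        using near(2) K by (auto intro: mult_right_mono)
    qed
    also have "\<dots> < \<epsilon>"
      using E_int K\<delta> \<epsilon> by (simp add: mult.commute)
    finally show ?thesis .
  qed
  with \<delta> J(1) show ?thesis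
    by blast
qed

section \<open>The isotopy of a generator\<close>

lemma lin_comb_cong: "(\<And>i. i < m \<Longrightarrow> l i = l' i) \<Longrightarrow> lin_comb m h l = lin_comb m h l'"
  by (simp add: lin_comb_def)

definition covector :: "('m, 'n::finite) generator \<Rightarrow> ('m, 'n) chart \<Rightarrow> real \<Rightarrow> real^'n \<Rightarrow> real^'n \<Rightarrow> real" where
  "covector G c t x v = dfun (fst G t) c x v + snd G t c x v"

definition hamiltonian_field ::
  "('m, 'n::finite) tensor2 \<Rightarrow> ('m, 'n) generator \<Rightarrow> ('m, 'n) chart \<Rightarrow> real \<Rightarrow> real^'n \<Rightarrow> real^'n" where
  "hamiltonian_field \<omega> G c t x = (THE w. \<forall>v. \<omega> c x w v = covector G c t x v)"

text \<open>Results that assume only this apply also to reparametrised generators, for which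
  linearity is checked directly instead of membership in \<open>generators\<close>.\<close>

definition linear_covector :: "('m, 'n::finite) chart set \<Rightarrow> ('m, 'n) generator \<Rightarrow> bool" where
  "linear_covector A G \<longleftrightarrow> (\<forall>t\<in>{0..1}. \<forall>c\<in>A. \<forall>x\<in>cimg c. linear (covector G c t x))"

locale symplectic_manifold =
  fixes A :: "('m::{t2_space, second_countable_topology}, 'n::finite) chart set"
    and \<omega> g :: "('m, 'n) tensor2" and n m :: nat and h :: "nat \<Rightarrow> ('m, 'n) tensor1"
  assumes manifold: "closed_connected_manifold A"
    and symplectic: "symplectic_form A \<omega>"
    and basis: "harmonic_basis A g m h"
begin

lemma atlas: "smooth_atlas A"
  using manifold by (simp add: closed_connected_manifold_def)

lemma omega_bilinear: "c \<in> A \<Longrightarrow> x \<in> cimg c \<Longrightarrow> bilinear (\<omega> c x)"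
  using symplectic by (auto simp: symplectic_form_def smooth_tensor2_def)

lemma omega_nondegenerate: "c \<in> A \<Longrightarrow> x \<in> cimg c \<Longrightarrow> v \<noteq> 0 \<Longrightarrow> \<exists>w. \<omega> c x v w \<noteq> 0"
  using symplectic by (auto simp: symplectic_form_def)

lemma omega_transition:
  assumes "c \<in> A" "d \<in> A" "p \<in> cdom c" "p \<in> cdom d"
  shows "\<omega> c (cmap c p) v w =
    \<omega> d (cmap d p) (transition_deriv c d (cmap c p) v) (transition_deriv c d (cmap c p) w)"
proof -
  have "\<forall>c\<in>A. \<forall>d\<in>A. \<forall>x\<in>cmap c ` (cdom c \<inter> cdom d). \<forall>v w. \<omega> c x v w =
      \<omega> d (cmap d (cinv c x)) (transition_deriv c d x v) (transition_deriv c d x w)"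
    using symplectic by (simp add: symplectic_form_def smooth_tensor2_def)
  then have "\<omega> c (cmap c p) v w = \<omega> d (cmap d (cinv c (cmap c p)))
      (transition_deriv c d (cmap c p) v) (transition_deriv c d (cmap c p) w)"
    using assms by blast
  then show ?thesis
    by (simp add: chart_simps(1)[OF atlas assms(1,3)])
qed

lemma one_form_transition:
  assumes "one_form A \<alpha>" "c \<in> A" "d \<in> A" "p \<in> cdom c" "p \<in> cdom d"
  shows "\<alpha> c (cmap c p) v = \<alpha> d (cmap d p) (transition_deriv c d (cmap c p) v)"
proof -
  have "\<forall>c\<in>A. \<forall>d\<in>A. \<forall>x\<in>cmap c ` (cdom c \<inter> cdom d). \<forall>v.
      \<alpha> c x v = \<alpha> d (cmap d (cinv c x)) (transition_deriv c d x v)"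
    using assms(1) by (simp add: one_form_def)
  then have "\<alpha> c (cmap c p) v = \<alpha> d (cmap d (cinv c (cmap c p))) (transition_deriv c d (cmap c p) v)"
    using assms by blast
  then show ?thesis
    by (simp add: chart_simps(1)[OF atlas assms(2,4)])
qed

lemma dfun_transition:
  assumes "c \<in> A" "d \<in> A" "p \<in> cdom c" "p \<in> cdom d"
    and f: "(f \<circ> cinv d) differentiable (at (cmap d p))"
  shows "dfun f c (cmap c p) v = dfun f d (cmap d p) (transition_deriv c d (cmap c p) v)"
proof -
  note simps = chart_simps[OF atlas assms(1)] chart_simps[OF atlas assms(2)]
  have "((f \<circ> cinv d) has_derivative dfun f d (cmap d p)) (at ((cmap d \<circ> cinv c) (cmap c p)))"
    using f simps assms unfolding dfun_def by (simp add: frechet_derivative_works)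
  from diff_chain_at[OF transition_has_derivative[OF atlas assms(1-4)] this]
  have "((f \<circ> cinv d \<circ> (cmap d \<circ> cinv c)) has_derivative
      (dfun f d (cmap d p) \<circ> transition_deriv c d (cmap c p))) (at (cmap c p))" .
  then have "((f \<circ> cinv c) has_derivative
      (dfun f d (cmap d p) \<circ> transition_deriv c d (cmap c p))) (at (cmap c p))"
    by (rule has_derivative_transform_within_open[OF _ open_chart_overlap[OF atlas assms(1,2)]])
      (use assms simps in auto)
  then show ?thesis
    unfolding dfun_def[of f c] by (simp add: frechet_derivative_at[symmetric])
qed

section \<open>Coordinates of harmonic forms and the Hamiltonian vector field\<close>

lemma harmonic_one_form: "\<alpha> \<in> harmonic_forms A g \<Longrightarrow> one_form A \<alpha>"
  by (simp add: harmonic_forms_def)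

lemma basis_one_form: "k < m \<Longrightarrow> one_form A (h k)"
  using basis by (auto simp: harmonic_basis_def intro: harmonic_one_form)

lemma hcoords_unique:
  assumes "lin_comb m h l = lin_comb m h l'" "i < m"
  shows "l i = l' i"
proof -
  have "lin_comb m h (\<lambda>i. l i - l' i) = (\<lambda>c x v. 0)"
    using assms(1) by (auto simp: lin_comb_def fun_eq_iff sum_subtractf algebra_simps)
  moreover have "\<forall>l. lin_comb m h l = (\<lambda>c x v. 0) \<longrightarrow> (\<forall>i<m. l i = 0)"
    using basis by (simp add: harmonic_basis_def)
  ultimately have "\<forall>i<m. l i - l' i = 0"
    by blast
  with assms(2) show ?thesis
    by simp
qed

lemma hcoords_lin_comb:
  assumes "i < m"
  shows "hcoords m h (lin_comb m h l) i = l i"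
proof -
  \<comment> \<open>\<open>hcoords\<close> selects the coefficients that vanish from index
    \<open>m\<close> on, so a given \<open>l\<close> has to be cut off first.\<close>
  define l0 where "l0 i = (if i < m then l i else 0)" for i
  have l0: "lin_comb m h l = lin_comb m h l0"
    by (auto simp: lin_comb_def l0_def fun_eq_iff)
  have "hcoords m h (lin_comb m h l) = l0"
    unfolding hcoords_def
  proof (rule the_equality)
    show "lin_comb m h l = lin_comb m h l0 \<and> (\<forall>i\<ge>m. l0 i = 0)"
      using l0 by (simp add: l0_def)
    fix k assume k: "lin_comb m h l = lin_comb m h k \<and> (\<forall>i\<ge>m. k i = 0)"
    then have "k i = l0 i" if "i < m" for i
      using hcoords_unique[of k l0 i] l0 that by metis
    with k show "k = l0"
      by (auto simp: fun_eq_iff l0_def not_less)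
  qed
  with assms show ?thesis
    by (simp add: l0_def)
qed

lemma hnorm_lin_comb: "hnorm m h (lin_comb m h l) = (\<Sum>i<m. \<bar>l i\<bar>)"
  by (simp add: hnorm_def hcoords_lin_comb)

lemma lin_comb_hcoords:
  assumes "\<alpha> \<in> harmonic_forms A g"
  shows "\<alpha> = lin_comb m h (hcoords m h \<alpha>)"
proof -
  obtain l where l: "\<alpha> = lin_comb m h l"
    using basis assms unfolding harmonic_basis_def by (elim conjE) blast
  have "lin_comb m h l = lin_comb m h (hcoords m h (lin_comb m h l))"
    by (rule lin_comb_cong) (simp add: hcoords_lin_comb)
  with l show ?thesis
    by simp
qed

lemma hamiltonian_field_iff:
  assumes "linear_covector A G" "t \<in> {0..1}" "c \<in> A" "x \<in> cimg c"
  shows "(\<forall>v. \<omega> c x w v = covector G c t x v) \<longleftrightarrow> w = hamiltonian_field \<omega> G c t x"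
proof -
  have ex1: "\<exists>!w. \<forall>v. \<omega> c x w v = covector G c t x v"
    using assms by (intro nondegenerate_bilinear_represents omega_bilinear omega_nondegenerate)
      (auto simp: linear_covector_def)
  show ?thesis
    unfolding hamiltonian_field_def
  proof
    show "\<forall>v. \<omega> c x w v = covector G c t x v" if "w = (THE w. \<forall>v. \<omega> c x w v = covector G c t x v)"
      using theI'[OF ex1] unfolding that .
    show "w = (THE w. \<forall>v. \<omega> c x w v = covector G c t x v)" if "\<forall>v. \<omega> c x w v = covector G c t x v"
      using the1_equality[OF ex1 that] ..
  qed
qed

text \<open>Nondegeneracy leaves only one possible velocity in \<open>generates\<close>, so the
  implicit equation for it becomes an ordinary differential equation.\<close>

lemma generates_iff:
  assumes G: "linear_covector A G"
  shows "generates A \<omega> G \<phi> \<longleftrightarrow>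
    (\<forall>p. \<phi> 0 p = p \<and> integral_curve A (hamiltonian_field \<omega> G) 0 1 (\<lambda>t. \<phi> t p))"
proof -
  have "(\<exists>w. ((\<lambda>s. cmap c (\<phi> s p)) has_vector_derivative w) (at t within {0..1}) \<and>
          (\<forall>v. \<omega> c (cmap c (\<phi> t p)) w v =
               dfun (fst G t) c (cmap c (\<phi> t p)) v + snd G t c (cmap c (\<phi> t p)) v)) \<longleftrightarrow>
      ((\<lambda>s. cmap c (\<phi> s p)) has_vector_derivative hamiltonian_field \<omega> G c t (cmap c (\<phi> t p))) (at t within {0..1})"
    if "t \<in> {0..1}" "c \<in> A" "\<phi> t p \<in> cdom c" for p t c
    using hamiltonian_field_iff[OF G that(1,2), of "cmap c (\<phi> t p)"] chart_simps(2)[OF atlas that(2,3)]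
    unfolding covector_def by metis
  then show ?thesis
    unfolding generates_def integral_curve_def by blast
qed

text \<open>All terms of the defining equation are tensorial. Pulling it back from chart d to chart
  c along the inverse transition shows that the transported vector solves the equation in d, where
  the solution is unique.\<close>

lemma vector_field_hamiltonian_field:
  assumes G: "linear_covector A G"
    and diff: "\<And>t c x. t \<in> {0..1} \<Longrightarrow> c \<in> A \<Longrightarrow> x \<in> cimg c \<Longrightarrow> (fst G t \<circ> cinv c) differentiable (at x)"
    and form: "\<And>t. t \<in> {0..1} \<Longrightarrow> one_form A (snd G t)"
  shows "vector_field A (hamiltonian_field \<omega> G)"
  unfolding vector_field_def
proof (intro ballI)
  fix c d t p assume *: "c \<in> A" "d \<in> A" "t \<in> {0..1::real}" "p \<in> cdom c \<inter> cdom d"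
  let ?D = "transition_deriv c d (cmap c p)" and ?E = "transition_deriv d c (cmap d p)"
  let ?w = "hamiltonian_field \<omega> G c t (cmap c p)"
  have img: "cmap c p \<in> cimg c" "cmap d p \<in> cimg d"
    using * chart_simps(2)[OF atlas] by auto
  have "\<omega> d (cmap d p) (?D ?w) v = covector G d t (cmap d p) v" for v
  proof -
    have "\<omega> d (cmap d p) (?D ?w) v = \<omega> c (cmap c p) (?E (?D ?w)) (?E v)"
      using * by (intro omega_transition) auto
    also have "?E (?D ?w) = ?w"
      using * by (intro transition_deriv_inverse[OF atlas]) auto
    also have "\<omega> c (cmap c p) ?w (?E v) = covector G c t (cmap c p) (?E v)"
      using hamiltonian_field_iff[OF G *(3,1) img(1), of ?w] by simp
    also have "\<dots> = covector G d t (cmap d p) v"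
      using * img unfolding covector_def
      by (auto simp: dfun_transition[of d c p "fst G t" v] diff one_form_transition[OF form, of t d c p v])
    finally show ?thesis .
  qed
  then show "hamiltonian_field \<omega> G d t (cmap d p) = ?D ?w"
    using hamiltonian_field_iff[OF G *(3,2) img(2), of "?D ?w"] by simp
qed

end

section \<open>Uniform Lipschitz bounds for a generator and existence of its isotopy\<close>

context symplectic_manifold
begin

abbreviation gens where "gens \<equiv> generators A \<omega> g n m h"

lemma generator_smooth:
  assumes "G \<in> gens" "c \<in> A"
  shows "smooth_on ({0..1} \<times> cimg c) (\<lambda>(t, x). fst G t (cinv c x))"
  using assms by (auto simp: generators_def)

lemma generator_harmonic: "G \<in> gens \<Longrightarrow> t \<in> {0..1} \<Longrightarrow> snd G t \<in> harmonic_forms A g"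
  by (auto simp: generators_def)

lemma generator_differentiable:
  assumes "G \<in> gens" "t \<in> {0..1}" "c \<in> A" "x \<in> cimg c"
  shows "(fst G t \<circ> cinv c) differentiable (at x)"
  using smooth_on_partial_derivative(1)[OF generator_smooth[OF assms(1,3)] atlas_open(2)[OF atlas assms(3)] assms(2,4)]
  by (simp add: o_def)

lemma generator_one_form: "G \<in> gens \<Longrightarrow> t \<in> {0..1} \<Longrightarrow> one_form A (snd G t)"
  using generator_harmonic harmonic_one_form by blast

lemma one_form_linear: "one_form A \<alpha> \<Longrightarrow> c \<in> A \<Longrightarrow> x \<in> cimg c \<Longrightarrow> linear (\<alpha> c x)"
  by (auto simp: one_form_def)

lemma generator_linear_covector:
  assumes "G \<in> gens"
  shows "linear_covector A G"
  unfolding linear_covector_def covector_def dfun_def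
  by (intro ballI linear_compose_add linear_frechet_derivative one_form_linear
      generator_differentiable[OF assms] generator_one_form[OF assms])

lemma generator_vector_field:
  assumes "G \<in> gens"
  shows "vector_field A (hamiltonian_field \<omega> G)"
  using assms by (intro vector_field_hamiltonian_field generator_linear_covector
      generator_differentiable generator_one_form)

lemma hcoords_lipschitz:
  assumes "G \<in> gens" "k < m"
  shows "lipschitz {0..1} (\<lambda>t. hcoords m h (snd G t) k)"
  using assms by (intro smooth_on_imp_lipschitz_on[of "{0..1}"]) (auto simp: generators_def)

lemma one_form_lipschitz:
  assumes "one_form A \<alpha>" "c \<in> A" "cball x r \<subseteq> cimg c"
  shows "lipschitz (cball x r) (\<lambda>x. \<alpha> c x v)"
  using assms by (intro smooth_on_imp_lipschitz_on[of "cimg c"]) (auto simp: one_form_def)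

text \<open>The form part is known to be regular in t through its coordinates and in x through the
  basis forms, so joint regularity comes from the expansion in the basis.\<close>

lemma covector_lipschitz:
  assumes G: "G \<in> gens" and c: "c \<in> A" "cball x r \<subseteq> cimg c"
  shows "lipschitz ({0..1} \<times> cball x r) (\<lambda>z. covector G c (fst z) (snd z) v)"
proof -
  let ?K = "{0..1::real} \<times> cball x r"
  have K: "compact ?K" "convex ?K"
    by (auto intro: compact_Times convex_Times)
  have "smooth_on ({0..1} \<times> cimg c)
      (\<lambda>(t, x). frechet_derivative (\<lambda>x. (\<lambda>(t, x). fst G t (cinv c x)) (t, x)) (at x) v)"
    by (rule smooth_on_partial_derivative(2)[OF generator_smooth[OF G c(1)] atlas_open(2)[OF atlas c(1)]])
  from smooth_on_imp_lipschitz_on[OF this K] c(2)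
  have "lipschitz ?K (\<lambda>(t, x). frechet_derivative (\<lambda>x. (\<lambda>(t, x). fst G t (cinv c x)) (t, x)) (at x) v)"
    by auto
  then have 1: "lipschitz ?K (\<lambda>z. dfun (fst G (fst z)) c (snd z) v)"
    by (simp add: dfun_def o_def case_prod_unfold)
  have "lipschitz ?K (\<lambda>z. \<Sum>k<m. hcoords m h (snd G (fst z)) k * h k c (snd z) v)"
    by (intro lipschitz_sum lipschitz_mult K(1) lipschitz_fst[of _ "\<lambda>t. hcoords m h (snd G t) _"]
        lipschitz_snd[of _ "\<lambda>x. h _ c x v"] hcoords_lipschitz[OF G] one_form_lipschitz basis_one_form c) auto
  moreover have "(\<Sum>k<m. hcoords m h (snd G (fst z)) k * h k c (snd z) v) = snd G (fst z) c (snd z) v"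
    if "z \<in> ?K" for z
    using arg_cong[OF lin_comb_hcoords[OF generator_harmonic[OF G], of "fst z"], of "\<lambda>\<alpha>. \<alpha> c (snd z) v"] that
    by (auto simp: lin_comb_def)
  ultimately have 2: "lipschitz ?K (\<lambda>z. snd G (fst z) c (snd z) v)"
    by (auto cong: lipschitz_on_cong)
  from lipschitz_add[OF 1 2] show ?thesis
    by (simp add: covector_def)
qed

lemma hamiltonian_field_lipschitz:
  assumes G: "G \<in> gens" and c: "c \<in> A" "cball x r \<subseteq> cimg c"
  shows "lipschitz ({0..1} \<times> cball x r) (\<lambda>z. hamiltonian_field \<omega> G c (fst z) (snd z))"
proof -
  let ?K = "{0..1::real} \<times> cball x r"
  have K: "compact ?K"
    by (auto intro: compact_Times)
  \<comment> \<open>The indices are placed so that the i-th entry of \<open>M z *v w\<close> is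
    \<omega>(w, e_i). Testing the defining equation on the axes e_i gives the linear system with
    right-hand side \<open>b\<close>.\<close>
  define M :: "real \<times> (real^'n) \<Rightarrow> real^'n^'n"
    where "M z = (\<chi> i j. \<omega> c (snd z) (axis j 1) (axis i 1))" for z
  define b :: "real \<times> (real^'n) \<Rightarrow> real^'n"
    where "b z = (\<chi> i. covector G c (fst z) (snd z) (axis i 1))" for z
  have M: "(M z *v w) $ i = \<omega> c (snd z) w (axis i 1)" if "z \<in> ?K" for z w i
  proof -
    have "linear (\<lambda>w. \<omega> c (snd z) w (axis i 1))"
      using omega_bilinear[of c "snd z"] c that by (auto simp: bilinear_def)
    from linear_eq_sum_axis[OF this, of w] show ?thesis
      by (simp add: M_def matrix_vector_mult_def mult.commute)
  qed
  show ?thesis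
  proof (rule linear_system_solution_lipschitz[OF K, of M b])
    have "lipschitz (cball x r) (\<lambda>x. \<omega> c x v w)" for v w
      using symplectic c by (intro smooth_on_imp_lipschitz_on[of "cimg c"])
        (auto simp: symplectic_form_def smooth_tensor2_def)
    then have "lipschitz ?K (\<lambda>z. \<omega> c (snd z) v w)" for v w
      by (rule lipschitz_snd)
    then show "lipschitz ?K M"
      by (intro lipschitz_vec) (simp add: M_def)
    show "lipschitz ?K b"
      using covector_lipschitz[OF G c] by (intro lipschitz_vec) (simp add: b_def)
    show "M z *v hamiltonian_field \<omega> G c (fst z) (snd z) = b z" if z: "z \<in> ?K" for z
    proof -
      have "fst z \<in> {0..1}" "snd z \<in> cimg c"
        using z c(2) by auto
      with hamiltonian_field_iff[OF generator_linear_covector[OF G] _ c(1)] show ?thesis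
        by (auto simp: vec_eq_iff M[OF z] b_def)
    qed
    show "w = 0" if z: "z \<in> ?K" and w: "M z *v w = 0" for z w
    proof (rule ccontr)
      assume "w \<noteq> 0"
      have img: "snd z \<in> cimg c"
        using z c(2) by auto
      have "\<omega> c (snd z) w v = 0" for v
      proof -
        have "linear (\<omega> c (snd z) w)"
          using omega_bilinear[OF c(1) img] by (auto simp: bilinear_def)
        moreover have "\<omega> c (snd z) w (axis i 1) = 0" for i
          using M[OF z, of w i] w by simp
        ultimately show ?thesis
          using linear_eq_sum_axis[of "\<omega> c (snd z) w" v] by simp
      qed
      then show False
        using omega_nondegenerate[OF c(1) img \<open>w \<noteq> 0\<close>] by simp
    qed
  qed
qed

text \<open>The function h_k(X_t), where X is the Hamiltonian field: the contribution of one basis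
  form to the integrand of \<open>Delta\<close>. The chart is chosen as in \<open>Delta\<close>, but
  the value does not depend on it.\<close>

definition pairing :: "('m, 'n) generator \<Rightarrow> nat \<Rightarrow> real \<Rightarrow> 'm \<Rightarrow> real" where
  "pairing G k t p =
     (let c = chart_at A p in h k c (cmap c p) (hamiltonian_field \<omega> G c t (cmap c p)))"

lemma pairing_chart:
  assumes "G \<in> gens" "k < m" "t \<in> {0..1}" "c \<in> A" "p \<in> cdom c"
  shows "pairing G k t p = h k c (cmap c p) (hamiltonian_field \<omega> G c t (cmap c p))"
proof -
  let ?d = "chart_at A p"
  note d = chart_at[OF atlas, of p]
  have "hamiltonian_field \<omega> G c t (cmap c p) =
      transition_deriv ?d c (cmap ?d p) (hamiltonian_field \<omega> G ?d t (cmap ?d p))"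
    using generator_vector_field[OF assms(1)] assms d unfolding vector_field_def by blast
  then show ?thesis
    using one_form_transition[OF basis_one_form[OF assms(2)] d(1) assms(4) d(2) assms(5)]
    by (simp add: pairing_def Let_def)
qed

text \<open>Collects what has to be uniform over the manifold: the field, for existence, uniqueness
  and speed of integral curves, and the potential and the pairings, for the time regularity of the
  inverse generator.\<close>

definition controlled :: "('m, 'n) generator \<Rightarrow> ('m, 'n) chart \<Rightarrow> (real^'n) set \<Rightarrow> real \<Rightarrow> bool" where
  "controlled G c S L \<longleftrightarrow>
     lipschitz_bounded L ({0..1} \<times> S) (\<lambda>(t, x). hamiltonian_field \<omega> G c t x) \<and>
     lipschitz_bounded L ({0..1} \<times> S) (\<lambda>(t, x). fst G t (cinv c x)) \<and>
     (\<forall>k<m. lipschitz_bounded L ({0..1} \<times> S) (\<lambda>(t, x). pairing G k t (cinv c x)))"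

lemma controlled_mono: "controlled G c S L \<Longrightarrow> S' \<subseteq> S \<Longrightarrow> L \<le> L' \<Longrightarrow> controlled G c S' L'"
  unfolding controlled_def by (blast intro: lipschitz_bounded_mono Sigma_mono)

lemma controlled_exists:
  assumes G: "G \<in> gens" and c: "c \<in> A" "cball x r \<subseteq> cimg c"
  shows "\<exists>L. controlled G c (cball x r) L"
proof -
  let ?K = "{0..1::real} \<times> cball x r"
  have K: "compact ?K" "convex ?K"
    by (auto intro: compact_Times convex_Times)
  note X = hamiltonian_field_lipschitz[OF G c]
  obtain L1 where L1: "lipschitz_bounded L1 ?K (\<lambda>(t, x). hamiltonian_field \<omega> G c t x)"
    using lipschitz_imp_lipschitz_bounded[OF X K(1)] by (auto simp: case_prod_unfold)
  have "lipschitz ?K (\<lambda>(t, x). fst G t (cinv c x))"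
    using c by (intro smooth_on_imp_lipschitz_on[OF generator_smooth[OF G c(1)]] K) auto
  then obtain L2 where L2: "lipschitz_bounded L2 ?K (\<lambda>(t, x). fst G t (cinv c x))"
    using lipschitz_imp_lipschitz_bounded K(1) by blast
  have "\<exists>L. lipschitz_bounded L ?K (\<lambda>(t, x). pairing G k t (cinv c x))" if k: "k < m" for k
  proof (rule lipschitz_imp_lipschitz_bounded[OF _ K(1)])
    \<comment> \<open>Linearity of h_k in the vector writes the pairing as a finite sum of products
      of Lipschitz functions.\<close>
    have "lipschitz ?K (\<lambda>z. \<Sum>j\<in>UNIV. hamiltonian_field \<omega> G c (fst z) (snd z) $ j * h k c (snd z) (axis j 1))"
      by (intro lipschitz_sum lipschitz_mult K(1) lipschitz_nth X
          lipschitz_snd[of _ "\<lambda>x. h k c x (axis _ 1)"] one_form_lipschitz basis_one_form c k)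
    moreover have "(\<Sum>j\<in>UNIV. hamiltonian_field \<omega> G c (fst z) (snd z) $ j * h k c (snd z) (axis j 1)) =
        (case z of (t, x) \<Rightarrow> pairing G k t (cinv c x))" if z: "z \<in> ?K" for z
    proof -
      have z: "fst z \<in> {0..1}" "snd z \<in> cimg c"
        using z c(2) by auto
      then have "pairing G k (fst z) (cinv c (snd z)) = h k c (snd z) (hamiltonian_field \<omega> G c (fst z) (snd z))"
        using pairing_chart[OF G k z(1) c(1), of "cinv c (snd z)"] chart_simps(3,4)[OF atlas c(1)] by simp
      then show ?thesis
        using linear_eq_sum_axis[OF one_form_linear[OF basis_one_form[OF k] c(1) z(2)],
            of "hamiltonian_field \<omega> G c (fst z) (snd z)"]
        by (simp add: case_prod_unfold)
    qed
    ultimately show "lipschitz ?K (\<lambda>(t, x). pairing G k t (cinv c x))"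
      by (auto cong: lipschitz_on_cong)
  qed
  then obtain L3 where L3: "\<And>k. k < m \<Longrightarrow> lipschitz_bounded (L3 k) ?K (\<lambda>(t, x). pairing G k t (cinv c x))"
    by metis
  define L where "L = \<bar>L1\<bar> + \<bar>L2\<bar> + (\<Sum>k<m. \<bar>L3 k\<bar>)"
  have sum: "(\<Sum>k<m. \<bar>L3 k\<bar>) \<ge> 0"
    by (simp add: sum_nonneg)
  then have "L1 \<le> L" "L2 \<le> L"
    unfolding L_def by linarith+
  moreover have "L3 k \<le> L" if "k < m" for k
    using member_le_sum[of k "{..<m}" "\<lambda>k. \<bar>L3 k\<bar>"] that by (simp add: L_def)
  ultimately have "controlled G c (cball x r) L"
    unfolding controlled_def
    by (intro conjI allI impI lipschitz_bounded_mono[OF L1] lipschitz_bounded_mono[OF L2]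
        lipschitz_bounded_mono[OF L3]) auto
  then show ?thesis ..
qed

lemma uniformly_controlled:
  assumes "G \<in> gens"
  obtains r L where "r > 0" "L \<ge> 0"
    "\<And>p. \<exists>c\<in>A. p \<in> cdom c \<and> cball (cmap c p) r \<subseteq> cimg c \<and> controlled G c (cball (cmap c p) r) L"
  by (rule uniform_chart_radius[OF manifold, of "controlled G"])
    (use controlled_exists[OF assms] controlled_mono in blast)+

text \<open>\<open>isotopy\<close> is a choice, which is meaningful once some solution exists; one
  is assembled from an integral curve through each point.\<close>

lemma isotopy_generates:
  assumes G: "G \<in> gens"
  shows "generates A \<omega> G (isotopy A \<omega> G)"
proof -
  obtain r L where rL: "r > 0" "L \<ge> 0"
    "\<And>p. \<exists>c\<in>A. p \<in> cdom c \<and> cball (cmap c p) r \<subseteq> cimg c \<and> controlled G c (cball (cmap c p) r) L"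
    using uniformly_controlled[OF G] by blast
  have "\<exists>\<gamma>. \<gamma> 0 = p \<and> integral_curve A (hamiltonian_field \<omega> G) 0 1 \<gamma>" for p
  proof (rule integral_curve_exists[OF atlas generator_vector_field[OF G] rL(1,2)])
    fix p
    obtain c where "c \<in> A" "p \<in> cdom c" "cball (cmap c p) r \<subseteq> cimg c" "controlled G c (cball (cmap c p) r) L"
      using rL(3) by blast
    then show "\<exists>c\<in>A. p \<in> cdom c \<and> cball (cmap c p) r \<subseteq> cimg c \<and>
       L-lipschitz_on ({0..1} \<times> cball (cmap c p) r) (\<lambda>(t, x). hamiltonian_field \<omega> G c t x) \<and>
       (\<forall>t\<in>{0..1}. \<forall>x\<in>cball (cmap c p) r. norm (hamiltonian_field \<omega> G c t x) \<le> L)"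
      by (intro bexI[of _ c]) (auto simp: controlled_def lipschitz_bounded_def)
  qed
  then obtain \<Gamma> where "\<And>p. \<Gamma> p 0 = p \<and> integral_curve A (hamiltonian_field \<omega> G) 0 1 (\<Gamma> p)"
    by metis
  then have "generates A \<omega> G (\<lambda>t p. \<Gamma> p t)"
    using generates_iff[OF generator_linear_covector[OF G]] by simp
  then show ?thesis
    unfolding isotopy_def by (rule someI[of "generates A \<omega> G"])
qed

lemma isotopy_curve:
  assumes "G \<in> gens"
  shows "isotopy A \<omega> G 0 p = p"
    and "integral_curve A (hamiltonian_field \<omega> G) 0 1 (\<lambda>t. isotopy A \<omega> G t p)"
  using isotopy_generates[OF assms] generates_iff[OF generator_linear_covector[OF assms]] by auto

end

section \<open>Inverse isotopies and reparametrised isotopies\<close>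

context symplectic_manifold
begin

section \<open>Time regularity of generators and of their inverses\<close>

abbreviation coords :: "('m, 'n) generator \<Rightarrow> real \<Rightarrow> nat \<Rightarrow> real" where
  "coords G t \<equiv> hcoords m h (snd G t)"

text \<open>\<open>C\<close> is chosen before the curve: this gives the uniformity in the starting
  point that the oscillation over the manifold requires.\<close>

lemma controlled_along_curves:
  assumes G: "G \<in> gens"
  shows "\<exists>C. \<forall>\<gamma>. integral_curve A (hamiltonian_field \<omega> G) 0 1 \<gamma> \<longrightarrow>
    lipschitz_bounded C {0..1} (\<lambda>t. fst G t (\<gamma> t)) \<and>
    (\<forall>k<m. lipschitz_bounded C {0..1} (\<lambda>t. pairing G k t (\<gamma> t)))"
proof -
  obtain r L where r: "r > 0" and L: "L \<ge> 0" and
    ctrl: "\<And>p. \<exists>c\<in>A. p \<in> cdom c \<and> cball (cmap c p) r \<subseteq> cimg c \<and> controlled G c (cball (cmap c p) r) L"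
    using uniformly_controlled[OF G] by blast
  \<comment> \<open>The constant is the sum of the Lipschitz constant along the curve and the sup
    bound \<open>L\<close>, so it exceeds both.\<close>
  have key: "lipschitz_bounded (L * (L + 2) + L) {0..1} (\<lambda>t. F t (\<gamma> t))"
    if \<gamma>: "integral_curve A (hamiltonian_field \<omega> G) 0 1 \<gamma>"
      and F: "\<And>c S. controlled G c S L \<Longrightarrow> lipschitz_bounded L ({0..1} \<times> S) (\<lambda>(t, x). F t (cinv c x))"
    for F :: "real \<Rightarrow> 'm \<Rightarrow> real" and \<gamma>
  proof -
    have "(L * (L + 2))-lipschitz_on {0..1} (\<lambda>t. F t (\<gamma> t))"
    proof (rule lipschitz_along_integral_curve[OF atlas \<gamma> r])
      fix p
      obtain c where c: "c \<in> A" "p \<in> cdom c" "controlled G c (cball (cmap c p) r) L"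
        using ctrl by blast
      with F[OF c(3)] r show "\<exists>c\<in>A. p \<in> cdom c \<and> (\<forall>t\<in>{0..1}. norm (hamiltonian_field \<omega> G c t (cmap c p)) \<le> L) \<and>
          L-lipschitz_on ({0..1} \<times> cball (cmap c p) r) (\<lambda>(t, x). F t (cinv c x))"
        by (intro bexI[of _ c]) (auto simp: controlled_def lipschitz_bounded_def)
    qed
    moreover have "\<bar>F t p\<bar> \<le> L" if "t \<in> {0..1}" for t p
    proof -
      obtain c where c: "c \<in> A" "p \<in> cdom c" "controlled G c (cball (cmap c p) r) L"
        using ctrl by blast
      have "(t, cmap c p) \<in> {0..1} \<times> cball (cmap c p) r"
        using that r by simp
      with F[OF c(3)] have "norm (F t (cinv c (cmap c p))) \<le> L"
        unfolding lipschitz_bounded_def by fastforce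
      then show ?thesis
        using chart_simps(1)[OF atlas c(1,2)] by simp
    qed
    ultimately show ?thesis
      using L unfolding lipschitz_bounded_def
      by (auto intro: lipschitz_on_mono order_trans[of _ L])
  qed
  show ?thesis
  proof (intro exI allI impI conjI)
    fix \<gamma> assume \<gamma>: "integral_curve A (hamiltonian_field \<omega> G) 0 1 \<gamma>"
    show "lipschitz_bounded (L * (L + 2) + L) {0..1} (\<lambda>t. fst G t (\<gamma> t))"
      by (rule key[OF \<gamma>]) (simp add: controlled_def)
    fix k assume "k < m"
    then show "lipschitz_bounded (L * (L + 2) + L) {0..1} (\<lambda>t. pairing G k t (\<gamma> t))"
      by (intro key[OF \<gamma>]) (simp add: controlled_def)
  qed
qed

text \<open>Here p stands still, so one chart around p with fixed coordinates suffices for all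
  times.\<close>

lemma potential_lipschitz_bounded:
  assumes G: "G \<in> gens"
  shows "\<exists>C. \<forall>p. lipschitz_bounded C {0..1} (\<lambda>t. fst G t p)"
proof -
  obtain r L where r: "r > 0" and L: "L \<ge> 0" and
    ctrl: "\<And>p. \<exists>c\<in>A. p \<in> cdom c \<and> cball (cmap c p) r \<subseteq> cimg c \<and> controlled G c (cball (cmap c p) r) L"
    using uniformly_controlled[OF G] by blast
  have "lipschitz_bounded L {0..1} (\<lambda>t. fst G t p)" for p
  proof -
    obtain c where c: "c \<in> A" "p \<in> cdom c" "controlled G c (cball (cmap c p) r) L"
      using ctrl by blast
    let ?f = "\<lambda>(t, x). fst G t (cinv c x)"
    have f: "lipschitz_bounded L ({0..1} \<times> cball (cmap c p) r) ?f"
      using c(3) by (simp add: controlled_def)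
    have eq: "fst G t p = ?f (t, cmap c p)" for t
      using chart_simps(1)[OF atlas c(1,2)] by simp
    have mem: "(t, cmap c p) \<in> {0..1} \<times> cball (cmap c p) r" if "t \<in> {0..1}" for t
      using that r by simp
    show ?thesis
      unfolding lipschitz_bounded_def
    proof (intro conjI lipschitz_onI ballI)
      fix s t :: real assume st: "s \<in> {0..1}" "t \<in> {0..1}"
      have "dist (?f (s, cmap c p)) (?f (t, cmap c p)) \<le> L * dist (s, cmap c p) (t, cmap c p)"
        using f mem[OF st(1)] mem[OF st(2)] unfolding lipschitz_bounded_def by (intro lipschitz_onD) auto
      then show "dist (fst G s p) (fst G t p) \<le> L * dist s t"
        unfolding eq by (simp add: dist_Pair_Pair)
    next
      show "norm (fst G t p) \<le> L" if "t \<in> {0..1}" for t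
        using f mem[OF that] unfolding eq lipschitz_bounded_def by blast
    qed (rule lipschitz_bounded_nonneg[OF f])
  qed
  then show ?thesis
    by blast
qed

lemma coords_lipschitz_bounded:
  assumes G: "G \<in> gens"
  shows "\<exists>C. \<forall>k<m. lipschitz_bounded C {0..1} (\<lambda>t. coords G t k)"
proof -
  have "\<exists>C. lipschitz_bounded C {0..1} (\<lambda>t. coords G t k)" if "k < m" for k
    by (rule lipschitz_imp_lipschitz_bounded[OF hcoords_lipschitz[OF G that]]) simp
  then obtain C where C: "\<And>k. k < m \<Longrightarrow> lipschitz_bounded (C k) {0..1} (\<lambda>t. coords G t k)"
    by metis
  have "lipschitz_bounded (\<Sum>k<m. \<bar>C k\<bar>) {0..1} (\<lambda>t. coords G t k)" if "k < m" for k
  proof (rule lipschitz_bounded_mono[OF C[OF that] order_refl])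
    show "C k \<le> (\<Sum>k<m. \<bar>C k\<bar>)"
      using member_le_sum[of k "{..<m}" "\<lambda>k. \<bar>C k\<bar>"] that by simp
  qed
  then show ?thesis
    by blast
qed

lemma generator_regular_path:
  assumes G: "G \<in> gens"
  shows "\<exists>C. regular_path m C (fst G) (coords G)"
proof -
  obtain C C' where "\<forall>p. lipschitz_bounded C {0..1} (\<lambda>t. fst G t p)"
    "\<forall>k<m. lipschitz_bounded C' {0..1} (\<lambda>t. coords G t k)"
    using potential_lipschitz_bounded[OF G] coords_lipschitz_bounded[OF G] by blast
  then have "regular_path m (max C C') (fst G) (coords G)"
    unfolding regular_path_def by (auto intro: lipschitz_bounded_mono)
  then show ?thesis ..
qed

lemma velocity_integral_curve:
  assumes "integral_curve A X 0 1 (\<lambda>t. \<phi> t p)" "t \<in> {0..1}" "c \<in> A" "\<phi> t p \<in> cdom c"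
  shows "velocity c \<phi> t p = X c t (cmap c (\<phi> t p))"
  unfolding velocity_def
  using vector_derivative_within_cbox[of 0 1 t] integral_curveD[OF assms] assms(2) by simp

lemma generator_form_eq:
  assumes "G \<in> gens" "t \<in> {0..1}"
  shows "snd G t c x v = (\<Sum>k<m. coords G t k * h k c x v)"
  using arg_cong[OF lin_comb_hcoords[OF generator_harmonic[OF assms]], of "\<lambda>\<alpha>. \<alpha> c x v"]
  by (simp add: lin_comb_def)

text \<open>In \<open>Delta\<close> the form is frozen at time t while the velocity runs through the
  times s. The basis expansion puts t into the coordinates and s into the pairings.\<close>

lemma Delta_isotopy:
  assumes G: "G \<in> gens" and t: "t \<in> {0..1}"
  shows "Delta A (snd G) (isotopy A \<omega> G) t p =
    integral {0..t} (\<lambda>s. \<Sum>k<m. coords G t k * pairing G k s (isotopy A \<omega> G s p))"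
  unfolding Delta_def
proof (rule integral_cong)
  fix s assume s: "s \<in> {0..t}"
  let ?q = "isotopy A \<omega> G s p"
  note c = chart_at[OF atlas, of ?q]
  have "velocity (chart_at A ?q) (isotopy A \<omega> G) s p =
      hamiltonian_field \<omega> G (chart_at A ?q) s (cmap (chart_at A ?q) ?q)"
    using s t by (intro velocity_integral_curve[where \<phi> = "isotopy A \<omega> G"] isotopy_curve(2)[OF G] c) auto
  then show "(let c = chart_at A ?q in snd G t c (cmap c ?q) (velocity c (isotopy A \<omega> G) s p)) =
      (\<Sum>k<m. coords G t k * pairing G k s ?q)"
    by (simp add: Let_def generator_form_eq[OF G t] pairing_def)
qed

lemma pairing_isotopy_continuous:
  assumes G: "G \<in> gens" and k: "k < m"
  shows "continuous_on {0..1} (\<lambda>s. pairing G k s (isotopy A \<omega> G s p))"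
  using controlled_along_curves[OF G] isotopy_curve(2)[OF G, of p] k
  unfolding lipschitz_bounded_def by (blast intro: lipschitz_on_continuous_on)

text \<open>The function part of the generator of the inverse isotopy, without its normalisation.\<close>

definition inverse_potential :: "('m, 'n) generator \<Rightarrow> real \<Rightarrow> 'm \<Rightarrow> real" where
  "inverse_potential G t p = - fst G t (isotopy A \<omega> G t p) - Delta A (snd G) (isotopy A \<omega> G) t p"

lemma inverse_regular_path:
  assumes G: "G \<in> gens"
  shows "\<exists>C. regular_path m C (inverse_potential G) (\<lambda>t k. - coords G t k)"
proof -
  let ?\<phi> = "isotopy A \<omega> G"
  obtain C where C: "\<And>p. lipschitz_bounded C {0..1} (\<lambda>t. fst G t (?\<phi> t p))"
    "\<And>p k. k < m \<Longrightarrow> lipschitz_bounded C {0..1} (\<lambda>t. pairing G k t (?\<phi> t p))"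
    using controlled_along_curves[OF G] isotopy_curve(2)[OF G] by meson
  obtain B where B: "\<And>k. k < m \<Longrightarrow> lipschitz_bounded B {0..1} (\<lambda>t. coords G t k)"
    using coords_lipschitz_bounded[OF G] by blast
  \<comment> \<open>Each summand is a coordinate with constant \<open>B\<close> times an indefinite
    integral with constant \<open>C\<close>; a product has constant
    \<open>2 * B * C\<close>.\<close>
  let ?C = "\<Sum>k<m. 2 * B * C"
  have Delta: "lipschitz_bounded ?C {0..1} (\<lambda>t. Delta A (snd G) ?\<phi> t p)" for p
  proof -
    let ?f = "\<lambda>k s. pairing G k s (?\<phi> s p)"
    have "lipschitz_bounded C {0..1} (\<lambda>t. integral {0..t} (?f k))" if "k < m" for k
      using C(2)[OF that, of p] by (intro lipschitz_bounded_indefinite_integral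
          pairing_isotopy_continuous[OF G that]) (auto simp: lipschitz_bounded_def)
    then have "lipschitz_bounded ?C {0..1} (\<lambda>t. \<Sum>k<m. coords G t k * integral {0..t} (?f k))"
      by (intro lipschitz_bounded_sum lipschitz_bounded_mult B) auto
    moreover have eq: "Delta A (snd G) ?\<phi> t p = (\<Sum>k<m. coords G t k * integral {0..t} (?f k))"
      if t: "t \<in> {0..1}" for t
    proof -
      have "?f k integrable_on {0..t}" if "k < m" for k
        by (intro integrable_continuous_real continuous_on_subset[OF pairing_isotopy_continuous[OF G that]])
          (use t in auto)
      then show ?thesis
        unfolding Delta_isotopy[OF G t] by (subst integral_sum) (auto intro: integrable_on_mult_right)
    qed
    ultimately show ?thesis
      by (subst lipschitz_bounded_cong[OF eq])
  qed
  \<comment> \<open>The absolute value is needed because the sign of \<open>B\<close> is unknown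
    when \<open>m\<close> is 0.\<close>
  define K where "K = C + ?C + \<bar>B\<bar>"
  have pos: "C \<ge> 0" "?C \<ge> 0"
    using C(1) Delta lipschitz_bounded_nonneg by blast+
  have "lipschitz_bounded K {0..1} (\<lambda>t. inverse_potential G t p)" for p
  proof (rule lipschitz_bounded_mono)
    show "lipschitz_bounded (C + ?C) {0..1} (\<lambda>t. inverse_potential G t p)"
      using lipschitz_bounded_add[OF lipschitz_bounded_uminus[OF C(1)] lipschitz_bounded_uminus[OF Delta]]
      by (simp add: inverse_potential_def)
  qed (auto simp: K_def)
  moreover have "lipschitz_bounded K {0..1} (\<lambda>t. - coords G t k)" if "k < m" for k
    by (rule lipschitz_bounded_mono[OF lipschitz_bounded_uminus[OF B[OF that]] order_refl])
      (unfold K_def, use pos in linarith)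
  ultimately show ?thesis
    unfolding regular_path_def by blast
qed

text \<open>Up to a function of time, which the oscillation does not see.\<close>

definition represents :: "('m, 'n) generator \<Rightarrow> (real \<Rightarrow> 'm \<Rightarrow> real) \<Rightarrow> (real \<Rightarrow> nat \<Rightarrow> real) \<Rightarrow> bool" where
  "represents P V l \<longleftrightarrow> (\<forall>t\<in>{0..1}. (\<exists>\<kappa>. \<forall>p. fst P t p = V t p + \<kappa>) \<and>
     (\<exists>B. \<forall>p. \<bar>V t p\<bar> \<le> B) \<and> snd P t = lin_comb m h (l t))"

lemma D0_represents:
  assumes P: "represents P V l" and Q: "represents Q V' l'"
  shows "D0 m h P Q = integral {0..1} (\<lambda>t. osc_norm m (\<lambda>p. V t p - V' t p) (\<lambda>k. l t k - l' t k))"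
  unfolding D0_def
proof (rule integral_cong)
  fix t :: real assume t: "t \<in> {0..1}"
  obtain \<kappa> B where 1: "\<And>p. fst P t p = V t p + \<kappa>" "\<And>p. \<bar>V t p\<bar> \<le> B" "snd P t = lin_comb m h (l t)"
    using P t unfolding represents_def by blast
  obtain \<kappa>' B' where 2: "\<And>p. fst Q t p = V' t p + \<kappa>'" "\<And>p. \<bar>V' t p\<bar> \<le> B'" "snd Q t = lin_comb m h (l' t)"
    using Q t unfolding represents_def by blast
  have "\<bar>V t p - V' t p\<bar> \<le> B + B'" for p
    using 1(2)[of p] 2(2)[of p] by linarith
  then have "osc (\<lambda>p. (V t p - V' t p) + (\<kappa> - \<kappa>')) = osc (\<lambda>p. V t p - V' t p)"
    by (rule osc_add_const)
  moreover have "(\<lambda>p. fst P t p - fst Q t p) = (\<lambda>p. (V t p - V' t p) + (\<kappa> - \<kappa>'))"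
    by (simp add: 1 2 algebra_simps)
  moreover have "(\<lambda>c x v. snd P t c x v - snd Q t c x v) = lin_comb m h (\<lambda>k. l t k - l' t k)"
    by (simp add: 1 2 lin_comb_def fun_eq_iff sum_subtractf left_diff_distrib)
  ultimately show "osc (\<lambda>p. fst P t p - fst Q t p) + hnorm m h (\<lambda>c x v. snd P t c x v - snd Q t c x v) =
      osc_norm m (\<lambda>p. V t p - V' t p) (\<lambda>k. l t k - l' t k)"
    by (simp add: osc_norm_def hnorm_lin_comb)
qed

lemma represents_generator:
  assumes G: "G \<in> gens"
  shows "represents G (fst G) (coords G)"
proof -
  obtain C where C: "regular_path m C (fst G) (coords G)"
    using generator_regular_path[OF G] by blast
  show ?thesis
    unfolding represents_def
  proof (intro ballI conjI)
    fix t :: real assume t: "t \<in> {0..1}"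
    show "\<exists>\<kappa>. \<forall>p. fst G t p = fst G t p + \<kappa>"
      by (rule exI[of _ 0]) simp
    show "\<exists>B. \<forall>p. \<bar>fst G t p\<bar> \<le> B"
      using regular_pathD(1)[OF C t t] by blast
    show "snd G t = lin_comb m h (coords G t)"
      by (rule lin_comb_hcoords[OF generator_harmonic[OF G t]])
  qed
qed

lemma represents_inverse:
  assumes G: "G \<in> gens"
  shows "represents (inverse_generator A \<omega> n G) (inverse_potential G) (\<lambda>t k. - coords G t k)"
  unfolding represents_def
proof (intro ballI conjI)
  fix t :: real assume t: "t \<in> {0..1}"
  obtain C where C: "regular_path m C (inverse_potential G) (\<lambda>t k. - coords G t k)"
    using inverse_regular_path[OF G] by blast
  show "\<exists>B. \<forall>p. \<bar>inverse_potential G t p\<bar> \<le> B"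
    using regular_pathD(1)[OF C t t] by blast
  \<comment> \<open>The constant is the mean value subtracted in
    \<open>Delta_normalized\<close>.\<close>
  show "\<exists>\<kappa>. \<forall>p. fst (inverse_generator A \<omega> n G) t p = inverse_potential G t p + \<kappa>"
    by (auto simp: inverse_generator_def inverse_potential_def Delta_normalized_def)
  show "snd (inverse_generator A \<omega> n G) t = lin_comb m h (\<lambda>k. - coords G t k)"
    by (simp add: inverse_generator_def generator_form_eq[OF G t] lin_comb_def fun_eq_iff sum_negf)
qed

lemma represents_reparam:
  assumes P: "represents P V l" and \<xi>: "monotone_reparam \<xi>"
  shows "represents (reparam \<xi> P) (\<lambda>t p. deriv01 \<xi> t * V (\<xi> t) p) (\<lambda>t k. deriv01 \<xi> t * l (\<xi> t) k)"
  unfolding represents_def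
proof (intro ballI)
  fix t :: real assume t: "t \<in> {0..1}"
  obtain \<kappa> B where 1: "\<And>p. fst P (\<xi> t) p = V (\<xi> t) p + \<kappa>" "\<And>p. \<bar>V (\<xi> t) p\<bar> \<le> B" "snd P (\<xi> t) = lin_comb m h (l (\<xi> t))"
    using P monotone_reparam_deriv(4)[OF \<xi> t] unfolding represents_def by blast
  have "\<bar>deriv01 \<xi> t * V (\<xi> t) p\<bar> \<le> \<bar>deriv01 \<xi> t\<bar> * B" for p
    using 1(2)[of p] by (simp add: abs_mult mult_left_mono)
  moreover have "fst (reparam \<xi> P) t p = deriv01 \<xi> t * V (\<xi> t) p + deriv01 \<xi> t * \<kappa>" for p
    by (simp add: reparam_def 1 distrib_left)
  moreover have "snd (reparam \<xi> P) t = lin_comb m h (\<lambda>k. deriv01 \<xi> t * l (\<xi> t) k)"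
    by (simp add: reparam_def 1 lin_comb_def fun_eq_iff sum_distrib_left mult.assoc)
  ultimately show "(\<exists>\<kappa>. \<forall>p. fst (reparam \<xi> P) t p = deriv01 \<xi> t * V (\<xi> t) p + \<kappa>) \<and>
      (\<exists>B. \<forall>p. \<bar>deriv01 \<xi> t * V (\<xi> t) p\<bar> \<le> B) \<and>
      snd (reparam \<xi> P) t = lin_comb m h (\<lambda>k. deriv01 \<xi> t * l (\<xi> t) k)"
    by blast
qed

section \<open>Reparametrised generators and their isotopies\<close>

lemma reparam_covector:
  assumes G: "G \<in> gens" and \<xi>: "monotone_reparam \<xi>" and tcx: "t \<in> {0..1}" "c \<in> A" "x \<in> cimg c"
  shows "covector (reparam \<xi> G) c t x v = deriv01 \<xi> t * covector G c (\<xi> t) x v"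
proof -
  let ?f = "fst G (\<xi> t) \<circ> cinv c"
  have "(?f has_derivative frechet_derivative ?f (at x)) (at x)"
    using generator_differentiable[OF G monotone_reparam_deriv(4)[OF \<xi> tcx(1)] tcx(2,3)]
    by (simp add: frechet_derivative_works)
  then have "((\<lambda>x. deriv01 \<xi> t * ?f x) has_derivative (\<lambda>v. deriv01 \<xi> t * frechet_derivative ?f (at x) v)) (at x)"
    by (rule has_derivative_mult_right)
  from frechet_derivative_at[OF this]
  have "dfun (fst (reparam \<xi> G) t) c x v = deriv01 \<xi> t * dfun (fst G (\<xi> t)) c x v"
    by (simp add: dfun_def reparam_def o_def fun_eq_iff)
  then show ?thesis
    by (simp add: covector_def reparam_def distrib_left)
qed

lemma reparam_linear_covector:
  assumes G: "G \<in> gens" and \<xi>: "monotone_reparam \<xi>"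
  shows "linear_covector A (reparam \<xi> G)"
  unfolding linear_covector_def
proof (intro ballI)
  fix t c x assume tcx: "t \<in> {0..1::real}" "c \<in> A" "x \<in> cimg c"
  then have "linear (covector G c (\<xi> t) x)"
    using generator_linear_covector[OF G] monotone_reparam_deriv(4)[OF \<xi> tcx(1)] by (auto simp: linear_covector_def)
  from linear_compose_scale_right[OF this, of "deriv01 \<xi> t"]
  show "linear (covector (reparam \<xi> G) c t x)"
    by (simp add: reparam_covector[OF G \<xi> tcx, abs_def])
qed

lemma reparam_hamiltonian_field:
  assumes G: "G \<in> gens" and \<xi>: "monotone_reparam \<xi>" and tcx: "t \<in> {0..1}" "c \<in> A" "x \<in> cimg c"
  shows "hamiltonian_field \<omega> (reparam \<xi> G) c t x = deriv01 \<xi> t *\<^sub>R hamiltonian_field \<omega> G c (\<xi> t) x"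
proof -
  have "\<omega> c x (hamiltonian_field \<omega> G c (\<xi> t) x) v = covector G c (\<xi> t) x v" for v
    using hamiltonian_field_iff[OF generator_linear_covector[OF G] monotone_reparam_deriv(4)[OF \<xi> tcx(1)] tcx(2,3)]
    by blast
  then have "\<omega> c x (deriv01 \<xi> t *\<^sub>R hamiltonian_field \<omega> G c (\<xi> t) x) v = covector (reparam \<xi> G) c t x v" for v
    by (simp add: reparam_covector[OF G \<xi> tcx] bilinear_lmul[OF omega_bilinear[OF tcx(2,3)]])
  then show ?thesis
    using hamiltonian_field_iff[OF reparam_linear_covector[OF G \<xi>] tcx,
        of "deriv01 \<xi> t *\<^sub>R hamiltonian_field \<omega> G c (\<xi> t) x"] by simp
qed

lemma reparam_integral_curve:
  assumes G: "G \<in> gens" and \<xi>: "monotone_reparam \<xi>"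
    and \<gamma>: "integral_curve A (hamiltonian_field \<omega> G) 0 1 \<gamma>"
  shows "integral_curve A (hamiltonian_field \<omega> (reparam \<xi> G)) 0 1 (\<lambda>t. \<gamma> (\<xi> t))"
  unfolding integral_curve_def
proof (intro conjI ballI impI)
  note D = monotone_reparam_deriv[OF \<xi>]
  show "continuous_on {0..1} (\<lambda>t. \<gamma> (\<xi> t))"
    using \<gamma> D by (auto simp: integral_curve_def intro: continuous_on_compose2)
  fix t c assume t: "t \<in> {0..1::real}" and c: "c \<in> A" "\<gamma> (\<xi> t) \<in> cdom c"
  \<comment> \<open>The chain rule asks for the outer derivative within the image of \<xi>, which
    may be smaller than [0,1] or even a single point.\<close>
  have "((\<lambda>s. cmap c (\<gamma> s)) has_vector_derivative hamiltonian_field \<omega> G c (\<xi> t) (cmap c (\<gamma> (\<xi> t)))) (at (\<xi> t) within \<xi> ` {0..1})"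
    by (rule has_vector_derivative_within_subset[OF integral_curveD[OF \<gamma> D(4)[OF t] c]]) (use D(4) in auto)
  from vector_diff_chain_within[OF _ this, of "deriv01 \<xi> t"] D(1)[OF t]
  show "((\<lambda>s. cmap c (\<gamma> (\<xi> s))) has_vector_derivative
      hamiltonian_field \<omega> (reparam \<xi> G) c t (cmap c (\<gamma> (\<xi> t)))) (at t within {0..1})"
    by (simp add: reparam_hamiltonian_field[OF G \<xi> t c(1) chart_simps(2)[OF atlas c]] o_def
        has_real_derivative_iff_has_vector_derivative)
qed

text \<open>The family \<phi> at times \<xi>(t) is used twice: its existence shows that the chosen
  isotopy of the reparametrised generator solves its equation, and uniqueness then compares the two.
  A bound \<open>B\<close> on |\<xi>'| supplies the Lipschitz constant \<open>B * L\<close> in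
  x.\<close>

lemma reparam_isotopy:
  assumes G: "G \<in> gens" and \<xi>: "monotone_reparam \<xi>" "\<xi> 0 = 0"
  shows "integral_curve A (hamiltonian_field \<omega> (reparam \<xi> G)) 0 1 (\<lambda>t. isotopy A \<omega> (reparam \<xi> G) t p)"
    and "t \<in> {0..1} \<Longrightarrow> isotopy A \<omega> (reparam \<xi> G) t p = isotopy A \<omega> G (\<xi> t) p"
proof -
  let ?R = "reparam \<xi> G" and ?\<phi> = "isotopy A \<omega> G"
  note D = monotone_reparam_deriv[OF \<xi>(1)]
  have curve: "integral_curve A (hamiltonian_field \<omega> ?R) 0 1 (\<lambda>t. ?\<phi> (\<xi> t) p)" for p
    by (rule reparam_integral_curve[OF G \<xi>(1) isotopy_curve(2)[OF G]])
  then have "generates A \<omega> ?R (\<lambda>t. ?\<phi> (\<xi> t))"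
    using isotopy_curve(1)[OF G] \<xi>(2) by (simp add: generates_iff[OF reparam_linear_covector[OF G \<xi>(1)]])
  then have "generates A \<omega> ?R (isotopy A \<omega> ?R)"
    unfolding isotopy_def[of A \<omega> ?R] by (rule someI[of "generates A \<omega> ?R"])
  then have R: "isotopy A \<omega> ?R 0 p = p" "integral_curve A (hamiltonian_field \<omega> ?R) 0 1 (\<lambda>t. isotopy A \<omega> ?R t p)" for p
    by (simp_all add: generates_iff[OF reparam_linear_covector[OF G \<xi>(1)]])
  then show "integral_curve A (hamiltonian_field \<omega> ?R) 0 1 (\<lambda>t. isotopy A \<omega> ?R t p)"
    by blast
  obtain r L where r: "r > 0" and L: "L \<ge> 0" and
    ctrl: "\<And>p. \<exists>c\<in>A. p \<in> cdom c \<and> cball (cmap c p) r \<subseteq> cimg c \<and> controlled G c (cball (cmap c p) r) L"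
    using uniformly_controlled[OF G] by blast
  have "bounded (deriv01 \<xi> ` {0..1})"
    using D(2) by (intro compact_imp_bounded compact_continuous_image) auto
  then obtain B where "\<forall>t\<in>{0..1}. \<bar>deriv01 \<xi> t\<bar> \<le> B"
    by (auto simp: bounded_iff)
  then have B: "\<And>t. t \<in> {0..1} \<Longrightarrow> \<bar>deriv01 \<xi> t\<bar> \<le> B" "B \<ge> 0"
    using order_trans[OF abs_ge_zero, of "deriv01 \<xi> 0" B] by simp_all
  show "isotopy A \<omega> ?R t p = ?\<phi> (\<xi> t) p" if t: "t \<in> {0..1}"
  proof (rule integral_curve_unique[OF atlas r _ _ R(2) curve _ t])
    show "B * L \<ge> 0"
      using B L by simp
    show "isotopy A \<omega> ?R 0 p = ?\<phi> (\<xi> 0) p"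
      using R(1) isotopy_curve(1)[OF G] \<xi>(2) by simp
    fix p
    obtain c where c: "c \<in> A" "p \<in> cdom c" "cball (cmap c p) r \<subseteq> cimg c" "controlled G c (cball (cmap c p) r) L"
      using ctrl by blast
    have "norm (hamiltonian_field \<omega> ?R c t x - hamiltonian_field \<omega> ?R c t y) \<le> B * L * norm (x - y)"
      if t: "t \<in> {0..1}" and xy: "x \<in> cball (cmap c p) r" "y \<in> cball (cmap c p) r" for t x y
    proof -
      let ?X = "\<lambda>x. hamiltonian_field \<omega> G c (\<xi> t) x"
      have "dist (?X x) (?X y) \<le> L * dist (\<xi> t, x) (\<xi> t, y)"
        using lipschitz_onD[of L _ "\<lambda>(t, x). hamiltonian_field \<omega> G c t x" "(\<xi> t, x)" "(\<xi> t, y)"]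
          c(4) xy D(4)[OF t] unfolding controlled_def lipschitz_bounded_def by force
      then have X: "norm (?X x - ?X y) \<le> L * norm (x - y)"
        by (simp add: dist_Pair_Pair dist_norm)
      have img: "x \<in> cimg c" "y \<in> cimg c"
        using xy c(3) by auto
      have "norm (hamiltonian_field \<omega> ?R c t x - hamiltonian_field \<omega> ?R c t y) = \<bar>deriv01 \<xi> t\<bar> * norm (?X x - ?X y)"
        unfolding reparam_hamiltonian_field[OF G \<xi>(1) t c(1) img(1)] reparam_hamiltonian_field[OF G \<xi>(1) t c(1) img(2)]
        by (simp flip: scaleR_diff_right)
      also have "\<dots> \<le> B * (L * norm (x - y))"
        using B(1)[OF t] B(2) X by (intro mult_mono) auto
      finally show ?thesis
        by (simp add: mult.assoc)
    qed
    with c(1,2) show "\<exists>c\<in>A. p \<in> cdom c \<and> (\<forall>t\<in>{0..1}. \<forall>x\<in>cball (cmap c p) r. \<forall>y\<in>cball (cmap c p) r.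
        norm (hamiltonian_field \<omega> ?R c t x - hamiltonian_field \<omega> ?R c t y) \<le> B * L * norm (x - y))"
      by blast
  qed
qed

text \<open>Two factors arise: \<xi>'(t) from the form, constant under the integral, and \<xi>'(s)
  from the velocity, absorbed by substitution. Because \<xi>(0) = 0, the new integral starts at 0
  again.\<close>

lemma Delta_reparam:
  assumes G: "G \<in> gens" and \<xi>: "monotone_reparam \<xi>" "\<xi> 0 = 0" and t: "t \<in> {0..1}"
  shows "Delta A (snd (reparam \<xi> G)) (isotopy A \<omega> (reparam \<xi> G)) t p =
    deriv01 \<xi> t * Delta A (snd G) (isotopy A \<omega> G) (\<xi> t) p"
proof -
  let ?R = "reparam \<xi> G" and ?\<phi> = "isotopy A \<omega> G"
  note D = monotone_reparam_deriv[OF \<xi>(1)]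
  let ?f = "\<lambda>s. \<Sum>k<m. coords G (\<xi> t) k * pairing G k s (?\<phi> s p)"
  have "Delta A (snd ?R) (isotopy A \<omega> ?R) t p = integral {0..t} (\<lambda>s. deriv01 \<xi> t * (deriv01 \<xi> s * ?f (\<xi> s)))"
    unfolding Delta_def
  proof (rule integral_cong)
    fix s assume "s \<in> {0..t}"
    then have s: "s \<in> {0..1}"
      using t by auto
    let ?q = "?\<phi> (\<xi> s) p"
    let ?c = "chart_at A ?q"
    note c = chart_at[OF atlas, of ?q]
    note q = reparam_isotopy(2)[OF G \<xi> s, of p]
    have "velocity ?c (isotopy A \<omega> ?R) s p = hamiltonian_field \<omega> ?R ?c s (cmap ?c ?q)"
      using velocity_integral_curve[where \<phi> = "isotopy A \<omega> ?R" and p = p, OF reparam_isotopy(1)[OF G \<xi>] s c(1)] c(2) q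
      by simp
    also have "\<dots> = deriv01 \<xi> s *\<^sub>R hamiltonian_field \<omega> G ?c (\<xi> s) (cmap ?c ?q)"
      by (rule reparam_hamiltonian_field[OF G \<xi>(1) s c(1) chart_simps(2)[OF atlas c]])
    finally have v: "velocity ?c (isotopy A \<omega> ?R) s p = deriv01 \<xi> s *\<^sub>R hamiltonian_field \<omega> G ?c (\<xi> s) (cmap ?c ?q)" .
    have "h k ?c (cmap ?c ?q) (velocity ?c (isotopy A \<omega> ?R) s p) = deriv01 \<xi> s * pairing G k (\<xi> s) ?q" if "k < m" for k
      using linear_scale[OF one_form_linear[OF basis_one_form[OF that] c(1) chart_simps(2)[OF atlas c]]]
      by (simp add: v pairing_def Let_def)
    then have "snd ?R t ?c (cmap ?c ?q) (velocity ?c (isotopy A \<omega> ?R) s p) =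
        deriv01 \<xi> t * (\<Sum>k<m. coords G (\<xi> t) k * (deriv01 \<xi> s * pairing G k (\<xi> s) ?q))"
      by (simp add: reparam_def generator_form_eq[OF G D(4)[OF t]])
    then show "(let c = chart_at A (isotopy A \<omega> ?R s p) in snd ?R t c (cmap c (isotopy A \<omega> ?R s p))
        (velocity c (isotopy A \<omega> ?R) s p)) = deriv01 \<xi> t * (deriv01 \<xi> s * ?f (\<xi> s))"
      by (simp add: q Let_def sum_distrib_left mult_ac)
  qed
  also have "\<dots> = deriv01 \<xi> t * integral {0..t} (\<lambda>s. deriv01 \<xi> s * ?f (\<xi> s))"
    by simp
  also have "integral {0..t} (\<lambda>s. deriv01 \<xi> s * ?f (\<xi> s)) = integral {0..\<xi> t} ?f"
  proof -
    have "continuous_on {0..1} ?f"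
      by (intro continuous_intros pairing_isotopy_continuous[OF G]) auto
    \<comment> \<open>The endpoints are in the right order, 0 = \<xi>(0) \<le> \<xi>(t), even if
      \<xi> is given as decreasing; it is then constant.\<close>
    then have "((\<lambda>s. deriv01 \<xi> s *\<^sub>R ?f (\<xi> s)) has_integral integral {\<xi> 0..\<xi> t} ?f) {0..t}"
      using t D(4)[OF t] \<xi>(2)
      by (intro has_integral_substitution[of 0 t \<xi> 0 1])
        (auto intro!: D(4) DERIV_subset[OF D(1)] simp del: atLeastAtMost_iff, auto)
    then show ?thesis
      using \<xi>(2) by (auto dest: integral_unique)
  qed
  finally show ?thesis
    unfolding Delta_isotopy[OF G D(4)[OF t]] .
qed

text \<open>The same pair represents
  \<open>reparam \<xi> (inverse_generator A \<omega> n G)\<close>. So for \<xi>(0) = 0 the two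
  readings of the reparametrised inverse differ only by a function of time, and \<open>D0\<close>
  cannot tell them apart.\<close>

lemma represents_inverse_reparam:
  assumes G: "G \<in> gens" and \<xi>: "monotone_reparam \<xi>" "\<xi> 0 = 0"
  shows "represents (inverse_generator A \<omega> n (reparam \<xi> G))
    (\<lambda>t p. deriv01 \<xi> t * inverse_potential G (\<xi> t) p) (\<lambda>t k. deriv01 \<xi> t * - coords G (\<xi> t) k)"
  unfolding represents_def
proof (intro ballI)
  fix t :: real assume t: "t \<in> {0..1}"
  let ?R = "reparam \<xi> G"
  have "fst (inverse_generator A \<omega> n ?R) t p = deriv01 \<xi> t * inverse_potential G (\<xi> t) p +
      mean_value A \<omega> n (Delta A (snd ?R) (isotopy A \<omega> ?R) t)" for p
    by (simp add: inverse_generator_def inverse_potential_def Delta_normalized_def Delta_reparam[OF G \<xi> t]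
        reparam_isotopy(2)[OF G \<xi> t]) (simp add: reparam_def right_diff_distrib)
  moreover have "snd (inverse_generator A \<omega> n ?R) t = snd (reparam \<xi> (inverse_generator A \<omega> n G)) t"
    by (simp add: inverse_generator_def reparam_def)
  ultimately show "(\<exists>\<kappa>. \<forall>p. fst (inverse_generator A \<omega> n ?R) t p = deriv01 \<xi> t * inverse_potential G (\<xi> t) p + \<kappa>) \<and>
      (\<exists>B. \<forall>p. \<bar>deriv01 \<xi> t * inverse_potential G (\<xi> t) p\<bar> \<le> B) \<and>
      snd (inverse_generator A \<omega> n ?R) t = lin_comb m h (\<lambda>k. deriv01 \<xi> t * - coords G (\<xi> t) k)"
    using represents_reparam[OF represents_inverse[OF G] \<xi>(1)] t unfolding represents_def by auto
qed

text \<open>A Cauchy sequence in \<open>D1\<close> is Cauchy in \<open>D0\<close> both for the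
  generators and for their inverses, so the equicontinuity estimate applies to each of the two
  families of paths. The first bound reparametrises the inverse generators; the second takes the
  inverses of the reparametrised ones.\<close>

lemma D1_reparam_equicontinuity:
  assumes G: "\<forall>i\<ge>1. G i \<in> gens" and cauchy: "D1_Cauchy A \<omega> n m h G" and \<epsilon>: "\<epsilon> > 0"
  shows "\<exists>\<delta>>0. \<exists>j0\<ge>1. \<forall>\<xi>1 \<xi>2.
     monotone_reparam \<xi>1 \<and> monotone_reparam \<xi>2 \<and> ham_norm (\<lambda>t. \<xi>1 t - \<xi>2 t) < \<delta> \<longrightarrow>
     (\<forall>i\<ge>j0.
        (D0 m h (reparam \<xi>1 (G i)) (reparam \<xi>2 (G i)) +
         D0 m h (reparam \<xi>1 (inverse_generator A \<omega> n (G i)))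
                (reparam \<xi>2 (inverse_generator A \<omega> n (G i)))) / 2 < \<epsilon> \<and>
        (\<xi>1 0 = 0 \<and> \<xi>2 0 = 0 \<longrightarrow> D1 A \<omega> n m h (reparam \<xi>1 (G i)) (reparam \<xi>2 (G i)) < \<epsilon>))"
proof -
  let ?inv = "inverse_generator A \<omega> n"
  note rep = represents_generator[OF G[rule_format]] represents_inverse[OF G[rule_format]]
  \<comment> \<open>Nonnegativity is what allows each summand of \<open>D1\<close> to be bounded by
    the sum.\<close>
  have nonneg: "D0 m h P Q \<ge> 0"
    if "represents P V l" "represents Q V' l'" "regular_path m C V l" "regular_path m C' V' l'" for P Q V V' l l' C C'
  proof -
    note reg = regular_path_diff[OF that(3,4)]
    have "osc_norm m (\<lambda>p. V t p - V' t p) (\<lambda>k. l t k - l' t k) \<ge> 0" if "t \<in> {0..1}" for t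
      using regular_pathD(1)[OF reg that that] by (rule osc_norm_nonneg)
    then show ?thesis
      unfolding D0_represents[OF that(1,2)]
      by (intro integral_nonneg integrable_continuous_real continuous_on_osc_norm[OF reg])
  qed
  have nonneg1: "D0 m h (G i) (G j) \<ge> 0" and nonneg2: "D0 m h (?inv (G i)) (?inv (G j)) \<ge> 0"
    if "i \<ge> 1" "j \<ge> 1" for i j
  proof -
    have Gij: "G i \<in> gens" "G j \<in> gens"
      using G that by auto
    obtain C C' where "regular_path m C (fst (G i)) (coords (G i))" "regular_path m C' (fst (G j)) (coords (G j))"
      using generator_regular_path[OF Gij(1)] generator_regular_path[OF Gij(2)] by blast
    then show "D0 m h (G i) (G j) \<ge> 0"
      by (rule nonneg[OF rep(1)[OF that(1)] rep(1)[OF that(2)]])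
    obtain C C' where "regular_path m C (inverse_potential (G i)) (\<lambda>t k. - coords (G i) t k)"
      "regular_path m C' (inverse_potential (G j)) (\<lambda>t k. - coords (G j) t k)"
      using inverse_regular_path[OF Gij(1)] inverse_regular_path[OF Gij(2)] by blast
    then show "D0 m h (?inv (G i)) (?inv (G j)) \<ge> 0"
      by (rule nonneg[OF rep(2)[OF that(1)] rep(2)[OF that(2)]])
  qed
  have small: "\<exists>N\<ge>1. \<forall>i\<ge>N. \<forall>j\<ge>N. D0 m h (G i) (G j) < e \<and> D0 m h (?inv (G i)) (?inv (G j)) < e"
    if "e > 0" for e
  proof -
    \<comment> \<open>\<open>D1\<close> is half the sum of the two distances, so a bound e/2 for it
      bounds each of them by e.\<close>
    from that have "e / 2 > 0"
      by simp
    then obtain N where N: "\<forall>i\<ge>N. \<forall>j\<ge>N. D1 A \<omega> n m h (G i) (G j) < e / 2"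
      using cauchy unfolding D1_Cauchy_def by blast
    have "D0 m h (G i) (G j) < e \<and> D0 m h (?inv (G i)) (?inv (G j)) < e"
      if ij: "i \<ge> max N 1" "j \<ge> max N 1" for i j
    proof -
      have "D1 A \<omega> n m h (G i) (G j) < e / 2"
        using N ij by simp
      then show ?thesis
        using nonneg1[of i j] nonneg2[of i j] ij unfolding D1_def by simp
    qed
    then show ?thesis
      by (intro exI[of _ "max N 1"]) auto
  qed
  define I where "I V l \<xi>1 \<xi>2 = integral {0..1} (\<lambda>t. osc_norm m
      (\<lambda>p. deriv01 \<xi>1 t * V (\<xi>1 t) p - deriv01 \<xi>2 t * V (\<xi>2 t) p)
      (\<lambda>k. deriv01 \<xi>1 t * l (\<xi>1 t) k - deriv01 \<xi>2 t * l (\<xi>2 t) k))"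
    for V :: "real \<Rightarrow> 'm \<Rightarrow> real" and l \<xi>1 \<xi>2
  have D0_I: "D0 m h P Q = I V l \<xi>1 \<xi>2"
    if "represents P (\<lambda>t p. deriv01 \<xi>1 t * V (\<xi>1 t) p) (\<lambda>t k. deriv01 \<xi>1 t * l (\<xi>1 t) k)"
      "represents Q (\<lambda>t p. deriv01 \<xi>2 t * V (\<xi>2 t) p) (\<lambda>t k. deriv01 \<xi>2 t * l (\<xi>2 t) k)" for P Q V l \<xi>1 \<xi>2
    unfolding I_def by (rule D0_represents[OF that])
  \<comment> \<open>Passes between \<open>D0\<close> and paths, once for the generators and once for
    their inverses.\<close>
  have equi: "\<exists>\<delta>>0. \<exists>j0\<ge>1. \<forall>\<xi>1 \<xi>2. monotone_reparam \<xi>1 \<and> monotone_reparam \<xi>2 \<and>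
      ham_norm (\<lambda>t. \<xi>1 t - \<xi>2 t) < \<delta> \<longrightarrow> (\<forall>i\<ge>j0. I (V i) (l i) \<xi>1 \<xi>2 < \<epsilon>)"
    if P: "\<And>i. i \<ge> 1 \<Longrightarrow> represents (P i) (V i) (l i)" and reg: "\<And>i. i \<ge> 1 \<Longrightarrow> \<exists>C. regular_path m C (V i) (l i)"
      and c: "\<And>e. e > 0 \<Longrightarrow> \<exists>N\<ge>1. \<forall>i\<ge>N. \<forall>j\<ge>N. D0 m h (P i) (P j) < e"
    for P :: "nat \<Rightarrow> ('m, 'n) generator" and V l
    unfolding I_def
  proof (rule reparam_equicontinuity[where V = V and l = l, OF _ _ \<epsilon>])
    show "\<exists>C. regular_path m C (V i) (l i)" if "i \<ge> 1" for i
      by (rule reg[OF that])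
    fix e :: real assume "e > 0"
    with c obtain N where N: "N \<ge> 1" "\<forall>i\<ge>N. \<forall>j\<ge>N. D0 m h (P i) (P j) < e"
      by blast
    then show "\<exists>N. \<forall>i\<ge>N. \<forall>j\<ge>N. integral {0..1} (\<lambda>t. osc_norm m (\<lambda>p. V i t p - V j t p) (\<lambda>k. l i t k - l j t k)) < e"
      by (intro exI[of _ N]) (auto simp: D0_represents[OF P P, symmetric])
  qed
  have "\<exists>\<delta>>0. \<exists>j0\<ge>1. \<forall>\<xi>1 \<xi>2. monotone_reparam \<xi>1 \<and> monotone_reparam \<xi>2 \<and>
      ham_norm (\<lambda>t. \<xi>1 t - \<xi>2 t) < \<delta> \<longrightarrow> (\<forall>i\<ge>j0. I (fst (G i)) (coords (G i)) \<xi>1 \<xi>2 < \<epsilon>)"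
  proof (rule equi[where P = G])
    show "\<exists>N\<ge>1. \<forall>i\<ge>N. \<forall>j\<ge>N. D0 m h (G i) (G j) < e" if "e > 0" for e
      using small[OF that] by blast
  qed (use rep(1) generator_regular_path G in auto)
  then obtain \<delta>1 j1 where 1: "\<delta>1 > 0" "j1 \<ge> 1"
    "\<And>\<xi>1 \<xi>2 i. monotone_reparam \<xi>1 \<Longrightarrow> monotone_reparam \<xi>2 \<Longrightarrow> ham_norm (\<lambda>t. \<xi>1 t - \<xi>2 t) < \<delta>1 \<Longrightarrow> i \<ge> j1 \<Longrightarrow>
        I (fst (G i)) (coords (G i)) \<xi>1 \<xi>2 < \<epsilon>"
    by blast
  have "\<exists>\<delta>>0. \<exists>j0\<ge>1. \<forall>\<xi>1 \<xi>2. monotone_reparam \<xi>1 \<and> monotone_reparam \<xi>2 \<and>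
      ham_norm (\<lambda>t. \<xi>1 t - \<xi>2 t) < \<delta> \<longrightarrow>
      (\<forall>i\<ge>j0. I (inverse_potential (G i)) (\<lambda>t k. - coords (G i) t k) \<xi>1 \<xi>2 < \<epsilon>)"
  proof (rule equi[where P = "\<lambda>i. ?inv (G i)"])
    show "\<exists>N\<ge>1. \<forall>i\<ge>N. \<forall>j\<ge>N. D0 m h (?inv (G i)) (?inv (G j)) < e" if "e > 0" for e
      using small[OF that] by blast
  qed (use rep(2) inverse_regular_path G in auto)
  then obtain \<delta>2 j2 where 2: "\<delta>2 > 0" "j2 \<ge> 1"
    "\<And>\<xi>1 \<xi>2 i. monotone_reparam \<xi>1 \<Longrightarrow> monotone_reparam \<xi>2 \<Longrightarrow> ham_norm (\<lambda>t. \<xi>1 t - \<xi>2 t) < \<delta>2 \<Longrightarrow> i \<ge> j2 \<Longrightarrow>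
        I (inverse_potential (G i)) (\<lambda>t k. - coords (G i) t k) \<xi>1 \<xi>2 < \<epsilon>"
    by blast
  show ?thesis
  proof (intro exI[of _ "min \<delta>1 \<delta>2"] exI[of _ "max j1 j2"] conjI allI impI)
    fix \<xi>1 \<xi>2 i
    assume *: "monotone_reparam \<xi>1 \<and> monotone_reparam \<xi>2 \<and> ham_norm (\<lambda>t. \<xi>1 t - \<xi>2 t) < min \<delta>1 \<delta>2"
      and i: "i \<ge> max j1 j2"
    then have \<xi>: "monotone_reparam \<xi>1" "monotone_reparam \<xi>2" and i1: "i \<ge> 1" and Gi: "G i \<in> gens"
      using 1(2) G by auto
    have a: "D0 m h (reparam \<xi>1 (G i)) (reparam \<xi>2 (G i)) < \<epsilon>"
      unfolding D0_I[OF represents_reparam[OF rep(1)[OF i1] \<xi>(1)] represents_reparam[OF rep(1)[OF i1] \<xi>(2)]]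
      using * i by (intro 1(3)) auto
    have b: "D0 m h (reparam \<xi>1 (?inv (G i))) (reparam \<xi>2 (?inv (G i))) < \<epsilon>"
      unfolding D0_I[OF represents_reparam[OF rep(2)[OF i1] \<xi>(1)] represents_reparam[OF rep(2)[OF i1] \<xi>(2)]]
      using * i by (intro 2(3)) auto
    from a b show "(D0 m h (reparam \<xi>1 (G i)) (reparam \<xi>2 (G i)) +
        D0 m h (reparam \<xi>1 (?inv (G i))) (reparam \<xi>2 (?inv (G i)))) / 2 < \<epsilon>"
      by simp
    assume "\<xi>1 0 = 0 \<and> \<xi>2 0 = 0"
    then have \<xi>0: "\<xi>1 0 = 0" "\<xi>2 0 = 0"
      by auto
    \<comment> \<open>The integral is the one already estimated for the reparametrised inverse
      generators, so the same \<delta> and index serve.\<close>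
    have "D0 m h (?inv (reparam \<xi>1 (G i))) (?inv (reparam \<xi>2 (G i))) < \<epsilon>"
      unfolding D0_I[OF represents_inverse_reparam[OF Gi \<xi>(1) \<xi>0(1)] represents_inverse_reparam[OF Gi \<xi>(2) \<xi>0(2)]]
      using * i by (intro 2(3)) auto
    with a show "D1 A \<omega> n m h (reparam \<xi>1 (G i)) (reparam \<xi>2 (G i)) < \<epsilon>"
      by (simp add: D1_def)
  qed (use 1 2 in auto)
qed

end

theorem lemma4p4:
  fixes A :: "('m::{t2_space, second_countable_topology}, 'n::finite) chart set"
    and \<omega> g :: "('m, 'n) tensor2"
    and n m :: nat
    and h :: "nat \<Rightarrow> ('m, 'n) tensor1"
    and G :: "nat \<Rightarrow> ('m, 'n) generator"
    and \<epsilon> :: real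
  assumes "CARD('n) = 2 * n"
    and "closed_connected_manifold A"
    and "symplectic_form A \<omega>"
    and "riemannian_metric A g"
    and "harmonic_basis A g m h"
    and "\<forall>i\<ge>1. G i \<in> generators A \<omega> g n m h"
    and "D1_Cauchy A \<omega> n m h G"
    and "\<epsilon> > 0"
  shows "\<exists>\<delta>>0. \<exists>j0\<ge>1. \<forall>\<xi>1 \<xi>2.
     monotone_reparam \<xi>1 \<and> monotone_reparam \<xi>2 \<and> ham_norm (\<lambda>t. \<xi>1 t - \<xi>2 t) < \<delta> \<longrightarrow>
     (\<forall>i\<ge>j0.
        (D0 m h (reparam \<xi>1 (G i)) (reparam \<xi>2 (G i)) +
         D0 m h (reparam \<xi>1 (inverse_generator A \<omega> n (G i)))
                (reparam \<xi>2 (inverse_generator A \<omega> n (G i)))) / 2 < \<epsilon> \<and>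
        (\<xi>1 0 = 0 \<and> \<xi>2 0 = 0 \<longrightarrow> D1 A \<omega> n m h (reparam \<xi>1 (G i)) (reparam \<xi>2 (G i)) < \<epsilon>))"
proof -
  interpret symplectic_manifold A \<omega> g n m h
    by unfold_locales fact+
  show ?thesis
    by (rule D1_reparam_equicontinuity) fact+
qed

end
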